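(* Let $\beta\in[0,2]$ be fixed, let $f(v)=v^3$, and for $\varepsilon\in(0,1]$ let $v=v(x,s)$ (depending on $\varepsilon$) be the exact solution of the oscillatory nonlinear Klein-Gordon equation on $\Omega=(a,b)$ with periodic boundary conditions, $$\varepsilon^{2\beta}\partial_{ss}v-\partial_{xx}v+v+\varepsilon^2v^3=0,\ x\in\Omega,\ s>0,\qquad v(x,0)=\phi(x),\quad \partial_sv(x,0)=\varepsilon^{-\beta}\gamma(x),\ x\in\overline\Omega,$$ where the real-valued functions $\phi,\gamma$ do not depend on $\varepsilon$. Let $0<T_0<T^*$ be fixed, with $T^*$ the maximum existence time of the solution. Assume that for some integer $m_0\ge2$ $$v\in L^\infty([0,T_0];H^{m_0}_p),\quad \partial_sv\in L^\infty([0,T_0];W^{1,4}),\quad \partial_{ss}v\in L^\infty([0,T_0];H^1),$$ $$\|v\|_{L^\infty([0,T_0];H^{m_0}_p)}\lesssim1,\quad \|\partial_sv\|_{L^\infty([0,T_0];W^{1,4})}\lesssim\frac1{\varepsilon^{\beta}},\quad \|\partial_{ss}v\|_{L^\infty([0,T_0];H^1)}\lesssim\frac1{\varepsilon^{2\beta}} .$$ Set $$\overline{M_1}:=\max_{\varepsilon\in(0,1]}\{\|v\|_{L^\infty([0,T_0];L^\infty)}+\varepsilon^{\beta}\|\partial_sv\|_{L^\infty([0,T_0];L^\infty)}\},\qquad \overline{M_2}:=\sup_{w\neq0,\ |w|\le1+\overline{M_1}}|w|^2 .$$ Let $v^n_M(x)$ be the approximation produced by the EWI-FS scheme for this equation (defined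 in the context) with mesh size $h=(b-a)/M$ ($M$ an even positive integer) and time step $k>0$, $s_n=nk$. Assume the stability condition $$0<k\le\frac{2\varepsilon^{\beta}h}{\sqrt{\pi^2+h^2(1+\varepsilon^2\bar\sigma_{\max})}}$$ (with $\bar\sigma_{\max}$ as defined in the context) and $$k\le\min\Big\{\frac14\varepsilon^{\beta},\ \frac{\varepsilon^{\beta}\pi h}{3\sqrt{h^2+\pi^2+\varepsilon^2\overline{M_2}h^2}}\Big\}.$$ Then there exist constants $h_0>0$ and $k_0>0$, sufficiently small and independent of $\varepsilon$, such that for any $0<\varepsilon\le1$, whenever $0<h\le h_0$ and $0<k\le\varepsilon^{\alpha^*}k_0$ with $\alpha^*=\max\{0,3\beta/2-1\}$ (with $0<k\le\frac{2\varepsilon^{\beta}h}{\sqrt{\pi^2+h^2(1+\varepsilon^2\bar\sigma_{\max})}}$ and $k\le\min\big\{\frac14\varepsilon^{\beta},\ \frac{\varepsilon^{\beta}\pi h}{3\sqrt{h^2+\pi^2+\varepsilon^2\overline{M_2}h^2}}\big\}$ satisfied), one has $$\|v(\cdot,s_n)-v^n_M\|_\lambda\lesssim h^{m_0-\lambda}+\varepsilon^{2-3\beta}k^2,\quad\lambda=0,1,\qquad \|v^n_M\|_{L^\infty}\le1+\overline{M_1},\qquad 0\le n\le\frac{T_0}{k}.$$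
   Context: Notation $p\lesssim q$: there is a generic constant $C>0$ independent of $h$, of the time step $k$ and of $\varepsilon$ such that $|p|\le Cq$. Sobolev spaces: for an integer $m\ge0$, $H^m(\Omega)$ carries the norm $\|z\|_m^2=\sum_{l\in\mathbb Z}(1+\mu_l^2)^m|\widehat z_l|^2$ for $z(x)=\sum_{l\in\mathbb Z}\widehat z_le^{i\mu_l(x-a)}$, where $\mu_l=\frac{2\pi l}{b-a}$; $m=0$ is $L^2(\Omega)$ (so $\|\cdot\|_0$ is the $L^2$ norm). $H^m_p(\Omega)$ is the subspace of $H^m(\Omega)$ of functions whose derivatives of order up to $m-1$ are $(b-a)$-periodic. $W^{1,4}$ is the usual Sobolev space on $\Omega$. Discretization notation: $M$ even positive integer, $h=(b-a)/M$, grid points $x_j=a+jh$ ($0\le j\le M$), $\mathcal T_M=\{-M/2,-M/2+1,\dots,M/2-1\}$. For a function $w$ on $\overline\Omega$, $\widehat w_l=\frac1{b-a}\int_a^b w(x)e^{-i\mu_l(x-a)}dx$; for a function or grid vector $w$ (with $w_j=w(x_j)$ for a function), $\widetilde w_l=\frac1M\sum_{j=0}^{M-1}w_je^{-i\mu_l(x_j-a)}$. $P_M$ is the $L^2$-projection: $(P_Mw)(x)=\sum_{l\in\mathcal T_M}\widehat w_le^{i\mu_l(x-a)}$. Put $\bar\zeta_l=\varepsilon^{-\beta}\sqrt{1+\mu_l^2}$ and $$\bar p_l=\cos(k\bar\zeta_l),\quad \bar q_l=\frac{\sin(k\bar\zeta_l)}{\varepsilon^{\beta}\bar\zeta_l},\quad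 \bar r_l=\frac{\varepsilon^2(\cos(k\bar\zeta_l)-1)}{(\varepsilon^{\beta}\bar\zeta_l)^2}.$$ EWI-FS scheme (Gautschi-type exponential wave integrator Fourier spectral): $v^0_M=P_M\phi$ and, for $n\ge0$, $v^{n+1}_M(x)=\sum_{l\in\mathcal T_M}\widehat{(v^{n+1}_M)}_le^{i\mu_l(x-a)}$, where for $l\in\mathcal T_M$ $$\widehat{(v^1_M)}_l=\bar p_l\widehat\phi_l+\bar q_l\widehat\gamma_l+\bar r_l\widehat{(f(\phi))}_l,\qquad \widehat{(v^{n+1}_M)}_l=-\widehat{(v^{n-1}_M)}_l+2\bar p_l\widehat{(v^n_M)}_l+2\bar r_l\widehat{(f(v^n_M))}_l\quad(n\ge1).$$ EWI-FP scheme (pseudospectral version): $v^0_j=\phi(x_j)$ and, for $n\ge 0$, $v^{n+1}_j=\sum_{l\in\mathcal T_M}\widetilde v^{n+1}_le^{i\mu_l(x_j-a)}$ ($0\le j\le M$), where for $l\in\mathcal T_M$ $$\widetilde v^1_l=\bar p_l\widetilde\phi_l+\bar q_l\widetilde\gamma_l+\bar r_l\widetilde{(f(\phi))}_l,\qquad \widetilde v^{n+1}_l=-\widetilde v^{n-1}_l+2\bar p_l\widetilde v^n_l+2\bar r_l\widetilde{(f(v^n))}_l\quad(n\ge1).$$ The quantity in the stability condition is $\bar\sigma_{\max}:=\max_{0\le n\le T_0/k}\|v^n\|_{l^\infty}^2$, where $v^n=(v^n_0,\dots,v^n_M)$ is the EWI-FP numerical solution and $\|w\|_{l^\infty}=\max_{0\le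 j\le M-1}|w_j|$. *)

theory Defs
  imports "HOL-Analysis.Analysis" "HOL-Probability.Essential_Supremum"
begin

(* Norms take values in ereal and are \<infinity> outside the space; thus "norm \<le> ereal C" also
   asserts membership. Real-valued functions are embedded by complex_of_real where the
   space consists of complex-valued functions. *)

section \<open>Lebesgue and Sobolev spaces on an interval\<close>

definition Linf_norm :: "real \<Rightarrow> real \<Rightarrow> (real \<Rightarrow> 'a::real_normed_vector) \<Rightarrow> ereal" where
  "Linf_norm a b w = esssup (lebesgue_on {a..b}) (\<lambda>x. ereal (norm (w x)))"

(* The norm of L^\<infinity>([0,T]; X), where N is the norm of X; recall that esssup is \<infinity> if
   the function s \<mapsto> N (u s) is not measurable. *)
definition Linf_time :: "real \<Rightarrow> ('b \<Rightarrow> ereal) \<Rightarrow> (real \<Rightarrow> 'b) \<Rightarrow> ereal" where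
  "Linf_time T N u = esssup (lebesgue_on {0..T}) (\<lambda>s. N (u s))"

definition in_Lp ::
  "real \<Rightarrow> real \<Rightarrow> real \<Rightarrow> (real \<Rightarrow> 'a::{banach,second_countable_topology}) \<Rightarrow> bool" where
  "in_Lp a b p w \<longleftrightarrow> w \<in> borel_measurable (lebesgue_on {a..b})
     \<and> integrable (lebesgue_on {a..b}) (\<lambda>x. norm (w x) powr p)"

definition test_function :: "real \<Rightarrow> real \<Rightarrow> (real \<Rightarrow> real) \<Rightarrow> bool" where
  "test_function a b \<psi> \<longleftrightarrow> (\<forall>n x. (deriv ^^ n) \<psi> differentiable (at x))
     \<and> (\<exists>c d. a < c \<and> d < b \<and> (\<forall>x. x \<notin> {c..d} \<longrightarrow> \<psi> x = 0))"

definition locally_integrable ::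
  "real \<Rightarrow> real \<Rightarrow> (real \<Rightarrow> 'a::{banach,second_countable_topology}) \<Rightarrow> bool" where
  "locally_integrable a b w \<longleftrightarrow>
     (\<forall>c d. a < c \<longrightarrow> d < b \<longrightarrow> integrable (lebesgue_on {c..d}) w)"

definition has_weak_deriv ::
  "real \<Rightarrow> real \<Rightarrow> (real \<Rightarrow> 'a::{banach,second_countable_topology}) \<Rightarrow> (real \<Rightarrow> 'a) \<Rightarrow> bool" where
  "has_weak_deriv a b w g \<longleftrightarrow> locally_integrable a b w \<and> locally_integrable a b g
     \<and> (\<forall>\<psi>. test_function a b \<psi> \<longrightarrow>
          (LINT x|lebesgue_on {a..b}. deriv \<psi> x *\<^sub>R w x)
            = - (LINT x|lebesgue_on {a..b}. \<psi> x *\<^sub>R g x))"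

(* g j is the j-th weak derivative of w, for j \<le> m, and all of these lie in L^p(a,b). *)
definition weak_derivs ::
  "real \<Rightarrow> real \<Rightarrow> nat \<Rightarrow> real \<Rightarrow> (real \<Rightarrow> 'a::{banach,second_countable_topology})
     \<Rightarrow> (nat \<Rightarrow> real \<Rightarrow> 'a) \<Rightarrow> bool" where
  "weak_derivs a b m p w g \<longleftrightarrow> g 0 = w
     \<and> (\<forall>j<m. has_weak_deriv a b (g j) (g (Suc j)))
     \<and> (\<forall>j\<le>m. in_Lp a b p (g j))"

(* Weak derivatives are unique almost everywhere, so the infimum is over at most one value;
   it is \<infinity> if w does not belong to W^{m,p}(a,b). *)
definition W_norm ::
  "real \<Rightarrow> real \<Rightarrow> nat \<Rightarrow> real \<Rightarrow> (real \<Rightarrow> 'a::{banach,second_countable_topology}) \<Rightarrow> ereal" where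
  "W_norm a b m p w =
     Inf {ereal ((\<Sum>j\<le>m. LINT x|lebesgue_on {a..b}. norm (g j x) powr p) powr (1 / p)) | g.
            weak_derivs a b m p w g}"

definition mu :: "real \<Rightarrow> real \<Rightarrow> int \<Rightarrow> real" where
  "mu a b l = 2 * pi * of_int l / (b - a)"

definition fourier_coeff :: "real \<Rightarrow> real \<Rightarrow> (real \<Rightarrow> complex) \<Rightarrow> int \<Rightarrow> complex" where
  "fourier_coeff a b w l =
     1 / complex_of_real (b - a) *
       (LINT x|lebesgue_on {a..b}. w x * exp (- (\<i> * complex_of_real (mu a b l * (x - a)))))"

(* H^m(a,b) = W^{m,2}(a,b), normed through the Fourier coefficients; the norm is \<infinity> if the
   Fourier sum diverges. *)
definition H_norm :: "real \<Rightarrow> real \<Rightarrow> nat \<Rightarrow> (real \<Rightarrow> complex) \<Rightarrow> ereal" where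
  "H_norm a b m w =
     (let c = (\<lambda>l. (1 + (mu a b l)\<^sup>2) ^ m * (cmod (fourier_coeff a b w l))\<^sup>2)
      in if (\<exists>g. weak_derivs a b m 2 w g) \<and> c summable_on UNIV
         then ereal (sqrt (\<Sum>\<^sub>\<infinity>l. c l)) else \<infinity>)"

(* Boundary values of a derivative of order j < m are those of its continuous representative. *)
definition in_Hp :: "real \<Rightarrow> real \<Rightarrow> nat \<Rightarrow> (real \<Rightarrow> complex) \<Rightarrow> bool" where
  "in_Hp a b m w \<longleftrightarrow> (\<exists>g. weak_derivs a b m 2 w g
     \<and> (\<forall>j<m. \<exists>r. continuous_on {a..b} r \<and> (AE x in lebesgue_on {a..b}. g j x = r x)
                   \<and> r a = r b))"

definition Hp_norm :: "real \<Rightarrow> real \<Rightarrow> nat \<Rightarrow> (real \<Rightarrow> complex) \<Rightarrow> ereal" where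
  "Hp_norm a b m w = (if in_Hp a b m w then H_norm a b m w else \<infinity>)"


section \<open>The oscillatory nonlinear Klein-Gordon equation\<close>

(* Functions of time s and space x are written u s x. The derivatives are one-sided at s = 0
   and at the end points of [a,b]. *)
definition dt :: "(real \<Rightarrow> real \<Rightarrow> real) \<Rightarrow> real \<Rightarrow> real \<Rightarrow> real" where
  "dt u s x = vector_derivative (\<lambda>r. u r x) (at s within {0..})"

definition dx :: "real \<Rightarrow> real \<Rightarrow> (real \<Rightarrow> real \<Rightarrow> real) \<Rightarrow> real \<Rightarrow> real \<Rightarrow> real" where
  "dx a b u s x = vector_derivative (u s) (at x within {a..b})"

(* u is a classical solution on the time interval [0,T). *)
definition kg_solution ::
  "real \<Rightarrow> real \<Rightarrow> real \<Rightarrow> real \<Rightarrow> (real \<Rightarrow> real) \<Rightarrow> (real \<Rightarrow> real) \<Rightarrow> ereal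
     \<Rightarrow> (real \<Rightarrow> real \<Rightarrow> real) \<Rightarrow> bool" where
  "kg_solution a b \<beta> \<epsilon> \<phi> \<gamma> T u \<longleftrightarrow>
     (let I = {s. 0 \<le> s \<and> ereal s < T} in
       (\<forall>w \<in> {u, dt u, dt (dt u), dx a b u, dx a b (dx a b u)}.
           continuous_on (I \<times> {a..b}) (\<lambda>(s, x). w s x))
     \<and> (\<forall>w \<in> {u, dt u}. \<forall>s\<in>I. \<forall>x\<in>{a..b}. (\<lambda>r. w r x) differentiable (at s within {0..}))
     \<and> (\<forall>w \<in> {u, dx a b u}. \<forall>s\<in>I. \<forall>x\<in>{a..b}. w s differentiable (at x within {a..b}))
     \<and> (\<forall>s\<in>I. \<forall>x\<in>{a<..<b}. 0 < s \<longrightarrow>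
           \<epsilon> powr (2 * \<beta>) * dt (dt u) s x - dx a b (dx a b u) s x + u s x
             + \<epsilon>\<^sup>2 * (u s x) ^ 3 = 0)
     \<and> (\<forall>s\<in>I. u s a = u s b \<and> dx a b u s a = dx a b u s b)
     \<and> (\<forall>x\<in>{a..b}. u 0 x = \<phi> x \<and> dt u 0 x = \<epsilon> powr (- \<beta>) * \<gamma> x))"

definition max_existence_time ::
  "real \<Rightarrow> real \<Rightarrow> real \<Rightarrow> real \<Rightarrow> (real \<Rightarrow> real) \<Rightarrow> (real \<Rightarrow> real) \<Rightarrow> ereal" where
  "max_existence_time a b \<beta> \<epsilon> \<phi> \<gamma> = Sup {T. 0 < T \<and> (\<exists>u. kg_solution a b \<beta> \<epsilon> \<phi> \<gamma> T u)}"

definition M1_bar :: "real \<Rightarrow> real \<Rightarrow> real \<Rightarrow> real \<Rightarrow> (real \<Rightarrow> real \<Rightarrow> real \<Rightarrow> real) \<Rightarrow> ereal" where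
  "M1_bar a b \<beta> T0 v =
     (SUP \<epsilon>\<in>{0<..1}. Linf_time T0 (Linf_norm a b) (v \<epsilon>)
        + ereal (\<epsilon> powr \<beta>) * Linf_time T0 (Linf_norm a b) (dt (v \<epsilon>)))"

definition M2_bar :: "real \<Rightarrow> real \<Rightarrow> real \<Rightarrow> real \<Rightarrow> (real \<Rightarrow> real \<Rightarrow> real \<Rightarrow> real) \<Rightarrow> ereal" where
  "M2_bar a b \<beta> T0 v =
     (SUP w\<in>{w::real. w \<noteq> 0 \<and> ereal \<bar>w\<bar> \<le> 1 + M1_bar a b \<beta> T0 v}. ereal (\<bar>w\<bar>\<^sup>2))"


section \<open>The exponential wave integrators\<close>

definition modes :: "nat \<Rightarrow> int set" where
  "modes M = {- (int M div 2) .. int M div 2 - 1}"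

definition trig_poly :: "real \<Rightarrow> real \<Rightarrow> nat \<Rightarrow> (int \<Rightarrow> complex) \<Rightarrow> real \<Rightarrow> complex" where
  "trig_poly a b M c x =
     (\<Sum>l\<in>modes M. c l * exp (\<i> * complex_of_real (mu a b l * (x - a))))"

definition zeta_bar :: "real \<Rightarrow> real \<Rightarrow> real \<Rightarrow> real \<Rightarrow> int \<Rightarrow> real" where
  "zeta_bar a b \<beta> \<epsilon> l = \<epsilon> powr (- \<beta>) * sqrt (1 + (mu a b l)\<^sup>2)"

definition p_bar :: "real \<Rightarrow> real \<Rightarrow> real \<Rightarrow> real \<Rightarrow> real \<Rightarrow> int \<Rightarrow> complex" where
  "p_bar a b \<beta> \<epsilon> k l = complex_of_real (cos (k * zeta_bar a b \<beta> \<epsilon> l))"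

definition q_bar :: "real \<Rightarrow> real \<Rightarrow> real \<Rightarrow> real \<Rightarrow> real \<Rightarrow> int \<Rightarrow> complex" where
  "q_bar a b \<beta> \<epsilon> k l =
     complex_of_real (sin (k * zeta_bar a b \<beta> \<epsilon> l) / (\<epsilon> powr \<beta> * zeta_bar a b \<beta> \<epsilon> l))"

definition r_bar :: "real \<Rightarrow> real \<Rightarrow> real \<Rightarrow> real \<Rightarrow> real \<Rightarrow> int \<Rightarrow> complex" where
  "r_bar a b \<beta> \<epsilon> k l =
     complex_of_real (\<epsilon>\<^sup>2 * (cos (k * zeta_bar a b \<beta> \<epsilon> l) - 1)
                        / (\<epsilon> powr \<beta> * zeta_bar a b \<beta> \<epsilon> l)\<^sup>2)"

(* The numerical solutions are complex-valued since modes M is not symmetric: the mode -M/2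
   has no counterpart M/2. *)
fun ewi_fs ::
  "real \<Rightarrow> real \<Rightarrow> real \<Rightarrow> real \<Rightarrow> (real \<Rightarrow> real) \<Rightarrow> (real \<Rightarrow> real) \<Rightarrow> nat \<Rightarrow> real
     \<Rightarrow> nat \<Rightarrow> real \<Rightarrow> complex" where
  "ewi_fs a b \<beta> \<epsilon> \<phi> \<gamma> M k 0 =
     trig_poly a b M (fourier_coeff a b (\<lambda>x. complex_of_real (\<phi> x)))"
| "ewi_fs a b \<beta> \<epsilon> \<phi> \<gamma> M k (Suc 0) =
     trig_poly a b M (\<lambda>l.
         p_bar a b \<beta> \<epsilon> k l * fourier_coeff a b (\<lambda>x. complex_of_real (\<phi> x)) l
       + q_bar a b \<beta> \<epsilon> k l * fourier_coeff a b (\<lambda>x. complex_of_real (\<gamma> x)) l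
       + r_bar a b \<beta> \<epsilon> k l * fourier_coeff a b (\<lambda>x. (complex_of_real (\<phi> x)) ^ 3) l)"
| "ewi_fs a b \<beta> \<epsilon> \<phi> \<gamma> M k (Suc (Suc n)) =
     trig_poly a b M (\<lambda>l.
       - fourier_coeff a b (ewi_fs a b \<beta> \<epsilon> \<phi> \<gamma> M k n) l
       + 2 * p_bar a b \<beta> \<epsilon> k l * fourier_coeff a b (ewi_fs a b \<beta> \<epsilon> \<phi> \<gamma> M k (Suc n)) l
       + 2 * r_bar a b \<beta> \<epsilon> k l
           * fourier_coeff a b (\<lambda>x. (ewi_fs a b \<beta> \<epsilon> \<phi> \<gamma> M k (Suc n) x) ^ 3) l)"

definition grid :: "real \<Rightarrow> real \<Rightarrow> nat \<Rightarrow> nat \<Rightarrow> real" where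
  "grid a b M j = a + real j * ((b - a) / real M)"

definition discrete_coeff :: "real \<Rightarrow> real \<Rightarrow> nat \<Rightarrow> (nat \<Rightarrow> complex) \<Rightarrow> int \<Rightarrow> complex" where
  "discrete_coeff a b M w l =
     1 / of_nat M * (\<Sum>j<M. w j * exp (- (\<i> * complex_of_real (mu a b l * (grid a b M j - a)))))"

(* ewi_fp \<dots> n j is the value at the grid point x_j; only 0 \<le> j \<le> M is meaningful. *)
fun ewi_fp ::
  "real \<Rightarrow> real \<Rightarrow> real \<Rightarrow> real \<Rightarrow> (real \<Rightarrow> real) \<Rightarrow> (real \<Rightarrow> real) \<Rightarrow> nat \<Rightarrow> real
     \<Rightarrow> nat \<Rightarrow> nat \<Rightarrow> complex" where
  "ewi_fp a b \<beta> \<epsilon> \<phi> \<gamma> M k 0 = (\<lambda>j. complex_of_real (\<phi> (grid a b M j)))"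
| "ewi_fp a b \<beta> \<epsilon> \<phi> \<gamma> M k (Suc 0) =
     (\<lambda>j. trig_poly a b M (\<lambda>l.
         p_bar a b \<beta> \<epsilon> k l * discrete_coeff a b M (\<lambda>i. complex_of_real (\<phi> (grid a b M i))) l
       + q_bar a b \<beta> \<epsilon> k l * discrete_coeff a b M (\<lambda>i. complex_of_real (\<gamma> (grid a b M i))) l
       + r_bar a b \<beta> \<epsilon> k l
           * discrete_coeff a b M (\<lambda>i. (complex_of_real (\<phi> (grid a b M i))) ^ 3) l)
       (grid a b M j))"
| "ewi_fp a b \<beta> \<epsilon> \<phi> \<gamma> M k (Suc (Suc n)) =
     (\<lambda>j. trig_poly a b M (\<lambda>l.
       - discrete_coeff a b M (ewi_fp a b \<beta> \<epsilon> \<phi> \<gamma> M k n) l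
       + 2 * p_bar a b \<beta> \<epsilon> k l * discrete_coeff a b M (ewi_fp a b \<beta> \<epsilon> \<phi> \<gamma> M k (Suc n)) l
       + 2 * r_bar a b \<beta> \<epsilon> k l
           * discrete_coeff a b M (\<lambda>i. (ewi_fp a b \<beta> \<epsilon> \<phi> \<gamma> M k (Suc n) i) ^ 3) l)
       (grid a b M j))"

definition linf_norm :: "nat \<Rightarrow> (nat \<Rightarrow> complex) \<Rightarrow> real" where
  "linf_norm M w = Max ((\<lambda>j. cmod (w j)) ` {0..M - 1})"

definition sigma_max ::
  "real \<Rightarrow> real \<Rightarrow> real \<Rightarrow> real \<Rightarrow> (real \<Rightarrow> real) \<Rightarrow> (real \<Rightarrow> real) \<Rightarrow> nat \<Rightarrow> real \<Rightarrow> real \<Rightarrow> real" where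
  "sigma_max a b \<beta> \<epsilon> \<phi> \<gamma> M k T0 =
     Max ((\<lambda>n. (linf_norm M (ewi_fp a b \<beta> \<epsilon> \<phi> \<gamma> M k n))\<^sup>2) ` {n. real n \<le> T0 / k})"

end

theory Submission
  imports Defs
begin

text \<open>The error \<open>v(s_n) - v_M^n\<close> is studied mode by mode. The Fourier coefficients \<open>V_l(s)\<close> of the exact
solution solve the oscillator equations \<open>V_l'' + \<zeta>_l^2 V_l = - \<epsilon>^(2-2\<beta>) (v^3)_l\<close>, and the scheme
integrates the oscillator exactly while freezing the cubic term over a step. Three estimates carry
the proof.

\<^item> Consistency. Freezing \<open>v^3\<close> costs a symmetric second difference in time, which is
\<open>O(\<epsilon>^(-2\<beta>) k^2)\<close> uniformly in space. Indeed \<open>v\<close> and \<open>\<epsilon>^(2\<beta>) v_ss\<close> are uniformly bounded,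
because they are bounded in \<open>H^1\<close>, and a bound for \<open>\<epsilon>^\<beta> v_s\<close> follows by interpolation
(\<open>derivative_interpolation\<close>). By Duhamel's principle the local error of one step is therefore
\<open>O(\<epsilon>^(2-4\<beta>) k^4)\<close> in \<open>L^2\<close> (\<open>local_error\<close>).

\<^item> Stability. The errors \<open>e^n_l\<close> of the modes satisfy
\<open>e^(n+1) = 2 cos(k \<zeta>_l) e^n - e^(n-1) + r^n\<close>, with fundamental solution
\<open>sin(m k \<zeta>_l) / sin(k \<zeta>_l)\<close>. The restriction of \<open>k\<close> by \<open>\<epsilon>^\<beta> h\<close> keeps \<open>k \<zeta>_l\<close> below \<open>\<pi>/3\<close>, so
this is at most \<open>2 / (k \<zeta>_l) = 2 \<epsilon>^\<beta> / (k sqrt(1 + \<mu>_l^2))\<close>. The factor \<open>1 / sqrt(1 + \<mu>_l^2)\<close>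
turns \<open>L^2\<close> bounds of the residuals \<open>r^n\<close> into an \<open>H^1\<close> bound of the error (\<open>stability\<close>); the
\<open>T0/k\<close> local errors add up to \<open>O(\<epsilon>^(2-3\<beta>) k^2)\<close>.

\<^item> Nonlinearity. As long as the numerical solution is bounded by \<open>1 + sup |v|\<close>, the cubic terms differ
by a constant times the error in \<open>L^2\<close> and enter with the factor \<open>k \<epsilon>^(2-\<beta>) \<le> k\<close>, so that a
discrete Gronwall argument closes the estimate in \<open>H^1\<close> (\<open>Hnorm_bound\<close>). The Sobolev embedding
\<open>H^1 \<subseteq> L^\<infinity>\<close> then shows that the numerical solution deviates from \<open>v\<close> by at most \<open>1\<close> at the next
step as well, provided that \<open>h\<close> and \<open>\<epsilon>^(2-3\<beta>) k^2\<close> are small (\<open>error_bound\<close>). This is where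
\<open>\<alpha>* = max {0, 3\<beta>/2 - 1}\<close> comes from.

The Sobolev embedding and Parseval's inequality rest on the completeness of the trigonometric system,
which is derived from the Stone-Weierstrass theorem on the unit circle. The hypotheses bound norms for
almost every time only; the bounds hold at every time because the Fourier coefficients of a classical
solution are continuous in time (\<open>H_bounded_all_times\<close>).\<close>

section \<open>Fourier coefficients on an interval\<close>

definition mode :: "real \<Rightarrow> real \<Rightarrow> int \<Rightarrow> real \<Rightarrow> complex" where
  "mode a b l x = exp (\<i> * complex_of_real (mu a b l * (x - a)))"

definition mean :: "real \<Rightarrow> real \<Rightarrow> (real \<Rightarrow> complex) \<Rightarrow> complex" where
  "mean a b w = integral {a..b} w / complex_of_real (b - a)"

definition mean_square :: "real \<Rightarrow> real \<Rightarrow> (real \<Rightarrow> complex) \<Rightarrow> real" where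
  "mean_square a b w = integral {a..b} (\<lambda>x. (cmod (w x))\<^sup>2) / (b - a)"

lemma trig_poly_mode: "trig_poly a b M c = (\<lambda>x. \<Sum>l\<in>modes M. c l * mode a b l x)"
  by (simp add: trig_poly_def mode_def fun_eq_iff)

lemma mu_add: "mu a b (l + m) = mu a b l + mu a b m"
  by (simp add: mu_def algebra_simps add_divide_distrib)

lemma mu_uminus: "mu a b (- l) = - mu a b l"
  by (simp add: mu_def)

lemma mode_0 [simp]: "mode a b 0 x = 1"
  by (simp add: mode_def mu_def)

lemma mode_add: "mode a b (l + m) x = mode a b l x * mode a b m x"
  by (simp add: mode_def mu_add exp_add[symmetric] algebra_simps)

lemma cnj_mode: "cnj (mode a b l x) = mode a b (- l) x"
  by (simp add: mode_def mu_uminus exp_cnj)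

lemma norm_mode [simp]: "cmod (mode a b l x) = 1"
  by (simp add: mode_def norm_exp_eq_Re)

lemma continuous_on_mode [continuous_intros]: "continuous_on A (mode a b l)"
  unfolding mode_def by (intro continuous_intros)

lemma mode_left [simp]: "mode a b l a = 1"
  by (simp add: mode_def)

lemma mode_has_vector_derivative:
  "(mode a b l has_vector_derivative \<i> * mu a b l * mode a b l x) (at x within S)"
  unfolding mode_def
  by (auto intro!: derivative_eq_intros has_vector_derivative_real_field simp: algebra_simps)

lemma mean_add:
  assumes "continuous_on {a..b} w" "continuous_on {a..b} z"
  shows "mean a b (\<lambda>x. w x + z x) = mean a b w + mean a b z"
  using assms by (simp add: mean_def integral_add integrable_continuous_real add_divide_distrib)

lemma mean_diff:
  assumes "continuous_on {a..b} w" "continuous_on {a..b} z"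
  shows "mean a b (\<lambda>x. w x - z x) = mean a b w - mean a b z"
  using assms by (simp add: mean_def integral_diff integrable_continuous_real diff_divide_distrib)

lemma mean_cmult: "mean a b (\<lambda>x. c * w x) = c * mean a b w"
  by (simp add: mean_def)

lemma mean_sum:
  assumes "finite F" "\<And>l. l \<in> F \<Longrightarrow> continuous_on {a..b} (w l)"
  shows "mean a b (\<lambda>x. \<Sum>l\<in>F. w l x) = (\<Sum>l\<in>F. mean a b (w l))"
  using assms by (simp add: mean_def integral_sum integrable_continuous_real sum_divide_distrib)

lemma mean_cnj: "mean a b (\<lambda>x. cnj (w x)) = cnj (mean a b w)"
  by (simp add: mean_def integral_cnj)

lemma mean_square_eq: assumes w: "continuous_on {a..b} w" shows "complex_of_real (mean_square a b w) = mean a b (\<lambda>x. w x * cnj (w x))"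
proof -
  have "(\<lambda>x. w x * cnj (w x)) = (\<lambda>x. complex_of_real ((cmod (w x))\<^sup>2))"
    by (metis complex_norm_square)
  moreover have "integral {a..b} (\<lambda>x. complex_of_real ((cmod (w x))\<^sup>2))
      = complex_of_real (integral {a..b} (\<lambda>x. (cmod (w x))\<^sup>2))"
    using integral_linear[OF _ bounded_linear_of_real, of "\<lambda>x. (cmod (w x))\<^sup>2" "{a..b}"] w
    by (simp add: o_def integrable_continuous_real continuous_intros)
  ultimately show ?thesis by (simp add: mean_def mean_square_def)
qed

lemma fourier_coeff_cmult:
  "fourier_coeff a b (\<lambda>x. c * w x) l = c * fourier_coeff a b w l"
  by (simp add: fourier_coeff_def mult.assoc)

lemma fourier_coeff_cong:
  assumes "\<And>x. x \<in> {a..b} \<Longrightarrow> w x = z x"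
  shows "fourier_coeff a b w l = fourier_coeff a b z l"
proof -
  have "(LINT x|lebesgue_on {a..b}. w x * exp (- (\<i> * complex_of_real (mu a b l * (x - a)))))
     = (LINT x|lebesgue_on {a..b}. z x * exp (- (\<i> * complex_of_real (mu a b l * (x - a)))))"
    using assms by (intro Bochner_Integration.integral_cong) auto
  then show ?thesis by (simp add: fourier_coeff_def)
qed

context
  fixes a b :: real
  assumes ab: "a < b"
begin

lemma mode_right [simp]: "mode a b l b = 1"
proof -
  have "mu a b l * (b - a) = 2 * of_int l * pi"
    using ab by (simp add: mu_def)
  then show ?thesis using exp_integer_2pi[of "of_int l"] by (simp add: mode_def mult_ac)
qed

lemma fourier_coeff_mean:
  assumes "continuous_on {a..b} w"
  shows "fourier_coeff a b w l = mean a b (\<lambda>x. w x * mode a b (- l) x)"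
proof -
  have c: "continuous_on {a..b} (\<lambda>x. w x * mode a b (- l) x)"
    using assms by (intro continuous_intros)
  have "(\<lambda>x. w x * exp (- (\<i> * complex_of_real (mu a b l * (x - a))))) = (\<lambda>x. w x * mode a b (- l) x)"
    by (simp add: mode_def mu_uminus fun_eq_iff)
  then show ?thesis unfolding fourier_coeff_def mean_def
    using lebesgue_integral_eq_integral[OF continuous_imp_integrable_real[OF c]] by simp
qed

lemma cmod_mean_le:
  assumes "continuous_on {a..b} w" "\<And>x. x \<in> {a..b} \<Longrightarrow> cmod (w x) \<le> B"
  shows "cmod (mean a b w) \<le> B"
proof -
  have "cmod (integral {a..b} w) \<le> B * (b - a)"
    using assms ab by (intro integral_bound) auto
  moreover have "cmod (complex_of_real (b - a)) = b - a"
    unfolding norm_of_real using ab by simp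
  ultimately show ?thesis using ab by (simp add: mean_def norm_divide pos_divide_le_eq del: of_real_diff)
qed

lemma mean_mode: "mean a b (mode a b l) = (if l = 0 then 1 else 0)"
proof (cases "l = 0")
  case True
  have "mode a b 0 = (\<lambda>x. 1)" by (simp add: fun_eq_iff)
  then show ?thesis using ab True by (simp add: mean_def scaleR_conv_of_real)
next
  case False
  then have m: "mu a b l \<noteq> 0" using ab by (simp add: mu_def)
  have "((\<lambda>x. \<i> * mu a b l * mode a b l x) has_integral (mode a b l b - mode a b l a)) {a..b}"
    using ab by (intro fundamental_theorem_of_calculus mode_has_vector_derivative) auto
  then have "mean a b (\<lambda>x. (\<i> * mu a b l) * mode a b l x) = 0"
    unfolding mean_def by (subst integral_unique) auto
  then show ?thesis using m False by (simp only: mean_cmult) simp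
qed

lemma mean_square_nonneg: "0 \<le> mean_square a b w"
  using ab unfolding mean_square_def
  by (cases "(\<lambda>x. (cmod (w x))\<^sup>2) integrable_on {a..b}")
    (auto intro!: divide_nonneg_pos Henstock_Kurzweil_Integration.integral_nonneg simp: not_integrable_integral)

lemma mean_square_mono:
  assumes "continuous_on {a..b} w" "continuous_on {a..b} z"
    and "\<And>x. x \<in> {a..b} \<Longrightarrow> cmod (w x) \<le> c * cmod (z x)"
  shows "mean_square a b w \<le> c\<^sup>2 * mean_square a b z"
proof -
  have "integral {a..b} (\<lambda>x. (cmod (w x))\<^sup>2) \<le> integral {a..b} (\<lambda>x. c\<^sup>2 * (cmod (z x))\<^sup>2)"
    using assms by (intro integral_le integrable_continuous_real continuous_intros)
      (auto simp flip: power_mult_distrib intro!: power_mono)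
  then show ?thesis using ab by (simp add: mean_square_def divide_right_mono)
qed

lemma mean_square_le_sup:
  assumes "continuous_on {a..b} w" "\<And>x. x \<in> {a..b} \<Longrightarrow> cmod (w x) \<le> B"
  shows "mean_square a b w \<le> B\<^sup>2"
proof -
  have "mean_square a b w \<le> B\<^sup>2 * mean_square a b (\<lambda>x. 1)"
    using assms by (intro mean_square_mono) auto
  moreover have "mean_square a b (\<lambda>x. 1) = 1" using ab by (simp add: mean_square_def)
  ultimately show ?thesis by simp
qed

lemma fourier_coeff_trig_sum:
  assumes "finite F"
  shows "fourier_coeff a b (\<lambda>x. \<Sum>l\<in>F. c l * mode a b l x) m = (if m \<in> F then c m else 0)"
proof -
  have "fourier_coeff a b (\<lambda>x. \<Sum>l\<in>F. c l * mode a b l x) m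
      = mean a b (\<lambda>x. \<Sum>l\<in>F. c l * mode a b (l - m) x)"
    by (subst fourier_coeff_mean)
      (auto intro!: continuous_intros simp: sum_distrib_right mode_add[symmetric] mult.assoc)
  also have "\<dots> = (\<Sum>l\<in>F. c l * (if l = m then 1 else 0))"
    using assms by (subst mean_sum) (auto intro!: continuous_intros simp: mean_cmult mean_mode)
  also have "\<dots> = (if m \<in> F then c m else 0)"
    using assms by (simp add: sum.delta' if_distrib cong: if_cong)
  finally show ?thesis .
qed

lemma fourier_coeff_add:
  assumes "continuous_on {a..b} w" "continuous_on {a..b} z"
  shows "fourier_coeff a b (\<lambda>x. w x + z x) l = fourier_coeff a b w l + fourier_coeff a b z l"
  using assms
  by (simp add: fourier_coeff_mean continuous_on_add distrib_right mean_add continuous_on_mult continuous_on_mode)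

lemma fourier_coeff_diff:
  assumes "continuous_on {a..b} w" "continuous_on {a..b} z"
  shows "fourier_coeff a b (\<lambda>x. w x - z x) l = fourier_coeff a b w l - fourier_coeff a b z l"
  using assms
  by (simp add: fourier_coeff_mean continuous_on_diff left_diff_distrib mean_diff continuous_on_mult continuous_on_mode)

text \<open>Pairing with a trigonometric sum only sees finitely many coefficients; applied to the function and to its own partial sum, this yields Bessel's identity.\<close>

lemma mean_mult_cnj_trig_sum:
  assumes "finite F" "continuous_on {a..b} w"
  shows "mean a b (\<lambda>x. w x * cnj (\<Sum>l\<in>F. c l * mode a b l x)) = (\<Sum>l\<in>F. fourier_coeff a b w l * cnj (c l))"
proof -
  have "mean a b (\<lambda>x. w x * cnj (\<Sum>l\<in>F. c l * mode a b l x))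
      = mean a b (\<lambda>x. \<Sum>l\<in>F. cnj (c l) * (w x * mode a b (- l) x))"
    by (simp add: cnj_mode sum_distrib_left mult_ac)
  also have "\<dots> = (\<Sum>l\<in>F. cnj (c l) * fourier_coeff a b w l)"
    using assms by (subst mean_sum) (auto intro!: continuous_intros simp: mean_cmult fourier_coeff_mean)
  finally show ?thesis by (simp add: mult.commute)
qed

lemma Bessel_identity:
  assumes "finite F" and w: "continuous_on {a..b} w"
  shows "mean_square a b (\<lambda>x. w x - (\<Sum>l\<in>F. fourier_coeff a b w l * mode a b l x))
     = mean_square a b w - (\<Sum>l\<in>F. (cmod (fourier_coeff a b w l))\<^sup>2)"
proof -
  define c where "c = fourier_coeff a b w"
  define S where "S = (\<lambda>x. \<Sum>l\<in>F. c l * mode a b l x)"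
  have S: "continuous_on {a..b} S" unfolding S_def by (intro continuous_intros)
  have wS: "mean a b (\<lambda>x. w x * cnj (S x)) = (\<Sum>l\<in>F. c l * cnj (c l))"
    unfolding S_def using mean_mult_cnj_trig_sum[OF assms] by (simp add: c_def)
  have "mean a b (\<lambda>x. S x * cnj (S x)) = (\<Sum>l\<in>F. fourier_coeff a b S l * cnj (c l))"
    using mean_mult_cnj_trig_sum[OF assms(1) S, of c] by (simp add: S_def)
  then have SS: "mean a b (\<lambda>x. S x * cnj (S x)) = (\<Sum>l\<in>F. c l * cnj (c l))"
    using assms(1) by (simp add: S_def fourier_coeff_trig_sum)
  have "mean a b (\<lambda>x. S x * cnj (w x)) = cnj (mean a b (\<lambda>x. w x * cnj (S x)))"
    by (subst mean_cnj[symmetric]) (simp add: mult.commute)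
  then have Sw: "mean a b (\<lambda>x. S x * cnj (w x)) = (\<Sum>l\<in>F. c l * cnj (c l))"
    by (simp add: wS mult.commute)
  have "complex_of_real (mean_square a b (\<lambda>x. w x - S x)) =
     mean a b (\<lambda>x. (w x * cnj (w x) - w x * cnj (S x)) - (S x * cnj (w x) - S x * cnj (S x)))"
    using w S by (subst mean_square_eq) (auto intro!: continuous_intros simp: algebra_simps)
  also have "\<dots> = complex_of_real (mean_square a b w) - (\<Sum>l\<in>F. c l * cnj (c l))"
    using w S by (simp add: mean_diff continuous_on_diff continuous_on_mult continuous_on_cnj wS SS Sw mean_square_eq)
  also have "\<dots> = complex_of_real (mean_square a b w - (\<Sum>l\<in>F. (cmod (c l))\<^sup>2))"
    unfolding complex_norm_square[symmetric] of_real_sum of_real_diff by (rule refl)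
  finally show ?thesis unfolding S_def c_def of_real_eq_iff .
qed

lemma Bessel_inequality:
  assumes "finite F" "continuous_on {a..b} w"
  shows "(\<Sum>l\<in>F. (cmod (fourier_coeff a b w l))\<^sup>2) \<le> mean_square a b w"
  proof -
  have "0 \<le> mean_square a b (\<lambda>x. w x - (\<Sum>l\<in>F. fourier_coeff a b w l * mode a b l x))"
    by (rule mean_square_nonneg)
  then show ?thesis unfolding Bessel_identity[OF assms] by linarith
qed

end

section \<open>Completeness of the trigonometric system\<close>

context
  fixes a b :: real
  assumes ab: "a < b"
begin

text \<open>By \<open>fourier_completeness\<close> below, zero is the only such function with equal end values.\<close>

definition null_coeffs :: "(real \<Rightarrow> complex) \<Rightarrow> bool" where
  "null_coeffs d \<longleftrightarrow> continuous_on {a..b} d \<and> (\<forall>l. fourier_coeff a b d l = 0)"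

lemma fourier_coeff_mult_mode:
  assumes "continuous_on {a..b} d"
  shows "fourier_coeff a b (\<lambda>x. d x * mode a b m x) l = fourier_coeff a b d (l - m)"
proof -
  have "fourier_coeff a b (\<lambda>x. d x * mode a b m x) l
      = mean a b (\<lambda>x. d x * mode a b m x * mode a b (- l) x)"
    using assms by (intro fourier_coeff_mean[OF ab] continuous_intros)
  also have "\<dots> = mean a b (\<lambda>x. d x * mode a b (- (l - m)) x)"
    by (simp add: mult.assoc flip: mode_add)
  finally show ?thesis using assms by (simp add: fourier_coeff_mean[OF ab])
qed

text \<open>The class of functions with vanishing Fourier coefficients is stable under multiplication by the
functions \<open>e^(\<plusminus>i\<mu>_1(x-a))\<close>, which merely shift the coefficients, hence by real and imaginary part of
the first mode and by all polynomials in these. Quantifying over \<^term>\<open>d\<close> makes this pass through products.\<close>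

lemma null_coeffs_mult_polynomial:
  assumes "real_polynomial_function g" "null_coeffs d"
  shows "null_coeffs (\<lambda>x. d x * complex_of_real (g (mode a b 1 x)))"
  using assms
proof (induction g arbitrary: d rule: real_polynomial_function.induct)
  case (linear f)
  interpret f: bounded_linear f by (rule linear)
  have d: "continuous_on {a..b} d" "\<And>l. fourier_coeff a b d l = 0"
    using linear(2) by (auto simp: null_coeffs_def)
  have f: "f z = Re z * f 1 + Im z * f \<i>" for z
  proof -
    have "z = Re z *\<^sub>R 1 + Im z *\<^sub>R \<i>" by (simp add: complex_eq_iff)
    then have "f z = f (Re z *\<^sub>R 1 + Im z *\<^sub>R \<i>)" by simp
    then show ?thesis by (simp only: f.add f.scaleR) simp
  qed
  define p where "p = complex_of_real (f 1) / 2 - \<i> * f \<i> / 2"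
  define q where "q = complex_of_real (f 1) / 2 + \<i> * f \<i> / 2"
  have "complex_of_real (f z) = p * z + q * cnj z" for z
    by (subst f) (simp add: p_def q_def complex_eq_iff field_simps)
  then have eq: "(\<lambda>x. d x * complex_of_real (f (mode a b 1 x)))
      = (\<lambda>x. p * (d x * mode a b 1 x) + q * (d x * mode a b (- 1) x))"
    by (simp add: cnj_mode algebra_simps)
  have c: "continuous_on {a..b} (\<lambda>x. p * (d x * mode a b 1 x))"
    "continuous_on {a..b} (\<lambda>x. q * (d x * mode a b (- 1) x))"
    using d by (intro continuous_intros; simp)+
  show ?case unfolding null_coeffs_def eq using d continuous_on_add[OF c]
    by (simp add: fourier_coeff_add[OF ab c] fourier_coeff_cmult fourier_coeff_mult_mode)
next
  case (const c)
  have "(\<lambda>x. d x * complex_of_real c) = (\<lambda>x. complex_of_real c * d x)"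
    by (simp add: mult.commute)
  then show ?case using const
    by (auto simp: null_coeffs_def fourier_coeff_cmult intro!: continuous_intros)
next
  case (add f g)
  from add(3)[OF add(5)] add(4)[OF add(5)] show ?case
    by (auto simp: null_coeffs_def fourier_coeff_add[OF ab] distrib_left intro!: continuous_intros)
next
  case (mult f g)
  from mult(4)[OF mult(3)[OF mult(5)]] show ?case
    by (simp add: mult.assoc)
qed

text \<open>A function with equal end values is a continuous function on the unit circle, composed with the first
mode; the Stone-Weierstrass theorem applies on the circle. Continuity of the function on the circle at
the point \<open>1\<close>, where the argument jumps, is obtained from the fact that loops are maps of the circle.\<close>

lemma polynomial_in_mode_approx:
  fixes u :: "real \<Rightarrow> real"
  assumes u: "continuous_on {a..b} u" "u a = u b" and "e > 0"
  obtains g :: "complex \<Rightarrow> real" where "real_polynomial_function g"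
    "\<And>x. x \<in> {a..b} \<Longrightarrow> \<bar>u x - g (mode a b 1 x)\<bar> < e"
proof -
  define p where "p = (\<lambda>t. u (a + (b - a) * t))"
  have seg: "a + (b - a) * t \<in> {a..b}" if "t \<in> {0..1}" for t
  proof -
    have "(b - a) * t \<le> (b - a) * 1" "0 \<le> (b - a) * t" using ab that by (auto intro: mult_left_mono)
    then show ?thesis by auto
  qed
  have "continuous_on {0..1} p" unfolding p_def
    using seg by (intro continuous_on_compose2[OF u(1)] continuous_intros) auto
  then have "path p" by (simp add: path_def)
  moreover have "pathfinish p = pathstart p" using u(2) by (simp add: p_def pathfinish_def pathstart_def)
  ultimately have "homotopic_loops UNIV p p" by (simp add: homotopic_loops_refl)
  from homotopic_with_imp_continuous[OF homotopic_loops_imp_homotopic_circlemaps[OF this]]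
  have "continuous_on (sphere 0 1) (p \<circ> (\<lambda>z. Arg2pi z / (2 * pi)))" by blast
  from Stone_Weierstrass_real_polynomial_function[OF compact_sphere this \<open>e > 0\<close>]
  obtain g :: "complex \<Rightarrow> real" where g: "real_polynomial_function g"
    "\<And>z. z \<in> sphere 0 1 \<Longrightarrow> \<bar>(p \<circ> (\<lambda>z. Arg2pi z / (2 * pi))) z - g z\<bar> < e" by blast
  have eq: "(p \<circ> (\<lambda>z. Arg2pi z / (2 * pi))) (mode a b 1 x) = u x" if x: "x \<in> {a..b}" for x
  proof (cases "x = b")
    case True
    have "Arg2pi 1 = 0" using Arg2pi_of_real[of 1] by simp
    then show ?thesis using True u(2) by (simp add: p_def mode_right[OF ab])
  next
    case False
    have "mu a b 1 * (x - a) < 2 * pi" "0 \<le> mu a b 1 * (x - a)"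
      using x False ab by (auto simp: mu_def field_simps)
    then have "Arg2pi (mode a b 1 x) = mu a b 1 * (x - a)"
      unfolding mode_def by (subst Arg2pi_exp) auto
    then show ?thesis using ab by (simp add: p_def mu_def)
  qed
  show ?thesis
  proof (rule that[OF g(1)])
    fix x assume "x \<in> {a..b}"
    then show "\<bar>u x - g (mode a b 1 x)\<bar> < e"
      using g(2)[of "mode a b 1 x"] unfolding eq[OF \<open>x \<in> {a..b}\<close>] by (simp add: dist_norm)
  qed
qed

text \<open>Such a function is orthogonal to all polynomials in the first mode, hence, by density, to its own real
and imaginary parts.\<close>

lemma fourier_completeness:
  assumes d: "null_coeffs d" "d a = d b" and x: "x \<in> {a..b}"
  shows "d x = 0"
proof -
  have dc: "continuous_on {a..b} d" using d by (simp add: null_coeffs_def)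
  obtain D where "\<forall>x\<in>{a..b}. cmod (d x) \<le> D"
    using compact_imp_bounded[OF compact_continuous_image[OF dc compact_Icc]]
    by (auto simp: bounded_iff)
  then have D: "\<And>x. x \<in> {a..b} \<Longrightarrow> cmod (d x) \<le> D" by blast
  have D0: "D \<ge> 0" using D[OF x] norm_ge_zero order_trans by blast
  have orth: "mean a b (\<lambda>x. d x * complex_of_real (u x)) = 0"
    if u: "continuous_on {a..b} u" "u a = u b" for u
  proof -
    have bound: "cmod (mean a b (\<lambda>x. d x * complex_of_real (u x))) \<le> D * e" if "e > 0" for e
    proof -
      obtain g where g: "real_polynomial_function g"
        and ug: "\<And>x. x \<in> {a..b} \<Longrightarrow> \<bar>u x - g (mode a b 1 x)\<bar> < e"
        using polynomial_in_mode_approx[OF u \<open>e > 0\<close>] by blast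
      let ?g = "\<lambda>x. complex_of_real (g (mode a b 1 x))"
      have n: "null_coeffs (\<lambda>x. d x * ?g x)"
        by (rule null_coeffs_mult_polynomial[OF g d(1)])
      then have c: "continuous_on {a..b} (\<lambda>x. d x * ?g x)"
        and "fourier_coeff a b (\<lambda>x. d x * ?g x) 0 = 0" by (auto simp: null_coeffs_def)
      then have "mean a b (\<lambda>x. d x * ?g x) = 0" by (simp add: fourier_coeff_mean[OF ab])
      then have "mean a b (\<lambda>x. d x * complex_of_real (u x))
          = mean a b (\<lambda>x. d x * complex_of_real (u x) - d x * ?g x)"
        using dc u by (subst mean_diff[OF _ c]) (auto intro!: continuous_intros)
      also have "cmod \<dots> \<le> D * e"
      proof (rule cmod_mean_le[OF ab])
        show "continuous_on {a..b} (\<lambda>x. d x * complex_of_real (u x) - d x * ?g x)"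
          using dc u by (intro continuous_on_diff[OF _ c] continuous_intros)
        fix x assume x: "x \<in> {a..b}"
        have "cmod (d x * complex_of_real (u x) - d x * ?g x) = cmod (d x) * \<bar>u x - g (mode a b 1 x)\<bar>"
          by (simp flip: right_diff_distrib of_real_diff add: norm_mult)
        also have "\<dots> \<le> D * e"
          using D[OF x] ug[OF x] D0 by (intro mult_mono) auto
        finally show "cmod (d x * complex_of_real (u x) - d x * ?g x) \<le> D * e" .
      qed
      finally show ?thesis .
    qed
    have *: "cmod (mean a b (\<lambda>x. d x * complex_of_real (u x))) \<le> 0 + e" if "e > 0" for e
    proof -
      \<comment> \<open>The denominator \<open>D + 1\<close> is positive even if \<open>d\<close> vanishes.\<close>
      have "cmod (mean a b (\<lambda>x. d x * complex_of_real (u x))) \<le> D * (e / (D + 1))"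
        using that D0 by (intro bound) simp
      also have "\<dots> \<le> e" using that D0 by (simp add: field_simps)
      finally show ?thesis by simp
    qed
    have "cmod (mean a b (\<lambda>x. d x * complex_of_real (u x))) \<le> 0" by (rule field_le_epsilon) (rule *)
    then show ?thesis by simp
  qed
  have "complex_of_real (mean_square a b d)
     = mean a b (\<lambda>x. d x * complex_of_real (Re (d x)) - \<i> * (d x * complex_of_real (Im (d x))))"
  proof -
    have "d x * cnj (d x) = d x * complex_of_real (Re (d x)) - \<i> * (d x * complex_of_real (Im (d x)))" for x
      by (simp add: complex_eq_iff algebra_simps)
    then show ?thesis by (simp add: mean_square_eq[OF dc])
  qed
  also have "\<dots> = 0" using dc d(2)
    by (subst mean_diff)
      (auto intro!: continuous_intros simp: mean_cmult orth continuous_on_Re continuous_on_Im)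
  finally have "integral {a..b} (\<lambda>x. (cmod (d x))\<^sup>2) = 0" using ab by (simp add: mean_square_def)
  then have "\<forall>x\<in>{a..b}. (cmod (d x))\<^sup>2 = 0"
    using dc ab by (subst (asm) integral_eq_0_iff) (auto intro!: continuous_intros)
  then show ?thesis using x by simp
qed

text \<open>The absolutely convergent Fourier series has a continuous sum with the same coefficients, so the
difference to \<^term>\<open>w\<close> vanishes by completeness.\<close>

lemma fourier_inversion:
  assumes w: "continuous_on {a..b} w" "w a = w b"
    and sum: "(\<lambda>l. cmod (fourier_coeff a b w l)) summable_on UNIV"
  shows "uniform_limit {a..b} (\<lambda>F x. \<Sum>l\<in>F. fourier_coeff a b w l * mode a b l x) w
           (finite_subsets_at_top UNIV)"
proof -
  define c where "c = fourier_coeff a b w"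
  define S where "S = (\<lambda>x. \<Sum>\<^sub>\<infinity>l. c l * mode a b l x)"
  let ?P = "\<lambda>F x. \<Sum>l\<in>F. c l * mode a b l x"
  have lim: "uniform_limit {a..b} ?P S (finite_subsets_at_top UNIV)"
    unfolding S_def using sum
    by (intro Weierstrass_m_test_general) (auto simp: norm_mult c_def)
  have Pc: "continuous_on {a..b} (?P F)" for F by (intro continuous_intros)
  have Sc: "continuous_on {a..b} S"
    by (rule uniform_limit_theorem[OF _ lim]) (auto intro: Pc)
  have "fourier_coeff a b S m = c m" for m
  proof -
    have "cmod (fourier_coeff a b S m - c m) \<le> 0 + e" if "e > 0" for e
    proof -
      have "\<forall>\<^sub>F F in finite_subsets_at_top UNIV. (\<forall>x\<in>{a..b}. dist (?P F x) (S x) < e)"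
        using lim that by (auto simp: uniform_limit_iff)
      moreover have "\<forall>\<^sub>F F in finite_subsets_at_top UNIV. finite F \<and> {m} \<subseteq> F"
        unfolding eventually_finite_subsets_at_top by (intro exI[of _ "{m}"]) auto
      ultimately have "\<forall>\<^sub>F F in finite_subsets_at_top UNIV.
          (\<forall>x\<in>{a..b}. dist (?P F x) (S x) < e) \<and> finite F \<and> {m} \<subseteq> F"
        by (rule eventually_conj)
      then have "\<exists>F. (\<forall>x\<in>{a..b}. dist (?P F x) (S x) < e) \<and> finite F \<and> {m} \<subseteq> F"
        by (rule eventually_happens'[OF finite_subsets_at_top_neq_bot])
      then obtain F where F': "(\<forall>x\<in>{a..b}. dist (?P F x) (S x) < e) \<and> finite F \<and> {m} \<subseteq> F"
        by (rule exE)
      have F: "dist (?P F x) (S x) < e" if "x \<in> {a..b}" for x using F' that by blast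
      have Fm: "finite F" "m \<in> F" using F' by blast+
      have "fourier_coeff a b S m - c m = fourier_coeff a b (\<lambda>x. S x - ?P F x) m"
        using Fm by (simp add: fourier_coeff_diff[OF ab Sc Pc] fourier_coeff_trig_sum[OF ab])
      also have "\<dots> = mean a b (\<lambda>x. (S x - ?P F x) * mode a b (- m) x)"
        using Sc Pc by (intro fourier_coeff_mean[OF ab] continuous_intros)
      also have "cmod \<dots> \<le> e"
        using Sc Pc F
        by (intro cmod_mean_le[OF ab] continuous_intros)
           (auto simp: norm_mult dist_norm norm_minus_commute less_imp_le)
      finally show ?thesis by simp
    qed
    then have "cmod (fourier_coeff a b S m - c m) \<le> 0" by (rule field_le_epsilon)
    then show ?thesis by simp
  qed
  then have nul: "null_coeffs (\<lambda>x. w x - S x)"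
    using w Sc by (auto simp: null_coeffs_def fourier_coeff_diff[OF ab] c_def intro!: continuous_intros)
  have ends: "w a - S a = w b - S b"
    using w by (simp add: S_def mode_right[OF ab])
  have eq: "w x = S x" if "x \<in> {a..b}" for x
    using fourier_completeness[OF nul ends that] by simp
  show ?thesis unfolding uniform_limit_iff
  proof (intro allI impI)
    fix e :: real assume "e > 0"
    with lim have "\<forall>\<^sub>F F in finite_subsets_at_top UNIV. \<forall>x\<in>{a..b}. dist (?P F x) (S x) < e"
      unfolding uniform_limit_iff by blast
    then show "\<forall>\<^sub>F F in finite_subsets_at_top UNIV.
        \<forall>x\<in>{a..b}. dist (\<Sum>l\<in>F. fourier_coeff a b w l * mode a b l x) (w x) < e"
      by (rule eventually_mono) (simp add: eq c_def)
  qed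
qed

text \<open>This makes the Sobolev embedding of \<open>H^1\<close> into the bounded functions work in dimension one.\<close>

lemma summable_inverse_mu: "(\<lambda>l. 1 / (1 + (mu a b l)\<^sup>2)) summable_on UNIV"
proof -
  define c where "c = 2 * pi / (b - a)"
  have c: "c > 0" using ab by (simp add: c_def)
  let ?g = "\<lambda>l. 1 / (1 + (mu a b l)\<^sup>2)"
  have mu: "mu a b l = c * of_int l" for l by (simp add: mu_def c_def)
  have nat: "(\<lambda>n. 1 / (1 + (c * real n)\<^sup>2)) summable_on UNIV"
  proof (rule norm_summable_imp_summable_on)
    have s: "summable (\<lambda>n. 1 / c\<^sup>2 * inverse (real n ^ 2))"
      by (intro summable_mult inverse_power_summable) simp
    show "summable (\<lambda>n. norm (1 / (1 + (c * real n)\<^sup>2)))"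
    proof (rule summable_comparison_test'[OF s, of 1])
      fix n :: nat assume "1 \<le> n"
      then have "0 < (c * real n)\<^sup>2" using c by simp
      then have "1 / (1 + (c * real n)\<^sup>2) \<le> 1 / (c * real n)\<^sup>2"
        by (intro divide_left_mono mult_pos_pos add_pos_pos) auto
      also have "\<dots> = 1 / c\<^sup>2 * inverse (real n ^ 2)" by (simp add: field_simps)
      finally show "norm (norm (1 / (1 + (c * real n)\<^sup>2))) \<le> 1 / c\<^sup>2 * inverse (real n ^ 2)"
        by simp
    qed
  qed
  have "?g summable_on range int"
    using nat by (subst summable_on_reindex) (auto simp: o_def mu)
  moreover have "?g summable_on range (\<lambda>n. - int n)"
    using nat by (subst summable_on_reindex) (auto simp: o_def mu inj_on_def)
  ultimately have "?g summable_on (range int \<union> range (\<lambda>n. - int n))"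
    by (rule summable_on_union)
  moreover have "range int \<union> range (\<lambda>n. - int n) = UNIV"
  proof -
    have "l \<in> range int \<union> range (\<lambda>n. - int n)" for l by (cases l rule: int_cases2) auto
    then show ?thesis by blast
  qed
  ultimately show ?thesis by simp
qed

end

text \<open>The norm of the embedding of periodic \<open>H^1\<close> functions into the continuous functions, as given by the Cauchy-Schwarz inequality.\<close>

definition sobolev_const :: "real \<Rightarrow> real \<Rightarrow> real" where
  "sobolev_const a b = sqrt (\<Sum>\<^sub>\<infinity>l. 1 / (1 + (mu a b l)\<^sup>2))"

text \<open>Bounding all finite partial sums expresses \<open>\<parallel>w\<parallel>_m \<le> A\<close> without reference to summability or weak
derivatives, and each of these countably many conditions is preserved under limits in time.\<close>

definition H_bounded :: "real \<Rightarrow> real \<Rightarrow> nat \<Rightarrow> (real \<Rightarrow> complex) \<Rightarrow> real \<Rightarrow> bool" where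
  "H_bounded a b m w A \<longleftrightarrow>
     (\<forall>F. finite F \<longrightarrow> (\<Sum>l\<in>F. (1 + (mu a b l)\<^sup>2) ^ m * (cmod (fourier_coeff a b w l))\<^sup>2) \<le> A\<^sup>2)"

lemma H_boundedD:
  "H_bounded a b m w A \<Longrightarrow> finite F \<Longrightarrow>
     (\<Sum>l\<in>F. (1 + (mu a b l)\<^sup>2) ^ m * (cmod (fourier_coeff a b w l))\<^sup>2) \<le> A\<^sup>2"
  by (simp add: H_bounded_def)

lemma sobolev_const_nonneg: "0 \<le> sobolev_const a b"
  unfolding sobolev_const_def by (intro real_sqrt_ge_zero infsum_nonneg) (simp add: add_pos_nonneg)

context
  fixes a b :: real
  assumes ab: "a < b"
begin

lemma sum_fourier_coeff_le:
  assumes "H_bounded a b 1 w A" "0 \<le> A" "finite F"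
  shows "(\<Sum>l\<in>F. cmod (fourier_coeff a b w l)) \<le> sobolev_const a b * A"
proof -
  let ?k = "\<lambda>l. 1 + (mu a b l)\<^sup>2"
  have k: "?k l > 0" for l by (simp add: add_pos_nonneg)
  have "(\<Sum>l\<in>F. cmod (fourier_coeff a b w l))
     = (\<Sum>l\<in>F. \<bar>sqrt (1 / ?k l)\<bar> * \<bar>sqrt (?k l) * cmod (fourier_coeff a b w l)\<bar>)"
    using k by (intro sum.cong) (auto simp: abs_mult real_sqrt_divide less_imp_neq[symmetric])
  also have "\<dots> \<le> L2_set (\<lambda>l. sqrt (1 / ?k l)) F * L2_set (\<lambda>l. sqrt (?k l) * cmod (fourier_coeff a b w l)) F"
    by (rule L2_set_mult_ineq)
  also have "\<dots> \<le> sobolev_const a b * A"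
  proof (intro mult_mono L2_set_nonneg sobolev_const_nonneg)
    have "(\<Sum>l\<in>F. 1 / ?k l) \<le> (\<Sum>\<^sub>\<infinity>l. 1 / ?k l)"
      using k by (intro finite_sum_le_infsum summable_inverse_mu[OF ab] assms) (auto intro: less_imp_le)
    moreover have "(\<Sum>l\<in>F. (sqrt (1 / ?k l))\<^sup>2) = (\<Sum>l\<in>F. 1 / ?k l)"
      using k by (intro sum.cong refl real_sqrt_pow2) (auto intro: less_imp_le)
    ultimately show "L2_set (\<lambda>l. sqrt (1 / ?k l)) F \<le> sobolev_const a b"
      unfolding L2_set_def sobolev_const_def by (intro real_sqrt_le_mono) simp
    have "(\<Sum>l\<in>F. (sqrt (?k l) * cmod (fourier_coeff a b w l))\<^sup>2) \<le> A\<^sup>2"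
      using H_boundedD[OF assms(1,3)] k by (simp add: power_mult_distrib)
    then show "L2_set (\<lambda>l. sqrt (?k l) * cmod (fourier_coeff a b w l)) F \<le> A"
      unfolding L2_set_def using assms(2) by (intro real_le_lsqrt) (auto intro: sum_nonneg)
  qed
  finally show ?thesis .
qed

lemma fourier_summable:
  assumes "H_bounded a b 1 w A" "0 \<le> A"
  shows "(\<lambda>l. cmod (fourier_coeff a b w l)) summable_on UNIV"
  using sum_fourier_coeff_le[OF assms]
  by (intro nonneg_bdd_above_summable_on bdd_aboveI) auto

lemma sobolev_sup_bound:
  assumes w: "continuous_on {a..b} w" "w a = w b"
    and A: "H_bounded a b 1 w A" "0 \<le> A" and x: "x \<in> {a..b}"
  shows "cmod (w x) \<le> sobolev_const a b * A"
proof -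
  have lim: "((\<lambda>F. \<Sum>l\<in>F. fourier_coeff a b w l * mode a b l x) \<longlongrightarrow> w x) (finite_subsets_at_top UNIV)"
    by (rule tendsto_uniform_limitI[OF fourier_inversion[OF ab w fourier_summable[OF A]] x])
  show ?thesis
  proof (rule tendsto_upperbound[OF tendsto_norm[OF lim]])
    have "cmod (\<Sum>l\<in>F. fourier_coeff a b w l * mode a b l x) \<le> sobolev_const a b * A" if "finite F" for F
      using sum_norm_le[of F "\<lambda>l. fourier_coeff a b w l * mode a b l x" "\<lambda>l. cmod (fourier_coeff a b w l)"]
        sum_fourier_coeff_le[OF A that] by (simp add: norm_mult)
    then show "\<forall>\<^sub>F F in finite_subsets_at_top UNIV.
        cmod (\<Sum>l\<in>F. fourier_coeff a b w l * mode a b l x) \<le> sobolev_const a b * A"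
      by (auto simp: eventually_finite_subsets_at_top)
  qed simp
qed

text \<open>One half of Parseval's identity; the \<open>H^1\<close> bound \<^term>\<open>A'\<close> makes the Fourier series converge uniformly.\<close>

lemma mean_square_le:
  assumes w: "continuous_on {a..b} w" "w a = w b"
    and A': "H_bounded a b 1 w A'" "0 \<le> A'" and A: "H_bounded a b 0 w A"
  shows "mean_square a b w \<le> A\<^sup>2"
proof (rule field_le_epsilon)
  fix e :: real assume e: "e > 0"
  let ?P = "\<lambda>F x. \<Sum>l\<in>F. fourier_coeff a b w l * mode a b l x"
  have "\<forall>\<^sub>F F in finite_subsets_at_top UNIV. \<forall>x\<in>{a..b}. dist (?P F x) (w x) < sqrt e"
    using fourier_inversion[OF ab w fourier_summable[OF A']] e by (auto simp: uniform_limit_iff)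
  then obtain F where F: "finite F" "\<And>x. x \<in> {a..b} \<Longrightarrow> dist (?P F x) (w x) < sqrt e"
    by (auto simp: eventually_finite_subsets_at_top)
  have "mean_square a b (\<lambda>x. w x - ?P F x) \<le> (sqrt e)\<^sup>2"
    using w F(2) by (intro mean_square_le_sup[OF ab] continuous_intros)
      (auto simp: dist_norm norm_minus_commute less_imp_le)
  then show "mean_square a b w \<le> A\<^sup>2 + e"
    using Bessel_identity[OF ab F(1) w(1)] H_boundedD[OF A F(1)] e by simp
qed

end

section \<open>Essential suprema and Sobolev norms\<close>

text \<open>A continuous function that exceeds \<^term>\<open>C\<close> at one point of a nondegenerate interval does so on a set of positive measure.\<close>

lemma AE_le_imp_le:
  fixes G :: "real \<Rightarrow> real"
  assumes "c < d" and G: "continuous_on {c..d} G"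
    and ae: "AE s in lebesgue_on {c..d}. G s \<le> C" and s: "s \<in> {c..d}"
  shows "G s \<le> C"
proof (rule ccontr)
  assume "\<not> G s \<le> C"
  then have e: "G s - C > 0" by simp
  obtain r where r: "r > 0" "\<And>t. t \<in> {c..d} \<Longrightarrow> dist t s < r \<Longrightarrow> dist (G t) (G s) < G s - C"
    using G s e unfolding continuous_on_iff by metis
  let ?p = "max c (s - r)" and ?q = "min d (s + r)"
  have pq: "?p < ?q" using \<open>c < d\<close> s r(1) by auto
  have "AE t in lebesgue. t \<in> {c..d} \<longrightarrow> G t \<le> C"
    using ae by (subst (asm) AE_restrict_space_iff) auto
  then obtain N where N: "negligible N" "{t. \<not> (t \<in> {c..d} \<longrightarrow> G t \<le> C)} \<subseteq> N"
    unfolding eventually_ae_filter_negligible by blast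
  have "{?p<..<?q} \<subseteq> N"
  proof
    fix t assume t: "t \<in> {?p<..<?q}"
    then have "t \<in> {c..d}" "dist t s < r" by (auto simp: dist_real_def)
    with r(2)[OF this] have "G t > C" by (auto simp: dist_real_def)
    with N(2) \<open>t \<in> {c..d}\<close> show "t \<in> N" by auto
  qed
  then have "negligible {?p<..<?q}" using N(1) negligible_subset by blast
  moreover have "{?p<..<?q} \<noteq> {}" using dense[OF pq] by (auto simp: greaterThanLessThan_iff)
  ultimately show False using open_not_negligible[of "{?p<..<?q}"] by simp
qed

lemma Linf_norm_le_imp_bound:
  assumes "a < b" "continuous_on {a..b} w" "Linf_norm a b w \<le> ereal L" "x \<in> {a..b}"
  shows "norm (w x) \<le> L"
proof (rule AE_le_imp_le[OF assms(1) continuous_on_norm[OF assms(2)] _ assms(4)])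
  show "AE x in lebesgue_on {a..b}. norm (w x) \<le> L"
    using esssup_AE[of "\<lambda>x. ereal (norm (w x))" "lebesgue_on {a..b}"]
  proof (rule AE_mp, intro AE_I2 impI)
    fix x assume "ereal (norm (w x)) \<le> esssup (lebesgue_on {a..b}) (\<lambda>x. ereal (norm (w x)))"
    then have "ereal (norm (w x)) \<le> ereal L"
      using assms(3) unfolding Linf_norm_def by (rule order_trans)
    then show "norm (w x) \<le> L" by simp
  qed
qed

lemma Linf_norm_leI:
  assumes "continuous_on {a..b} w" "\<And>x. x \<in> {a..b} \<Longrightarrow> norm (w x) \<le> L"
  shows "Linf_norm a b w \<le> ereal L"
  unfolding Linf_norm_def
proof (rule esssup_I)
  have "(\<lambda>x. norm (w x)) \<in> borel_measurable (lebesgue_on {a..b})"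
    using assms(1) by (intro continuous_imp_measurable_on_sets_lebesgue continuous_on_norm) auto
  then show "(\<lambda>x. ereal (norm (w x))) \<in> borel_measurable (lebesgue_on {a..b})" by simp
  show "AE x in lebesgue_on {a..b}. ereal (norm (w x)) \<le> ereal L"
    using assms(2) by (intro AE_I2) auto
qed

lemma esssup_nonneg:
  fixes f :: "real \<Rightarrow> ereal"
  assumes "c < d" "\<And>x. 0 \<le> f x"
  shows "0 \<le> esssup (lebesgue_on {c..d}) f"
proof (rule ccontr)
  assume n: "\<not> 0 \<le> esssup (lebesgue_on {c..d}) f"
  have "AE s in lebesgue_on {c..d}. (0::real) \<le> -1"
    using esssup_AE[of f "lebesgue_on {c..d}"]
    by (rule AE_mp) (use n assms(2) order_trans in \<open>auto intro!: AE_I2\<close>)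
  from AE_le_imp_le[OF assms(1) _ this, of c] assms(1) show False by simp
qed

lemma Linf_norm_nonneg: "a < b \<Longrightarrow> 0 \<le> Linf_norm a b w"
  unfolding Linf_norm_def by (rule esssup_nonneg) auto

lemma Linf_time_AE:
  assumes "Linf_time T N u \<le> C"
  shows "AE s in lebesgue_on {0..T}. N (u s) \<le> C"
  using esssup_AE[of "\<lambda>s. N (u s)" "lebesgue_on {0..T}"]
  by (rule AE_mp) (use assms in \<open>auto intro!: AE_I2 elim: order_trans simp: Linf_time_def\<close>)

lemma H_norm_le_imp_bounded:
  assumes "H_norm a b m w \<le> ereal C"
  shows "H_bounded a b m w C"
proof -
  define c where "c = (\<lambda>l. (1 + (mu a b l)\<^sup>2) ^ m * (cmod (fourier_coeff a b w l))\<^sup>2)"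
  have c0: "c l \<ge> 0" for l by (simp add: c_def)
  have s: "c summable_on UNIV" and C: "sqrt (\<Sum>\<^sub>\<infinity>l. c l) \<le> C"
    using assms unfolding H_norm_def Let_def c_def[symmetric] by (auto split: if_splits)
  have le: "(\<Sum>\<^sub>\<infinity>l. c l) \<le> C\<^sup>2" by (rule sqrt_le_D[OF C])
  show ?thesis unfolding H_bounded_def c_def[symmetric]
  proof (intro allI impI)
    fix F :: "int set" assume "finite F"
    then have "sum c F \<le> (\<Sum>\<^sub>\<infinity>l. c l)" using s c0 by (intro finite_sum_le_infsum) auto
    then show "sum c F \<le> C\<^sup>2" using le by simp
  qed
qed

lemma Hp_norm_le_imp_bounded: "Hp_norm a b m w \<le> ereal C \<Longrightarrow> H_bounded a b m w C"
  by (rule H_norm_le_imp_bounded) (auto simp: Hp_norm_def split: if_splits)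

lemma H_norm_leI:
  assumes "weak_derivs a b m 2 w g" "H_bounded a b m w A" "0 \<le> A"
  shows "H_norm a b m w \<le> ereal A"
proof -
  define c where "c = (\<lambda>l. (1 + (mu a b l)\<^sup>2) ^ m * (cmod (fourier_coeff a b w l))\<^sup>2)"
  have c0: "c l \<ge> 0" for l by (simp add: c_def)
  have le: "sum c F \<le> A\<^sup>2" if "finite F" for F
    using H_boundedD[OF assms(2) that] by (simp add: c_def)
  have s: "c summable_on UNIV"
    using le c0 by (intro nonneg_bdd_above_summable_on bdd_aboveI[of _ "A\<^sup>2"]) auto
  have "(\<Sum>\<^sub>\<infinity>l. c l) \<le> A\<^sup>2" using s le by (intro infsum_le_finite_sums) auto
  then have "sqrt (\<Sum>\<^sub>\<infinity>l. c l) \<le> A" using assms(3) by (intro real_le_lsqrt)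
  moreover have "H_norm a b m w = ereal (sqrt (\<Sum>\<^sub>\<infinity>l. c l))"
    unfolding H_norm_def Let_def c_def[symmetric] using s assms(1) by auto
  ultimately show ?thesis by simp
qed

lemma H_bounded_mono:
  assumes "H_bounded a b m w A" "A \<le> B" "0 \<le> A"
  shows "H_bounded a b m w B"
  using assms power_mono[OF assms(2,3), of 2] unfolding H_bounded_def by (meson order_trans)

lemma H_bounded_lower_order:
  assumes "H_bounded a b m w A" "j \<le> m"
  shows "H_bounded a b j w A"
  unfolding H_bounded_def
proof (intro allI impI)
  fix F :: "int set" assume F: "finite F"
  have "(\<Sum>l\<in>F. (1 + (mu a b l)\<^sup>2) ^ j * (cmod (fourier_coeff a b w l))\<^sup>2)
      \<le> (\<Sum>l\<in>F. (1 + (mu a b l)\<^sup>2) ^ m * (cmod (fourier_coeff a b w l))\<^sup>2)"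
    using assms(2) by (intro sum_mono mult_right_mono power_increasing) auto
  then show "(\<Sum>l\<in>F. (1 + (mu a b l)\<^sup>2) ^ j * (cmod (fourier_coeff a b w l))\<^sup>2) \<le> A\<^sup>2"
    using H_boundedD[OF assms(1) F] by simp
qed

lemma in_Lp_continuous:
  fixes w :: "real \<Rightarrow> 'a::euclidean_space"
  assumes "continuous_on {a..b} w"
  shows "in_Lp a b 2 w"
proof -
  have "(\<lambda>x. norm (w x) powr 2) = (\<lambda>x. (norm (w x))\<^sup>2)" by (simp add: powr_numeral)
  then show ?thesis unfolding in_Lp_def using assms
    by (auto intro!: continuous_imp_measurable_on_sets_lebesgue continuous_imp_integrable_real continuous_intros)
qed

text \<open>Integration by parts; test functions vanish at both end points.\<close>

lemma has_weak_deriv_C1: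
  fixes w :: "real \<Rightarrow> complex"
  assumes ab: "a < b" and w': "continuous_on {a..b} w'"
    and d: "\<And>x. x \<in> {a..b} \<Longrightarrow> (w has_vector_derivative w' x) (at x within {a..b})"
  shows "has_weak_deriv a b w w'"
proof -
  have w: "continuous_on {a..b} w"
    using d has_vector_derivative_continuous by (fastforce simp: continuous_on_eq_continuous_within)
  have "(LINT x|lebesgue_on {a..b}. deriv \<psi> x *\<^sub>R w x) = - (LINT x|lebesgue_on {a..b}. \<psi> x *\<^sub>R w' x)"
    if t: "test_function a b \<psi>" for \<psi>
  proof -
    have d0: "\<psi> differentiable (at x)" and d1: "deriv \<psi> differentiable (at x)" for x
      using t[unfolded test_function_def, THEN conjunct1, rule_format, of 0 x]
        t[unfolded test_function_def, THEN conjunct1, rule_format, of 1 x] by auto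
    have \<psi>: "(\<psi> has_vector_derivative deriv \<psi> x) (at x within {a..b})" for x
      using d0[of x] by (metis DERIV_deriv_iff_real_differentiable has_field_derivative_at_within
          has_real_derivative_iff_has_vector_derivative)
    have c0: "continuous_on {a..b} \<psi>"
      using d0 by (simp add: differentiable_imp_continuous_within continuous_at_imp_continuous_on)
    have c1: "continuous_on {a..b} (deriv \<psi>)"
      using d1 by (simp add: differentiable_imp_continuous_within continuous_at_imp_continuous_on)
    have ends: "\<psi> a = 0" "\<psi> b = 0"
      using t unfolding test_function_def by force+
    have i1: "continuous_on {a..b} (\<lambda>x. deriv \<psi> x *\<^sub>R w x)" "continuous_on {a..b} (\<lambda>x. \<psi> x *\<^sub>R w' x)"
      using c0 c1 w w' by (auto intro!: continuous_intros)
    have "((\<lambda>x. deriv \<psi> x *\<^sub>R w x + \<psi> x *\<^sub>R w' x) has_integral (\<psi> b *\<^sub>R w b - \<psi> a *\<^sub>R w a)) {a..b}"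
    proof (rule fundamental_theorem_of_calculus)
      fix x assume "x \<in> {a..b}"
      from has_vector_derivative_scaleR[OF \<psi>[of x, folded has_real_derivative_iff_has_vector_derivative] d[OF this]]
      show "((\<lambda>x. \<psi> x *\<^sub>R w x) has_vector_derivative deriv \<psi> x *\<^sub>R w x + \<psi> x *\<^sub>R w' x) (at x within {a..b})"
        by (simp add: add.commute)
    qed (use ab in simp)
    then have "integral {a..b} (\<lambda>x. deriv \<psi> x *\<^sub>R w x + \<psi> x *\<^sub>R w' x) = 0"
      using ends by (simp add: integral_unique)
    then have "integral {a..b} (\<lambda>x. deriv \<psi> x *\<^sub>R w x) + integral {a..b} (\<lambda>x. \<psi> x *\<^sub>R w' x) = 0"
      using i1 by (simp add: integral_add integrable_continuous_real)
    then show ?thesis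
      using i1 by (simp add: lebesgue_integral_eq_integral continuous_imp_integrable_real eq_neg_iff_add_eq_0)
  qed
  moreover have "locally_integrable a b w" "locally_integrable a b w'"
    unfolding locally_integrable_def
    by (auto intro!: continuous_imp_integrable_real intro: continuous_on_subset[OF w] continuous_on_subset[OF w'])
  ultimately show ?thesis by (simp add: has_weak_deriv_def)
qed

lemma weak_derivs_C1:
  fixes w :: "real \<Rightarrow> complex"
  assumes ab: "a < b" and w': "continuous_on {a..b} w'"
    and d: "\<And>x. x \<in> {a..b} \<Longrightarrow> (w has_vector_derivative w' x) (at x within {a..b})"
    and "m \<le> 1"
  shows "weak_derivs a b m 2 w (\<lambda>j. if j = 0 then w else w')"
proof -
  have w: "continuous_on {a..b} w"
    using d has_vector_derivative_continuous by (fastforce simp: continuous_on_eq_continuous_within)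
  show ?thesis unfolding weak_derivs_def
    using has_weak_deriv_C1[OF ab w' d] in_Lp_continuous[OF w] in_Lp_continuous[OF w'] \<open>m \<le> 1\<close> by auto
qed

section \<open>Functions of time and space\<close>

lemma continuous_on_slice:
  assumes "continuous_on (S \<times> X) (\<lambda>(s, x). u s x)" "s \<in> S"
  shows "continuous_on X (u s)"
  using continuous_on_compose2[OF assms(1) continuous_on_Pair[OF continuous_on_const[of X s] continuous_on_id]] assms(2)
  by auto

lemma continuous_on_slice':
  assumes "continuous_on (S \<times> X) (\<lambda>(s, x). u s x)" "x \<in> X"
  shows "continuous_on S (\<lambda>s. u s x)"
  using continuous_on_compose2[OF assms(1) continuous_on_Pair[OF continuous_on_id continuous_on_const[of S x]]] assms(2)
  by auto

context
  fixes a b :: real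
  assumes ab: "a < b"
begin

lemma continuous_on_fourier_coeff:
  fixes u :: "real \<Rightarrow> real \<Rightarrow> complex"
  assumes u: "continuous_on (S \<times> {a..b}) (\<lambda>(s, x). u s x)"
  shows "continuous_on S (\<lambda>s. fourier_coeff a b (u s) l)"
proof -
  have "continuous_on (S \<times> {a..b}) (\<lambda>z. u (fst z) (snd z) * mode a b (- l) (snd z))"
    using u by (intro continuous_intros continuous_on_compose2[OF continuous_on_mode, of _ snd])
      (auto simp: case_prod_unfold)
  then have "continuous_on (S \<times> cbox a b) (\<lambda>(s, x). u s x * mode a b (- l) x)"
    by (simp add: case_prod_unfold)
  from integral_continuous_on_param[OF this]
  have "continuous_on S (\<lambda>s. mean a b (\<lambda>x. u s x * mode a b (- l) x))"
    unfolding mean_def using ab by (auto intro!: continuous_intros)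
  then show ?thesis
    using continuous_on_slice[OF u] by (subst continuous_on_cong[OF refl fourier_coeff_mean[OF ab]]) auto
qed

text \<open>Each partial sum is a continuous function of time, so a bound for almost every time holds at every time.\<close>

lemma H_bounded_all_times:
  fixes u :: "real \<Rightarrow> real \<Rightarrow> complex"
  assumes "0 < T" and u: "continuous_on ({0..T} \<times> {a..b}) (\<lambda>(s, x). u s x)"
    and ae: "AE s in lebesgue_on {0..T}. H_bounded a b m (u s) C" and s: "s \<in> {0..T}"
  shows "H_bounded a b m (u s) C"
  unfolding H_bounded_def
proof (intro allI impI)
  fix F :: "int set" assume F: "finite F"
  show "(\<Sum>l\<in>F. (1 + (mu a b l)\<^sup>2) ^ m * (cmod (fourier_coeff a b (u s) l))\<^sup>2) \<le> C\<^sup>2"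
  proof (rule AE_le_imp_le[OF \<open>0 < T\<close> _ _ s])
    show "continuous_on {0..T} (\<lambda>s. \<Sum>l\<in>F. (1 + (mu a b l)\<^sup>2) ^ m * (cmod (fourier_coeff a b (u s) l))\<^sup>2)"
      by (intro continuous_intros continuous_on_fourier_coeff[OF u])
    show "AE s in lebesgue_on {0..T}.
        (\<Sum>l\<in>F. (1 + (mu a b l)\<^sup>2) ^ m * (cmod (fourier_coeff a b (u s) l))\<^sup>2) \<le> C\<^sup>2"
      using ae by (rule AE_mp) (use F in \<open>auto intro!: AE_I2 simp: H_bounded_def\<close>)
  qed
qed

lemma Linf_time_imp_bound:
  fixes u :: "real \<Rightarrow> real \<Rightarrow> real"
  assumes "0 < T" and u: "continuous_on ({0..T} \<times> {a..b}) (\<lambda>(s, x). u s x)"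
    and le: "Linf_time T (Linf_norm a b) u \<le> ereal L" and s: "s \<in> {0..T}" and x: "x \<in> {a..b}"
  shows "\<bar>u s x\<bar> \<le> L"
proof (rule AE_le_imp_le[OF \<open>0 < T\<close> _ _ s])
  show "continuous_on {0..T} (\<lambda>s. \<bar>u s x\<bar>)"
    using continuous_on_slice'[OF u x] by (intro continuous_intros)
  have "AE s in lebesgue_on {0..T}. Linf_norm a b (u s) \<le> ereal L"
    by (rule Linf_time_AE[OF le])
  then show "AE s in lebesgue_on {0..T}. \<bar>u s x\<bar> \<le> L"
  proof (rule AE_mp, intro AE_I2 impI)
    fix s assume "s \<in> space (lebesgue_on {0..T})" "Linf_norm a b (u s) \<le> ereal L"
    then show "\<bar>u s x\<bar> \<le> L"
      using Linf_norm_le_imp_bound[OF ab continuous_on_slice[OF u] _ x, of s L] by auto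
  qed
qed

end

section \<open>Taylor estimates and Duhamel's principle\<close>

lemma mean_value_bound:
  fixes f :: "real \<Rightarrow> 'a::real_normed_vector"
  assumes "convex S" "\<And>t. t \<in> S \<Longrightarrow> (f has_vector_derivative f' t) (at t within S)"
    and "\<And>t. t \<in> S \<Longrightarrow> norm (f' t) \<le> B" and "x \<in> S" "y \<in> S"
  shows "norm (f y - f x) \<le> B * \<bar>y - x\<bar>"
proof -
  have "norm (f y - f x) \<le> B * norm (y - x)"
  proof (rule differentiable_bound[OF assms(1) _ _ assms(5,4)])
    fix t assume t: "t \<in> S"
    show "(f has_derivative (\<lambda>h. h *\<^sub>R f' t)) (at t within S)"
      using assms(2)[OF t] by (simp add: has_vector_derivative_def)
    show "onorm (\<lambda>h. h *\<^sub>R f' t) \<le> B"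
      using assms(3)[OF t] by (intro onorm_le) (simp add: mult.commute[of B] mult_left_mono)
  qed
  then show ?thesis by simp
qed

text \<open>The constant \<open>1/2\<close> of Taylor's formula is given up in favour of a proof by the mean value inequality alone.\<close>

lemma first_order_Taylor:
  fixes f :: "real \<Rightarrow> 'a::real_normed_vector"
  assumes S: "convex S" and f: "\<And>t. t \<in> S \<Longrightarrow> (f has_vector_derivative f' t) (at t within S)"
    and f': "\<And>t. t \<in> S \<Longrightarrow> (f' has_vector_derivative f'' t) (at t within S)"
    and D: "\<And>t. t \<in> S \<Longrightarrow> norm (f'' t) \<le> D" and xy: "x \<in> S" "y \<in> S"
  shows "norm (f y - f x - (y - x) *\<^sub>R f' x) \<le> D * (y - x)\<^sup>2"
proof -
  have sub: "closed_segment x y \<subseteq> S" using S xy by (simp add: closed_segment_subset)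
  have D0: "D \<ge> 0" using D[OF xy(1)] norm_ge_zero order_trans by blast
  have "norm (f y - f x - (y - x) *\<^sub>R f' x) \<le> norm (y - x) * (D * \<bar>y - x\<bar>)"
  proof (rule vector_differentiable_bound_linearization[where S = "closed_segment x y"])
    fix t assume t: "t \<in> closed_segment x y"
    show "(f has_vector_derivative f' t) (at t within closed_segment x y)"
      using f sub t by (blast intro: has_vector_derivative_within_subset)
    have "norm (f' t - f' x) \<le> D * \<bar>t - x\<bar>"
      using sub t by (intro mean_value_bound[OF S f' D xy(1)]) auto
    also have "\<dots> \<le> D * \<bar>y - x\<bar>"
      using t D0 by (intro mult_left_mono) (auto simp: closed_segment_eq_real_ivl split: if_splits)
    finally show "norm (f' t - f' x) \<le> D * \<bar>y - x\<bar>" .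
  qed auto
  also have "\<dots> = D * (y - x)\<^sup>2" by (simp add: power2_eq_square)
  finally show ?thesis .
qed

text \<open>One of the two points at distance \<^term>\<open>\<delta>\<close> from \<^term>\<open>s\<close> lies in the interval; the difference quotient
towards it is at most \<open>2 B / \<delta>\<close> and deviates from the derivative by at most \<open>D \<delta>\<close>. With
\<open>\<delta>\<close> of order \<open>\<epsilon>^\<beta>\<close> both terms scale alike in \<^term>\<open>\<epsilon>\<close>.\<close>

lemma derivative_interpolation:
  fixes f :: "real \<Rightarrow> real"
  assumes f: "\<And>t. t \<in> {0..T} \<Longrightarrow> (f has_vector_derivative f' t) (at t within {0..T})"
    and f': "\<And>t. t \<in> {0..T} \<Longrightarrow> (f' has_vector_derivative f'' t) (at t within {0..T})"
    and B: "\<And>t. t \<in> {0..T} \<Longrightarrow> \<bar>f t\<bar> \<le> B" and D: "\<And>t. t \<in> {0..T} \<Longrightarrow> \<bar>f'' t\<bar> \<le> D"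
    and s: "s \<in> {0..T}" and \<delta>: "0 < \<delta>" "\<delta> \<le> T / 2"
  shows "\<bar>f' s\<bar> \<le> 2 * B / \<delta> + D * \<delta>"
proof -
  have "\<exists>y\<in>{0..T}. \<bar>y - s\<bar> = \<delta>"
  proof (cases "s \<le> T / 2")
    case True then show ?thesis using s \<delta> by (intro bexI[of _ "s + \<delta>"]) auto
  next
    case False then show ?thesis using s \<delta> by (intro bexI[of _ "s - \<delta>"]) auto
  qed
  then obtain y where y: "y \<in> {0..T}" "\<bar>y - s\<bar> = \<delta>" by blast
  have "\<bar>f y - f s - (y - s) * f' s\<bar> \<le> D * (y - s)\<^sup>2"
    using first_order_Taylor[of "{0..T}" f f' f'' D s y] f f' D s y by auto
  then have "\<bar>(y - s) * f' s\<bar> \<le> D * (y - s)\<^sup>2 + \<bar>f y\<bar> + \<bar>f s\<bar>" by linarith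
  also have "\<dots> \<le> D * \<delta>\<^sup>2 + 2 * B"
    using B[OF y(1)] B[OF s] y(2) by (metis add.assoc add_left_mono add_mono mult_2 power2_abs)
  finally have "\<delta> * \<bar>f' s\<bar> \<le> D * \<delta>\<^sup>2 + 2 * B" by (simp add: abs_mult y(2))
  then have "\<bar>f' s\<bar> \<le> (D * \<delta>\<^sup>2 + 2 * B) / \<delta>"
    using \<delta> by (simp add: pos_le_divide_eq mult.commute)
  also have "\<dots> = 2 * B / \<delta> + D * \<delta>"
    using \<delta> by (simp add: add_divide_distrib power2_eq_square)
  finally show ?thesis .
qed

lemma second_difference_bound:
  fixes f :: "real \<Rightarrow> real"
  assumes f: "\<And>t. t \<in> {0..T} \<Longrightarrow> (f has_vector_derivative f' t) (at t within {0..T})"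
    and f': "\<And>t. t \<in> {0..T} \<Longrightarrow> (f' has_vector_derivative f'' t) (at t within {0..T})"
    and D: "\<And>t. t \<in> {0..T} \<Longrightarrow> \<bar>f'' t\<bar> \<le> D"
    and w: "s - w \<in> {0..T}" "s + w \<in> {0..T}"
  shows "\<bar>f (s + w) + f (s - w) - 2 * f s\<bar> \<le> 2 * D * w\<^sup>2"
proof -
  have s: "s \<in> {0..T}" using w by auto
  have "\<bar>f (s + w) - f s - w * f' s\<bar> \<le> D * w\<^sup>2" "\<bar>f (s - w) - f s + w * f' s\<bar> \<le> D * w\<^sup>2"
    using first_order_Taylor[of "{0..T}" f f' f'' D s "s + w"]
      first_order_Taylor[of "{0..T}" f f' f'' D s "s - w"] f f' D s w by auto
  then show ?thesis by linarith
qed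

text \<open>For a forced oscillator \<open>y'' + z\<^sup>2 y = g\<close> that starts at rest, the function
\<open>t \<mapsto> cos(z(k-t)) y + sin(z(k-t))/z y'\<close> runs from \<open>0\<close> to \<open>y(k)\<close> and has derivative
\<open>sin(z(k-t))/z g\<close>, where \<open>\<bar>sin(z(k-t))/z\<bar> \<le> k\<close> regardless of the frequency. Pairing a family of
oscillators with the fixed vector \<open>(y_l(k))\<close> reduces the \<open>l^2\<close> estimate to the mean value inequality for
a single scalar function, with no interchange of integrals and norms.\<close>

lemma duhamel_l2_bound:
  fixes y y' y'' :: "'i \<Rightarrow> real \<Rightarrow> complex" and z :: "'i \<Rightarrow> real"
  assumes L: "finite L" and k: "0 \<le> k" and z: "\<And>l. l \<in> L \<Longrightarrow> 0 < z l"
    and y: "\<And>l t. l \<in> L \<Longrightarrow> t \<in> {0..k} \<Longrightarrow> (y l has_vector_derivative y' l t) (at t within {0..k})"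
    and y': "\<And>l t. l \<in> L \<Longrightarrow> t \<in> {0..k} \<Longrightarrow> (y' l has_vector_derivative y'' l t) (at t within {0..k})"
    and init: "\<And>l. l \<in> L \<Longrightarrow> y l 0 = 0" "\<And>l. l \<in> L \<Longrightarrow> y' l 0 = 0"
    and G: "\<And>t. t \<in> {0..k} \<Longrightarrow> L2_set (\<lambda>l. cmod (y'' l t + (z l)\<^sup>2 * y l t)) L \<le> G"
  shows "L2_set (\<lambda>l. cmod (y l k)) L \<le> k\<^sup>2 * G"
proof -
  define N where "N = L2_set (\<lambda>l. cmod (y l k)) L"
  define \<Psi> where "\<Psi> = (\<lambda>t. \<Sum>l\<in>L. cnj (y l k) *
      (complex_of_real (cos (z l * (k - t))) * y l t + complex_of_real (sin (z l * (k - t)) / z l) * y' l t))"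
  define \<Psi>' where "\<Psi>' = (\<lambda>t. \<Sum>l\<in>L. cnj (y l k) *
      (complex_of_real (sin (z l * (k - t)) / z l) * (y'' l t + (z l)\<^sup>2 * y l t)))"
  have N0: "N \<ge> 0" by (simp add: N_def)
  have der: "(\<Psi> has_vector_derivative \<Psi>' t) (at t within {0..k})" if t: "t \<in> {0..k}" for t
    unfolding \<Psi>_def \<Psi>'_def
  proof (intro has_vector_derivative_sum has_vector_derivative_mult_right)
    fix l assume l: "l \<in> L"
    have c: "((\<lambda>t. complex_of_real (cos (z l * (k - t)))) has_vector_derivative
          complex_of_real (z l * sin (z l * (k - t)))) (at t within {0..k})"
      by (intro has_vector_derivative_of_real) (auto intro!: derivative_eq_intros)
    have s: "((\<lambda>t. complex_of_real (sin (z l * (k - t)) / z l)) has_vector_derivative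
          complex_of_real (- cos (z l * (k - t)))) (at t within {0..k})"
      using z[OF l]
      by (intro has_vector_derivative_of_real) (auto intro!: derivative_eq_intros)
    have "((\<lambda>t. complex_of_real (cos (z l * (k - t))) * y l t + complex_of_real (sin (z l * (k - t)) / z l) * y' l t)
       has_vector_derivative
         (complex_of_real (cos (z l * (k - t))) * y' l t + complex_of_real (z l * sin (z l * (k - t))) * y l t)
         + (complex_of_real (sin (z l * (k - t)) / z l) * y'' l t + complex_of_real (- cos (z l * (k - t))) * y' l t))
       (at t within {0..k})"
      by (intro has_vector_derivative_add has_vector_derivative_mult c s y[OF l t] y'[OF l t])
    moreover have "(complex_of_real (cos (z l * (k - t))) * y' l t + complex_of_real (z l * sin (z l * (k - t))) * y l t)
         + (complex_of_real (sin (z l * (k - t)) / z l) * y'' l t + complex_of_real (- cos (z l * (k - t))) * y' l t)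
       = complex_of_real (sin (z l * (k - t)) / z l) * (y'' l t + (z l)\<^sup>2 * y l t)"
      using z[OF l] by (simp add: field_simps power2_eq_square)
    ultimately show "((\<lambda>t. complex_of_real (cos (z l * (k - t))) * y l t + complex_of_real (sin (z l * (k - t)) / z l) * y' l t)
       has_vector_derivative complex_of_real (sin (z l * (k - t)) / z l) * (y'' l t + (z l)\<^sup>2 * y l t)) (at t within {0..k})"
      by simp
  qed
  have bnd: "cmod (\<Psi>' t) \<le> k * N * G" if t: "t \<in> {0..k}" for t
  proof -
    have "cmod (\<Psi>' t) \<le> (\<Sum>l\<in>L. k * (\<bar>cmod (y l k)\<bar> * \<bar>cmod (y'' l t + (z l)\<^sup>2 * y l t)\<bar>))"
      unfolding \<Psi>'_def
    proof (rule sum_norm_le)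
      fix l assume l: "l \<in> L"
      have "\<bar>sin (z l * (k - t))\<bar> \<le> \<bar>z l * (k - t)\<bar>" by (rule abs_sin_x_le_abs_x)
      also have "\<dots> \<le> z l * k" using t z[OF l] by (auto simp: abs_mult)
      finally have "\<bar>sin (z l * (k - t)) / z l\<bar> \<le> k"
        using z[OF l] by (simp add: abs_div pos_divide_le_eq mult.commute)
      then have "cmod (y l k) * (\<bar>sin (z l * (k - t)) / z l\<bar> * cmod (y'' l t + (z l)\<^sup>2 * y l t))
         \<le> cmod (y l k) * (k * cmod (y'' l t + (z l)\<^sup>2 * y l t))"
        by (intro mult_left_mono mult_right_mono) auto
      then show "cmod (cnj (y l k) * (complex_of_real (sin (z l * (k - t)) / z l) * (y'' l t + (z l)\<^sup>2 * y l t)))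
         \<le> k * (\<bar>cmod (y l k)\<bar> * \<bar>cmod (y'' l t + (z l)\<^sup>2 * y l t)\<bar>)"
        unfolding norm_mult complex_mod_cnj norm_of_real by (simp add: mult_ac)
    qed
    also have "\<dots> = k * (\<Sum>l\<in>L. \<bar>cmod (y l k)\<bar> * \<bar>cmod (y'' l t + (z l)\<^sup>2 * y l t)\<bar>)"
      by (simp add: sum_distrib_left)
    also have "\<dots> \<le> k * (N * L2_set (\<lambda>l. cmod (y'' l t + (z l)\<^sup>2 * y l t)) L)"
      unfolding N_def using k by (intro mult_left_mono L2_set_mult_ineq)
    also have "\<dots> \<le> k * (N * G)" using k N0 G[OF t] by (intro mult_left_mono)
    finally show ?thesis by (simp add: mult.assoc)
  qed
  have "\<Psi> 0 = 0" unfolding \<Psi>_def using init by simp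
  moreover have "\<Psi> k = (\<Sum>l\<in>L. complex_of_real ((cmod (y l k))\<^sup>2))"
    unfolding \<Psi>_def by (intro sum.cong refl, subst complex_norm_square) (simp add: mult.commute)
  then have "\<Psi> k = complex_of_real (N\<^sup>2)"
    unfolding N_def L2_set_def by (simp add: sum_nonneg)
  ultimately have "N\<^sup>2 \<le> k * N * G * k"
    using mean_value_bound[of "{0..k}" \<Psi> \<Psi>' "k * N * G" 0 k] der bnd k by (simp add: norm_power)
  then have "N * N \<le> N * (k\<^sup>2 * G)" by (simp add: power2_eq_square mult_ac)
  moreover have "0 \<le> G" using G[of 0] k by (meson L2_set_nonneg atLeastAtMost_iff order_refl order_trans)
  ultimately show ?thesis unfolding N_def[symmetric] using N0
    by (cases "N = 0") auto
qed

section \<open>Derivatives of Fourier coefficients\<close>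

context
  fixes a b :: real
  assumes ab: "a < b"
begin

lemma fourier_coeff_has_vector_derivative:
  fixes u u' :: "real \<Rightarrow> real \<Rightarrow> complex"
  assumes u: "continuous_on ({c..d} \<times> {a..b}) (\<lambda>(s, x). u s x)"
    and u': "continuous_on ({c..d} \<times> {a..b}) (\<lambda>(s, x). u' s x)"
    and der: "\<And>s x. s \<in> {c..d} \<Longrightarrow> x \<in> {a..b} \<Longrightarrow>
      ((\<lambda>s. u s x) has_vector_derivative u' s x) (at s within {c..d})"
    and s: "s \<in> {c..d}"
  shows "((\<lambda>s. fourier_coeff a b (u s) l) has_vector_derivative fourier_coeff a b (u' s) l) (at s within {c..d})"
proof -
  have "continuous_on ({c..d} \<times> {a..b}) (\<lambda>z. u' (fst z) (snd z) * mode a b (- l) (snd z))"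
    using u' by (intro continuous_intros continuous_on_compose2[OF continuous_on_mode, of _ snd])
      (auto simp: case_prod_unfold)
  then have c': "continuous_on ({c..d} \<times> cbox a b) (\<lambda>(s, x). u' s x * mode a b (- l) x)"
    by (simp add: case_prod_unfold)
  have "((\<lambda>s. integral (cbox a b) (\<lambda>x. u s x * mode a b (- l) x)) has_vector_derivative
      integral (cbox a b) (\<lambda>x. u' s x * mode a b (- l) x)) (at s within {c..d})"
  proof (rule leibniz_rule_vector_derivative[OF _ _ c' s])
    show "((\<lambda>s. u s x * mode a b (- l) x) has_vector_derivative u' t x * mode a b (- l) x) (at t within {c..d})"
      if "t \<in> {c..d}" "x \<in> cbox a b" for t x
      using der[of t x] that by (intro has_vector_derivative_mult_left) auto
    show "(\<lambda>x. u t x * mode a b (- l) x) integrable_on cbox a b" if "t \<in> {c..d}" for t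
      using continuous_on_slice[OF u that] by (auto intro!: integrable_continuous_real continuous_intros)
  qed simp
  then have "((\<lambda>s. mean a b (\<lambda>x. u s x * mode a b (- l) x)) has_vector_derivative
      mean a b (\<lambda>x. u' s x * mode a b (- l) x)) (at s within {c..d})"
    unfolding mean_def by (auto intro: has_vector_derivative_divide)
  moreover have "mean a b (\<lambda>x. u' s x * mode a b (- l) x) = fourier_coeff a b (u' s) l"
    using continuous_on_slice[OF u' s] by (simp add: fourier_coeff_mean[OF ab])
  ultimately show ?thesis
    using continuous_on_slice[OF u] s
    by (auto intro: has_vector_derivative_transform simp: fourier_coeff_mean[OF ab])
qed

text \<open>The boundary terms of the integration by parts cancel by periodicity.\<close>

lemma fourier_coeff_derivative:
  assumes w: "\<And>x. x \<in> {a..b} \<Longrightarrow> (w has_vector_derivative w' x) (at x within {a..b})"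
    and w': "continuous_on {a..b} w'" and per: "w a = w b"
  shows "fourier_coeff a b w' l = \<i> * mu a b l * fourier_coeff a b w l"
proof -
  have wc: "continuous_on {a..b} w"
    using w has_vector_derivative_continuous by (fastforce simp: continuous_on_eq_continuous_within)
  let ?m = "mode a b (- l)"
  have "((\<lambda>x. w x * (\<i> * mu a b (- l) * ?m x) + w' x * ?m x) has_integral (w b * ?m b - w a * ?m a)) {a..b}"
    using ab by (intro fundamental_theorem_of_calculus has_vector_derivative_mult w mode_has_vector_derivative) auto
  then have "mean a b (\<lambda>x. w x * (\<i> * mu a b (- l) * ?m x) + w' x * ?m x) = 0"
    unfolding mean_def using per by (subst integral_unique) (auto simp: mode_right[OF ab])
  moreover have "(\<lambda>x. w x * (\<i> * mu a b (- l) * ?m x) + w' x * ?m x)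
      = (\<lambda>x. w' x * ?m x - (\<i> * mu a b l) * (w x * ?m x))"
    by (simp add: mu_uminus algebra_simps)
  moreover have "mean a b (\<lambda>x. w' x * ?m x - (\<i> * mu a b l) * (w x * ?m x))
      = mean a b (\<lambda>x. w' x * ?m x) - (\<i> * mu a b l) * mean a b (\<lambda>x. w x * ?m x)"
    using wc w' by (subst mean_diff) (auto intro!: continuous_intros simp: mean_cmult)
  ultimately show ?thesis by (simp add: fourier_coeff_mean[OF ab] wc w')
qed

end

lemma has_vector_derivative_scaleR_const:
  "(f has_vector_derivative f') F \<Longrightarrow> ((\<lambda>x. c *\<^sub>R f x) has_vector_derivative c *\<^sub>R f') F"
  by (rule bounded_linear.has_vector_derivative[OF bounded_linear_scaleR_right])

lemma has_vector_derivative_affine: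
  fixes f :: "real \<Rightarrow> 'a::real_normed_vector"
  assumes "(f has_vector_derivative f') (at (s + c * t) within S)"
    and "\<And>r. r \<in> R \<Longrightarrow> s + c * r \<in> S"
  shows "((\<lambda>t. f (s + c * t)) has_vector_derivative c *\<^sub>R f') (at t within R)"
proof -
  have "((\<lambda>t. s + c * t) has_vector_derivative c) (at t within R)"
    by (auto intro!: derivative_eq_intros has_vector_derivative_real_field[THEN has_vector_derivative_eq_rhs]
      simp flip: has_real_derivative_iff_has_vector_derivative)
  moreover have "(f has_vector_derivative f') (at (s + c * t) within (\<lambda>t. s + c * t) ` R)"
    using assms by (auto intro: has_vector_derivative_within_subset)
  ultimately show ?thesis
    using vector_diff_chain_within[of "\<lambda>t. s + c * t" c t R f f'] by (simp add: o_def)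
qed

context
  fixes a b :: real
  assumes ab: "a < b"
begin

lemma L2_fourier_coeff_le_mean_square:
  assumes "finite L" "continuous_on {a..b} w" "mean_square a b w \<le> S\<^sup>2" "0 \<le> S"
  shows "L2_set (\<lambda>l. cmod (fourier_coeff a b w l)) L \<le> S"
  unfolding L2_set_def using Bessel_inequality[OF ab assms(1,2)] assms(3,4) by (intro real_le_lsqrt) auto

lemma L2_fourier_coeff_le_sup:
  assumes "finite L" "continuous_on {a..b} w" "\<And>x. x \<in> {a..b} \<Longrightarrow> cmod (w x) \<le> S" "0 \<le> S"
  shows "L2_set (\<lambda>l. cmod (fourier_coeff a b w l)) L \<le> S"
  using assms by (intro L2_fourier_coeff_le_mean_square mean_square_le_sup[OF ab])

end

section \<open>Classical solutions of the Klein-Gordon equation\<close>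

text \<open>A classical solution on a time interval that strictly contains \<open>[0, T0]\<close>, so that all derivatives are continuous up to the end points.\<close>

locale kg_on_interval =
  fixes a b \<beta> \<epsilon> T0 :: real and T :: ereal and \<phi> \<gamma> :: "real \<Rightarrow> real" and u :: "real \<Rightarrow> real \<Rightarrow> real"
  assumes ab: "a < b" and T0: "0 < T0" and eps: "0 < \<epsilon>"
    and kg: "kg_solution a b \<beta> \<epsilon> \<phi> \<gamma> T u" and T: "ereal T0 < T"
begin

lemma time_in: "s \<in> {0..T0} \<Longrightarrow> 0 \<le> s \<and> ereal s < T"
  using T by (auto intro: le_less_trans[of "ereal s" "ereal T0"])

lemma continuous:
  "continuous_on ({0..T0} \<times> {a..b}) (\<lambda>(s, x). u s x)"
  "continuous_on ({0..T0} \<times> {a..b}) (\<lambda>(s, x). dt u s x)"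
  "continuous_on ({0..T0} \<times> {a..b}) (\<lambda>(s, x). dt (dt u) s x)"
  "continuous_on ({0..T0} \<times> {a..b}) (\<lambda>(s, x). dx a b u s x)"
  "continuous_on ({0..T0} \<times> {a..b}) (\<lambda>(s, x). dx a b (dx a b u) s x)"
proof -
  have sub: "{0..T0} \<times> {a..b} \<subseteq> {s. 0 \<le> s \<and> ereal s < T} \<times> {a..b}" using time_in by auto
  have "continuous_on ({0..T0} \<times> {a..b}) (\<lambda>(s, x). w s x)"
    if "w \<in> {u, dt u, dt (dt u), dx a b u, dx a b (dx a b u)}" for w
    by (rule continuous_on_subset[OF _ sub]) (use kg that in \<open>auto simp: kg_solution_def Let_def\<close>)
  then show "continuous_on ({0..T0} \<times> {a..b}) (\<lambda>(s, x). u s x)"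
    "continuous_on ({0..T0} \<times> {a..b}) (\<lambda>(s, x). dt u s x)"
    "continuous_on ({0..T0} \<times> {a..b}) (\<lambda>(s, x). dt (dt u) s x)"
    "continuous_on ({0..T0} \<times> {a..b}) (\<lambda>(s, x). dx a b u s x)"
    "continuous_on ({0..T0} \<times> {a..b}) (\<lambda>(s, x). dx a b (dx a b u) s x)" by blast+
qed

lemma has_time_derivative:
  assumes "s \<in> {0..T0}" "x \<in> {a..b}"
  shows "((\<lambda>r. u r x) has_vector_derivative dt u s x) (at s within {0..T0})"
    and "((\<lambda>r. dt u r x) has_vector_derivative dt (dt u) s x) (at s within {0..T0})"
proof -
  have "((\<lambda>r. w r x) has_vector_derivative dt w s x) (at s within {0..T0})" if "w \<in> {u, dt u}" for w
  proof -
    have "(\<lambda>r. w r x) differentiable (at s within {0..})"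
      using kg that assms time_in[OF assms(1)] by (auto simp: kg_solution_def Let_def)
    then have "((\<lambda>r. w r x) has_vector_derivative dt w s x) (at s within {0..})"
      unfolding dt_def by (rule vector_derivative_works[THEN iffD1])
    then show ?thesis by (rule has_vector_derivative_within_subset) auto
  qed
  then show "((\<lambda>r. u r x) has_vector_derivative dt u s x) (at s within {0..T0})"
    "((\<lambda>r. dt u r x) has_vector_derivative dt (dt u) s x) (at s within {0..T0})" by blast+
qed

lemma has_space_derivative:
  assumes "s \<in> {0..T0}" "x \<in> {a..b}"
  shows "(u s has_vector_derivative dx a b u s x) (at x within {a..b})"
    and "(dx a b u s has_vector_derivative dx a b (dx a b u) s x) (at x within {a..b})"
proof -
  have "(w s has_vector_derivative dx a b w s x) (at x within {a..b})" if "w \<in> {u, dx a b u}" for w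
  proof -
    have "w s differentiable (at x within {a..b})"
      using kg that assms time_in[OF assms(1)] by (auto simp: kg_solution_def Let_def)
    then show ?thesis
      unfolding dx_def by (rule vector_derivative_works[THEN iffD1])
  qed
  then show "(u s has_vector_derivative dx a b u s x) (at x within {a..b})"
    "(dx a b u s has_vector_derivative dx a b (dx a b u) s x) (at x within {a..b})" by blast+
qed

text \<open>The time derivatives inherit periodicity from the solution because one-sided derivatives on a nondegenerate interval are unique.\<close>

lemma periodic:
  assumes "s \<in> {0..T0}"
  shows "u s a = u s b" "dx a b u s a = dx a b u s b" "dt (dt u) s a = dt (dt u) s b"
proof -
  have per: "u s a = u s b" "dx a b u s a = dx a b u s b" if "s \<in> {0..T0}" for s
    using kg time_in[OF that] by (auto simp: kg_solution_def Let_def)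
  then show "u s a = u s b" "dx a b u s a = dx a b u s b" using assms by blast+
  have ends: "a \<in> {a..b}" "b \<in> {a..b}" using ab by auto
  have "dt u s a = dt u s b" if s: "s \<in> {0..T0}" for s
  proof (rule vector_derivative_unique_within_closed_interval[OF T0])
    show "s \<in> cbox 0 T0" using s by simp
    show "((\<lambda>r. u r a) has_vector_derivative dt u s a) (at s within cbox 0 T0)"
      using has_time_derivative(1)[OF s ends(1)] by simp
    show "((\<lambda>r. u r a) has_vector_derivative dt u s b) (at s within cbox 0 T0)"
      using has_vector_derivative_transform[OF s per(1) has_time_derivative(1)[OF s ends(2)]] by simp
  qed
  note dt_per = this
  show "dt (dt u) s a = dt (dt u) s b"
  proof (rule vector_derivative_unique_within_closed_interval[OF T0])
    show "s \<in> cbox 0 T0" using assms by simp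
    show "((\<lambda>r. dt u r a) has_vector_derivative dt (dt u) s a) (at s within cbox 0 T0)"
      using has_time_derivative(2)[OF assms ends(1)] by simp
    show "((\<lambda>r. dt u r a) has_vector_derivative dt (dt u) s b) (at s within cbox 0 T0)"
      using has_vector_derivative_transform[OF assms dt_per has_time_derivative(2)[OF assms ends(2)]] by simp
  qed
qed

lemma initial: "x \<in> {a..b} \<Longrightarrow> u 0 x = \<phi> x" "x \<in> {a..b} \<Longrightarrow> dt u 0 x = \<epsilon> powr (- \<beta>) * \<gamma> x"
  using kg by (auto simp: kg_solution_def Let_def)

text \<open>The equation is required in the open rectangle only; it extends to the closed one by continuity.\<close>

lemma pde:
  assumes "s \<in> {0..T0}" "x \<in> {a..b}"
  shows "\<epsilon> powr (2 * \<beta>) * dt (dt u) s x - dx a b (dx a b u) s x + u s x + \<epsilon>\<^sup>2 * (u s x) ^ 3 = 0"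
proof -
  define R where "R = (\<lambda>z. \<epsilon> powr (2 * \<beta>) * dt (dt u) (fst z) (snd z) - dx a b (dx a b u) (fst z) (snd z)
     + u (fst z) (snd z) + \<epsilon>\<^sup>2 * (u (fst z) (snd z)) ^ 3)"
  have cl: "closure ({0<..<T0} \<times> {a<..<b}) = {0..T0} \<times> {a..b}"
    using T0 ab by (simp add: closure_Times)
  have "continuous_on (closure ({0<..<T0} \<times> {a<..<b})) R"
    unfolding cl R_def using continuous by (intro continuous_intros) (auto simp: case_prod_unfold)
  moreover have "R z = 0" if "z \<in> {0<..<T0} \<times> {a<..<b}" for z
    using kg that time_in[of "fst z"] unfolding R_def kg_solution_def Let_def by auto
  ultimately have "R (s, x) = 0"
    by (rule continuous_constant_on_closure) (use assms cl in auto)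
  then show ?thesis by (simp add: R_def)
qed

abbreviation V :: "int \<Rightarrow> real \<Rightarrow> complex" where
  "V l s \<equiv> fourier_coeff a b (\<lambda>x. complex_of_real (u s x)) l"

abbreviation V' :: "int \<Rightarrow> real \<Rightarrow> complex" where
  "V' l s \<equiv> fourier_coeff a b (\<lambda>x. complex_of_real (dt u s x)) l"

abbreviation V'' :: "int \<Rightarrow> real \<Rightarrow> complex" where
  "V'' l s \<equiv> fourier_coeff a b (\<lambda>x. complex_of_real (dt (dt u) s x)) l"

abbreviation cube_coeff :: "int \<Rightarrow> real \<Rightarrow> complex" where
  "cube_coeff l s \<equiv> fourier_coeff a b (\<lambda>x. complex_of_real (u s x) ^ 3) l"

abbreviation \<zeta> :: "int \<Rightarrow> real" where
  "\<zeta> \<equiv> zeta_bar a b \<beta> \<epsilon>"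

lemma continuous_space:
  assumes "s \<in> {0..T0}"
  shows "continuous_on {a..b} (u s)" "continuous_on {a..b} (dt u s)" "continuous_on {a..b} (dt (dt u) s)"
    "continuous_on {a..b} (dx a b u s)" "continuous_on {a..b} (dx a b (dx a b u) s)"
  using continuous_on_slice[OF continuous(1) assms] continuous_on_slice[OF continuous(2) assms]
    continuous_on_slice[OF continuous(3) assms] continuous_on_slice[OF continuous(4) assms]
    continuous_on_slice[OF continuous(5) assms] by auto

lemma zeta_pos: "0 < \<zeta> l"
  unfolding zeta_bar_def using eps by (intro mult_pos_pos) (auto simp: add_pos_nonneg)

lemma zeta_square: "(\<zeta> l)\<^sup>2 = \<epsilon> powr (- 2 * \<beta>) * (1 + (mu a b l)\<^sup>2)"
proof -
  have "(\<epsilon> powr (- \<beta>))\<^sup>2 = \<epsilon> powr (- 2 * \<beta>)"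
    by (simp add: powr_add[symmetric] power2_eq_square)
  then show ?thesis by (simp add: zeta_bar_def power_mult_distrib)
qed

lemma powr_2_minus: "\<epsilon> powr (2 - 2 * \<beta>) = \<epsilon>\<^sup>2 / (\<epsilon> powr \<beta>)\<^sup>2"
proof -
  have "\<epsilon> powr (2 - 2 * \<beta>) = \<epsilon> powr 2 / \<epsilon> powr (2 * \<beta>)" by (rule powr_diff)
  moreover have "\<epsilon> powr (2 * \<beta>) = (\<epsilon> powr \<beta>)\<^sup>2"
    unfolding power2_eq_square powr_add[symmetric] by simp
  ultimately show ?thesis using eps by simp
qed

lemma V_derivative:
  assumes "s \<in> {0..T0}"
  shows "(V l has_vector_derivative V' l s) (at s within {0..T0})"
    and "(V' l has_vector_derivative V'' l s) (at s within {0..T0})"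
proof -
  have c: "continuous_on ({0..T0} \<times> {a..b}) (\<lambda>(s, x). complex_of_real (w s x))"
    if "continuous_on ({0..T0} \<times> {a..b}) (\<lambda>(s, x). w s x)" for w
    using that by (auto simp: case_prod_unfold intro!: continuous_intros)
  show "(V l has_vector_derivative V' l s) (at s within {0..T0})"
    by (rule fourier_coeff_has_vector_derivative[OF ab c c _ assms])
      (auto intro!: continuous bounded_linear.has_vector_derivative[OF bounded_linear_of_real] has_time_derivative)
  show "(V' l has_vector_derivative V'' l s) (at s within {0..T0})"
    by (rule fourier_coeff_has_vector_derivative[OF ab c c _ assms])
      (auto intro!: continuous bounded_linear.has_vector_derivative[OF bounded_linear_of_real] has_time_derivative)
qed

text \<open>Each mode is a harmonic oscillator of frequency \<open>\<zeta>_l\<close>, driven by the corresponding mode of the cubic term.\<close>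

lemma mode_ode:
  assumes s: "s \<in> {0..T0}"
  shows "V'' l s + (\<zeta> l)\<^sup>2 * V l s = - complex_of_real (\<epsilon> powr (2 - 2 * \<beta>)) * cube_coeff l s"
proof -
  note c = continuous_space[OF s]
  define e where "e = complex_of_real (\<epsilon> powr (- 2 * \<beta>))"
  have c': "continuous_on {a..b} (\<lambda>x. complex_of_real (dx a b (dx a b u) s x))"
    "continuous_on {a..b} (\<lambda>x. complex_of_real (dx a b u s x))"
    "continuous_on {a..b} (\<lambda>x. complex_of_real (u s x))"
    using c by (auto intro!: continuous_intros)
  have 1: "fourier_coeff a b (\<lambda>x. complex_of_real (dx a b u s x)) l = \<i> * mu a b l * V l s"
    by (rule fourier_coeff_derivative[OF ab])
      (auto intro!: c c' bounded_linear.has_vector_derivative[OF bounded_linear_of_real] has_space_derivative s simp: periodic[OF s])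
  have dxx: "fourier_coeff a b (\<lambda>x. complex_of_real (dx a b (dx a b u) s x)) l
      = \<i> * mu a b l * fourier_coeff a b (\<lambda>x. complex_of_real (dx a b u s x)) l"
    by (rule fourier_coeff_derivative[OF ab])
      (auto intro!: c c' bounded_linear.has_vector_derivative[OF bounded_linear_of_real] has_space_derivative s simp: periodic[OF s])
  have 2: "fourier_coeff a b (\<lambda>x. complex_of_real (dx a b (dx a b u) s x)) l = - (mu a b l)\<^sup>2 * V l s"
  proof -
    have "\<i> * mu a b l * (\<i> * mu a b l * V l s) = (\<i> * \<i>) * (complex_of_real (mu a b l) * complex_of_real (mu a b l)) * V l s"
      by (simp only: mult_ac)
    then show ?thesis unfolding dxx 1 by (simp add: power2_eq_square)
  qed
  have inv: "\<epsilon> powr (- 2 * \<beta>) * \<epsilon> powr (2 * \<beta>) = 1"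
    using eps by (simp add: powr_add[symmetric])
  have eq: "complex_of_real (dt (dt u) s x) = e * complex_of_real (dx a b (dx a b u) s x)
       - (e * complex_of_real (u s x) + (e * \<epsilon>\<^sup>2) * complex_of_real (u s x) ^ 3)" if "x \<in> {a..b}" for x
  proof -
    have "\<epsilon> powr (2 * \<beta>) * dt (dt u) s x = dx a b (dx a b u) s x - (u s x + \<epsilon>\<^sup>2 * (u s x) ^ 3)"
      using pde[OF s that] by linarith
    then have "\<epsilon> powr (- 2 * \<beta>) * (\<epsilon> powr (2 * \<beta>) * dt (dt u) s x)
       = \<epsilon> powr (- 2 * \<beta>) * (dx a b (dx a b u) s x - (u s x + \<epsilon>\<^sup>2 * (u s x) ^ 3))" by simp
    then have "dt (dt u) s x = \<epsilon> powr (- 2 * \<beta>) * dx a b (dx a b u) s x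
       - (\<epsilon> powr (- 2 * \<beta>) * u s x + (\<epsilon> powr (- 2 * \<beta>) * \<epsilon>\<^sup>2) * (u s x) ^ 3)"
      unfolding mult.assoc[symmetric] inv by (simp add: algebra_simps)
    then show ?thesis unfolding e_def by (metis (no_types, lifting) of_real_add of_real_diff of_real_mult of_real_power)
  qed
  have "V'' l s = fourier_coeff a b (\<lambda>x. e * complex_of_real (dx a b (dx a b u) s x)
       - (e * complex_of_real (u s x) + (e * \<epsilon>\<^sup>2) * complex_of_real (u s x) ^ 3)) l"
    by (rule fourier_coeff_cong[OF eq])
  also have "\<dots> = e * fourier_coeff a b (\<lambda>x. complex_of_real (dx a b (dx a b u) s x)) l
       - (e * V l s + (e * \<epsilon>\<^sup>2) * cube_coeff l s)"
    unfolding fourier_coeff_cmult[symmetric]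
    using c' by (subst fourier_coeff_diff[OF ab], (intro continuous_intros; simp)+)
      (subst fourier_coeff_add[OF ab], (intro continuous_intros; simp)+, rule refl)
  finally have f: "V'' l s = e * fourier_coeff a b (\<lambda>x. complex_of_real (dx a b (dx a b u) s x)) l
       - (e * V l s + (e * \<epsilon>\<^sup>2) * cube_coeff l s)" .
  have "V'' l s = - (e * (1 + (mu a b l)\<^sup>2)) * V l s - (e * \<epsilon>\<^sup>2) * cube_coeff l s"
    unfolding f 2 by (simp add: algebra_simps)
  moreover have "complex_of_real ((\<zeta> l)\<^sup>2) = e * (1 + (mu a b l)\<^sup>2)"
    unfolding zeta_square e_def by simp
  moreover have "e * complex_of_real (\<epsilon>\<^sup>2) = complex_of_real (\<epsilon> powr (2 - 2 * \<beta>))"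
  proof -
    have "\<epsilon> powr (- 2 * \<beta>) * \<epsilon>\<^sup>2 = \<epsilon> powr (2 - 2 * \<beta>)"
      using eps by (simp add: powr_add[symmetric] flip: powr_numeral)
    then show ?thesis unfolding e_def by (metis of_real_mult)
  qed
  ultimately show ?thesis by simp
qed

end

section \<open>Local error of the exponential integrator\<close>

text \<open>The bounds scale with \<^term>\<open>\<epsilon>\<close> as in the hypotheses on the exact solution, and the constants derived
below from \<^term>\<open>B\<close>, \<^term>\<open>D\<close> and \<^term>\<open>T0\<close> do not involve \<^term>\<open>\<epsilon>\<close>.\<close>

locale kg_bounded_solution = kg_on_interval +
  fixes B D :: real
  assumes eps1: "\<epsilon> \<le> 1"
    and B: "\<And>s x. s \<in> {0..T0} \<Longrightarrow> x \<in> {a..b} \<Longrightarrow> \<bar>u s x\<bar> \<le> B"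
    and D: "\<And>s x. s \<in> {0..T0} \<Longrightarrow> x \<in> {a..b} \<Longrightarrow> \<bar>dt (dt u) s x\<bar> \<le> D * \<epsilon> powr (- 2 * \<beta>)"
    and beta: "0 \<le> \<beta>"
begin

lemma B_nonneg: "0 \<le> B"
  using B[of 0 a] T0 ab by auto

lemma D_nonneg: "0 \<le> D"
proof -
  have "0 \<le> D * \<epsilon> powr (- 2 * \<beta>)" using D[of 0 a] T0 ab by auto
  then show ?thesis using eps by (simp add: zero_le_mult_iff)
qed

definition velocity_bound :: real where "velocity_bound = 4 * B / T0 + D * T0 / 2"

lemma velocity_bound_nonneg: "0 \<le> velocity_bound"
  unfolding velocity_bound_def using B_nonneg D_nonneg T0 by simp

text \<open>Interpolation between the bounds for \<open>u\<close> and \<open>u_ss\<close> at the scale \<open>\<epsilon>\<^sup>\<beta> T0 / 2\<close>.\<close>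

lemma dt_sup_bound:
  assumes s: "s \<in> {0..T0}" and x: "x \<in> {a..b}"
  shows "\<bar>dt u s x\<bar> \<le> velocity_bound * \<epsilon> powr (- \<beta>)"
proof -
  define \<delta> where "\<delta> = \<epsilon> powr \<beta> * T0 / 2"
  have "\<epsilon> powr \<beta> \<le> 1" using powr_mono2[of \<beta> \<epsilon> 1] eps eps1 beta by simp
  then have \<delta>: "0 < \<delta>" "\<delta> \<le> T0 / 2" using eps T0 by (auto simp: \<delta>_def)
  have "\<bar>dt u s x\<bar> \<le> 2 * B / \<delta> + D * \<epsilon> powr (- 2 * \<beta>) * \<delta>"
    by (rule derivative_interpolation[where f = "\<lambda>r. u r x" and f'' = "\<lambda>r. dt (dt u) r x" and T = T0])
      (use has_time_derivative B D s x \<delta> in auto)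
  also have "2 * B / \<delta> = 4 * B / T0 * \<epsilon> powr (- \<beta>)"
    using eps T0 by (simp add: \<delta>_def powr_minus field_simps)
  also have "D * \<epsilon> powr (- 2 * \<beta>) * \<delta> = D * T0 / 2 * (\<epsilon> powr (- 2 * \<beta>) * \<epsilon> powr \<beta>)"
    by (simp add: \<delta>_def)
  also have "\<epsilon> powr (- 2 * \<beta>) * \<epsilon> powr \<beta> = \<epsilon> powr (- \<beta>)"
    using eps by (simp add: powr_add[symmetric])
  finally show ?thesis by (simp add: velocity_bound_def algebra_simps)
qed

text \<open>With \<open>cube_curvature\<close>, the constants in the bounds for the first and second time derivatives of \<open>u\<^sup>3\<close>, up to powers of \<^term>\<open>\<epsilon>\<close>.\<close>

definition cube_rate :: real where "cube_rate = 3 * B\<^sup>2 * velocity_bound"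

definition cube_curvature :: real where "cube_curvature = 6 * B * velocity_bound\<^sup>2 + 3 * B\<^sup>2 * D"

lemma cube_derivative:
  assumes "s \<in> {0..T0}" "x \<in> {a..b}"
  shows "((\<lambda>r. (u r x) ^ 3) has_vector_derivative 3 * (u s x)\<^sup>2 * dt u s x) (at s within {0..T0})"
    and "((\<lambda>r. 3 * (u r x)\<^sup>2 * dt u r x) has_vector_derivative
        6 * u s x * (dt u s x)\<^sup>2 + 3 * (u s x)\<^sup>2 * dt (dt u) s x) (at s within {0..T0})"
  using has_time_derivative[OF assms]
  unfolding has_real_derivative_iff_has_vector_derivative[symmetric]
  by (auto intro!: derivative_eq_intros simp: power2_eq_square)

lemma cube_derivative_bound:
  assumes "s \<in> {0..T0}" "x \<in> {a..b}"
  shows "\<bar>3 * (u s x)\<^sup>2 * dt u s x\<bar> \<le> cube_rate * \<epsilon> powr (- \<beta>)"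
    and "\<bar>6 * u s x * (dt u s x)\<^sup>2 + 3 * (u s x)\<^sup>2 * dt (dt u) s x\<bar> \<le> cube_curvature * \<epsilon> powr (- 2 * \<beta>)"
proof -
  have B2: "(u s x)\<^sup>2 \<le> B\<^sup>2"
    using power_mono[OF B[OF assms], of 2] by simp
  have E: "(dt u s x)\<^sup>2 \<le> velocity_bound\<^sup>2 * \<epsilon> powr (- 2 * \<beta>)"
  proof -
    have "(dt u s x)\<^sup>2 \<le> (velocity_bound * \<epsilon> powr (- \<beta>))\<^sup>2"
      using power_mono[OF dt_sup_bound[OF assms], of 2] by simp
    moreover have "(\<epsilon> powr (- \<beta>))\<^sup>2 = \<epsilon> powr (- 2 * \<beta>)"
      by (simp add: powr_add[symmetric] power2_eq_square)
    ultimately show ?thesis by (simp add: power_mult_distrib)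
  qed
  have "\<bar>3 * (u s x)\<^sup>2 * dt u s x\<bar> = 3 * ((u s x)\<^sup>2 * \<bar>dt u s x\<bar>)" by (simp add: abs_mult)
  also have "\<dots> \<le> 3 * (B\<^sup>2 * (velocity_bound * \<epsilon> powr (- \<beta>)))"
    using B2 dt_sup_bound[OF assms] by (intro mult_left_mono mult_mono) auto
  finally show "\<bar>3 * (u s x)\<^sup>2 * dt u s x\<bar> \<le> cube_rate * \<epsilon> powr (- \<beta>)" by (simp add: cube_rate_def)
  have "\<bar>6 * u s x * (dt u s x)\<^sup>2 + 3 * (u s x)\<^sup>2 * dt (dt u) s x\<bar>
     \<le> 6 * (\<bar>u s x\<bar> * (dt u s x)\<^sup>2) + 3 * ((u s x)\<^sup>2 * \<bar>dt (dt u) s x\<bar>)"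
    by (rule order_trans[OF abs_triangle_ineq]) (simp add: abs_mult)
  also have "\<dots> \<le> 6 * (B * (velocity_bound\<^sup>2 * \<epsilon> powr (- 2 * \<beta>))) + 3 * (B\<^sup>2 * (D * \<epsilon> powr (- 2 * \<beta>)))"
    using B2 E B[OF assms] D[OF assms] B_nonneg by (intro add_mono mult_left_mono mult_mono) auto
  finally show "\<bar>6 * u s x * (dt u s x)\<^sup>2 + 3 * (u s x)\<^sup>2 * dt (dt u) s x\<bar> \<le> cube_curvature * \<epsilon> powr (- 2 * \<beta>)"
    by (simp add: cube_curvature_def algebra_simps)
qed

lemma cube_rate_nonneg: "0 \<le> cube_rate" and cube_curvature_nonneg: "0 \<le> cube_curvature"
  unfolding cube_rate_def cube_curvature_def using velocity_bound_nonneg B_nonneg D_nonneg by auto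

lemma continuous_cube:
  "s \<in> {0..T0} \<Longrightarrow> continuous_on {a..b} (\<lambda>x. complex_of_real (u s x) ^ 3)"
  using continuous_space(1) by (intro continuous_intros)

text \<open>As functions of the step size, the sum \<open>V_l(s+t) + V_l(s-t)\<close> and the update of the scheme solve the same
oscillator equation and agree to first order at \<open>t = 0\<close>, except that the scheme freezes the cubic term
at time \<^term>\<open>s\<close>. The forcing of the difference is thus a symmetric second difference of \<open>u\<^sup>3\<close>.\<close>

lemma local_error:
  assumes L: "finite L" and k: "0 < k" and s: "s - k \<in> {0..T0}" "s + k \<in> {0..T0}"
  shows "L2_set (\<lambda>l. cmod (V l (s + k) + V l (s - k)
      - 2 * p_bar a b \<beta> \<epsilon> k l * V l s - 2 * r_bar a b \<beta> \<epsilon> k l * cube_coeff l s)) L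
    \<le> 2 * cube_curvature * \<epsilon> powr (2 - 4 * \<beta>) * k ^ 4"
proof -
  define \<kappa> where "\<kappa> = \<epsilon> powr (2 - 2 * \<beta>)"
  have s0: "s \<in> {0..T0}" using s k by auto
  have in1: "s + t \<in> {0..T0}" and in2: "s - t \<in> {0..T0}" if "t \<in> {0..k}" for t
    using s that by auto
  \<comment> \<open>The difference between the exact solution and the update of the scheme for step size \<open>t\<close>, with its first
  two derivatives; the shape \<open>s + c * t\<close> is the one of \<open>has_vector_derivative_affine\<close>.\<close>
  define y where "y = (\<lambda>l t. V l (s + 1 * t) + V l (s + (- 1) * t) - complex_of_real (2 * cos (\<zeta> l * t)) * V l s
     - complex_of_real (2 * \<kappa> / (\<zeta> l)\<^sup>2 * (cos (\<zeta> l * t) - 1)) * cube_coeff l s)"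
  define y' where "y' = (\<lambda>l t. 1 *\<^sub>R V' l (s + 1 * t) + (- 1) *\<^sub>R V' l (s + (- 1) * t)
     - complex_of_real (- 2 * \<zeta> l * sin (\<zeta> l * t)) * V l s
     - complex_of_real (- 2 * \<kappa> / \<zeta> l * sin (\<zeta> l * t)) * cube_coeff l s)"
  define y'' where "y'' = (\<lambda>l t. 1 *\<^sub>R (1 *\<^sub>R V'' l (s + 1 * t)) + (- 1) *\<^sub>R ((- 1) *\<^sub>R V'' l (s + (- 1) * t))
     - complex_of_real (- 2 * (\<zeta> l)\<^sup>2 * cos (\<zeta> l * t)) * V l s
     - complex_of_real (- 2 * \<kappa> * cos (\<zeta> l * t)) * cube_coeff l s)"
  have main: "L2_set (\<lambda>l. cmod (y l k)) L \<le> k\<^sup>2 * (\<kappa> * (2 * (cube_curvature * \<epsilon> powr (- 2 * \<beta>)) * k\<^sup>2))"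
  proof (rule duhamel_l2_bound[where z = \<zeta> and y' = y' and y'' = y''])
    show "(y l has_vector_derivative y' l t) (at t within {0..k})" if t: "t \<in> {0..k}" for l t
      unfolding y_def y'_def using in1[OF t] in2[OF t] in1 in2 zeta_pos[of l]
      by (intro has_vector_derivative_diff has_vector_derivative_add has_vector_derivative_mult_left
          has_vector_derivative_affine[where S = "{0..T0}"] V_derivative has_vector_derivative_of_real)
        (auto intro!: derivative_eq_intros simp: power2_eq_square)
    show "(y' l has_vector_derivative y'' l t) (at t within {0..k})" if t: "t \<in> {0..k}" for l t
      unfolding y'_def y''_def using in1[OF t] in2[OF t] in1 in2 zeta_pos[of l]
      by (intro has_vector_derivative_diff has_vector_derivative_add has_vector_derivative_mult_left
          has_vector_derivative_scaleR_const
          has_vector_derivative_affine[where S = "{0..T0}"] V_derivative has_vector_derivative_of_real)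
        (auto intro!: derivative_eq_intros simp: power2_eq_square)
    show "L2_set (\<lambda>l. cmod (y'' l t + (\<zeta> l)\<^sup>2 * y l t)) L \<le> \<kappa> * (2 * (cube_curvature * \<epsilon> powr (- 2 * \<beta>)) * k\<^sup>2)"
      if t: "t \<in> {0..k}" for t
    proof -
      define g where "g = (\<lambda>x. complex_of_real (u (s + t) x) ^ 3 + complex_of_real (u (s - t) x) ^ 3
         - 2 * complex_of_real (u s x) ^ 3)"
      note c = continuous_cube[OF in1[OF t]] continuous_cube[OF in2[OF t]] continuous_cube[OF s0]
      have gc: "continuous_on {a..b} g"
        unfolding g_def by (intro continuous_on_diff continuous_on_add continuous_on_mult continuous_on_const c)
      have gl: "fourier_coeff a b g l = cube_coeff l (s + t) + cube_coeff l (s - t) - 2 * cube_coeff l s" for l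
        unfolding g_def fourier_coeff_cmult[symmetric] using c
        by (subst fourier_coeff_diff[OF ab], intro continuous_on_add c, intro continuous_on_mult continuous_on_const c)
           (subst fourier_coeff_add[OF ab], simp_all)
      have z: "\<zeta> l \<noteq> 0" for l using zeta_pos[of l] by simp
      have "y'' l t + (\<zeta> l)\<^sup>2 * y l t = (V'' l (s + t) + (\<zeta> l)\<^sup>2 * V l (s + t)) + (V'' l (s - t) + (\<zeta> l)\<^sup>2 * V l (s - t))
          + 2 * \<kappa> * cube_coeff l s" for l
        unfolding y_def y''_def using z[of l] by (simp add: field_simps)
      then have "y'' l t + (\<zeta> l)\<^sup>2 * y l t = - complex_of_real \<kappa> * fourier_coeff a b g l" for l
        unfolding mode_ode[OF in1[OF t]] mode_ode[OF in2[OF t]] gl \<kappa>_def[symmetric] by (simp add: algebra_simps)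
      then have "L2_set (\<lambda>l. cmod (y'' l t + (\<zeta> l)\<^sup>2 * y l t)) L = \<kappa> * L2_set (\<lambda>l. cmod (fourier_coeff a b g l)) L"
        by (simp add: norm_mult L2_set_right_distrib \<kappa>_def)
      also have "\<dots> \<le> \<kappa> * (2 * (cube_curvature * \<epsilon> powr (- 2 * \<beta>)) * k\<^sup>2)"
      proof (rule mult_left_mono[OF L2_fourier_coeff_le_sup[OF ab L gc]])
        fix x assume x: "x \<in> {a..b}"
        have "\<bar>(u (s + t) x) ^ 3 + (u (s - t) x) ^ 3 - 2 * (u s x) ^ 3\<bar> \<le> 2 * (cube_curvature * \<epsilon> powr (- 2 * \<beta>)) * t\<^sup>2"
          by (rule second_difference_bound[OF cube_derivative(1) cube_derivative(2) cube_derivative_bound(2)])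
            (use x in1[OF t] in2[OF t] in auto)
        also have "\<dots> \<le> 2 * (cube_curvature * \<epsilon> powr (- 2 * \<beta>)) * k\<^sup>2"
          using t cube_curvature_nonneg by (intro mult_left_mono power_mono) auto
        finally have "\<bar>(u (s + t) x) ^ 3 + (u (s - t) x) ^ 3 - 2 * (u s x) ^ 3\<bar> \<le> 2 * (cube_curvature * \<epsilon> powr (- 2 * \<beta>)) * k\<^sup>2" .
        moreover have "g x = complex_of_real ((u (s + t) x) ^ 3 + (u (s - t) x) ^ 3 - 2 * (u s x) ^ 3)"
          by (simp add: g_def)
        ultimately show "cmod (g x) \<le> 2 * (cube_curvature * \<epsilon> powr (- 2 * \<beta>)) * k\<^sup>2" by (simp only: norm_of_real)
      qed (use cube_curvature_nonneg in \<open>auto simp: \<kappa>_def\<close>)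
      finally show ?thesis .
    qed
    show "y l 0 = 0" "y' l 0 = 0" for l by (simp_all add: y_def y'_def)
  qed (use L k zeta_pos in auto)
  have yk: "y l k = V l (s + k) + V l (s - k)
      - 2 * p_bar a b \<beta> \<epsilon> k l * V l s - 2 * r_bar a b \<beta> \<epsilon> k l * cube_coeff l s" for l
  proof -
    have "2 * \<kappa> / (\<zeta> l)\<^sup>2 * (cos (\<zeta> l * k) - 1) = 2 * (\<epsilon>\<^sup>2 * (cos (k * \<zeta> l) - 1) / (\<epsilon> powr \<beta> * \<zeta> l)\<^sup>2)"
    proof -
      show ?thesis unfolding \<kappa>_def powr_2_minus by (simp add: power_mult_distrib mult.commute)
    qed
    then show ?thesis unfolding y_def p_bar_def r_bar_def by (simp add: mult.commute[of k])
  qed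
  have fin: "k\<^sup>2 * (\<kappa> * (2 * (cube_curvature * \<epsilon> powr (- 2 * \<beta>)) * k\<^sup>2)) = 2 * cube_curvature * \<epsilon> powr (2 - 4 * \<beta>) * k ^ 4"
  proof -
    have "\<kappa> * \<epsilon> powr (- 2 * \<beta>) = \<epsilon> powr (2 - 4 * \<beta>)"
      unfolding \<kappa>_def by (simp add: powr_add[symmetric])
    moreover have "k\<^sup>2 * (\<kappa> * (2 * (cube_curvature * \<epsilon> powr (- 2 * \<beta>)) * k\<^sup>2)) = 2 * cube_curvature * (\<kappa> * \<epsilon> powr (- 2 * \<beta>)) * k ^ 4"
      by (simp add: eval_nat_numeral)
    ultimately show ?thesis by simp
  qed
  show ?thesis using main unfolding yk fin .
qed

text \<open>The first step is not symmetric, so freezing the cubic term costs a first difference of \<open>u\<^sup>3\<close> and the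
local error is one order lower in \<^term>\<open>k\<close>; it occurs only once.\<close>

lemma local_error_first_step:
  assumes L: "finite L" and k: "0 < k" "k \<in> {0..T0}"
  shows "L2_set (\<lambda>l. cmod (V l k - p_bar a b \<beta> \<epsilon> k l * V l 0
      - q_bar a b \<beta> \<epsilon> k l * fourier_coeff a b (\<lambda>x. complex_of_real (\<gamma> x)) l
      - r_bar a b \<beta> \<epsilon> k l * cube_coeff l 0)) L
    \<le> cube_rate * \<epsilon> powr (2 - 3 * \<beta>) * k ^ 3"
proof -
  define \<kappa> where "\<kappa> = \<epsilon> powr (2 - 2 * \<beta>)"
  have s0: "0 \<in> {0..T0}" using k by auto
  have in1: "t \<in> {0..T0}" if "t \<in> {0..k}" for t using k that by auto
  define y where "y = (\<lambda>l t. V l t - complex_of_real (cos (\<zeta> l * t)) * V l 0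
     - complex_of_real (sin (\<zeta> l * t) / \<zeta> l) * V' l 0
     - complex_of_real (\<kappa> / (\<zeta> l)\<^sup>2 * (cos (\<zeta> l * t) - 1)) * cube_coeff l 0)"
  define y' where "y' = (\<lambda>l t. V' l t
     - complex_of_real (- \<zeta> l * sin (\<zeta> l * t)) * V l 0
     - complex_of_real (cos (\<zeta> l * t)) * V' l 0
     - complex_of_real (- \<kappa> / \<zeta> l * sin (\<zeta> l * t)) * cube_coeff l 0)"
  define y'' where "y'' = (\<lambda>l t. V'' l t
     - complex_of_real (- (\<zeta> l)\<^sup>2 * cos (\<zeta> l * t)) * V l 0
     - complex_of_real (- \<zeta> l * sin (\<zeta> l * t)) * V' l 0
     - complex_of_real (- \<kappa> * cos (\<zeta> l * t)) * cube_coeff l 0)"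
  have V: "(V l has_vector_derivative V' l t) (at t within {0..k})"
    "(V' l has_vector_derivative V'' l t) (at t within {0..k})" if "t \<in> {0..k}" for l t
    by (rule has_vector_derivative_within_subset[OF V_derivative(1)[OF in1[OF that]]]
             has_vector_derivative_within_subset[OF V_derivative(2)[OF in1[OF that]]]; use k in auto)+
  have main: "L2_set (\<lambda>l. cmod (y l k)) L \<le> k\<^sup>2 * (\<kappa> * (cube_rate * \<epsilon> powr (- \<beta>) * k))"
  proof (rule duhamel_l2_bound[where z = \<zeta> and y' = y' and y'' = y''])
    show "(y l has_vector_derivative y' l t) (at t within {0..k})" if t: "t \<in> {0..k}" for l t
      unfolding y_def y'_def using zeta_pos[of l]
      by (intro has_vector_derivative_diff has_vector_derivative_mult_left V[OF t] has_vector_derivative_of_real)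
        (auto intro!: derivative_eq_intros simp: power2_eq_square)
    show "(y' l has_vector_derivative y'' l t) (at t within {0..k})" if t: "t \<in> {0..k}" for l t
      unfolding y'_def y''_def using zeta_pos[of l]
      by (intro has_vector_derivative_diff has_vector_derivative_mult_left V[OF t] has_vector_derivative_of_real)
        (auto intro!: derivative_eq_intros simp: power2_eq_square)
    show "L2_set (\<lambda>l. cmod (y'' l t + (\<zeta> l)\<^sup>2 * y l t)) L \<le> \<kappa> * (cube_rate * \<epsilon> powr (- \<beta>) * k)"
      if t: "t \<in> {0..k}" for t
    proof -
      define g where "g = (\<lambda>x. complex_of_real (u t x) ^ 3 - complex_of_real (u 0 x) ^ 3)"
      note c = continuous_cube[OF in1[OF t]] continuous_cube[OF s0]
      have gc: "continuous_on {a..b} g"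
        unfolding g_def by (rule continuous_on_diff[OF c])
      have gl: "fourier_coeff a b g l = cube_coeff l t - cube_coeff l 0" for l
        unfolding g_def by (rule fourier_coeff_diff[OF ab c])
      have z: "\<zeta> l \<noteq> 0" for l using zeta_pos[of l] by simp
      have "y'' l t + (\<zeta> l)\<^sup>2 * y l t = (V'' l t + (\<zeta> l)\<^sup>2 * V l t) + \<kappa> * cube_coeff l 0" for l
        unfolding y_def y''_def using z[of l] by (simp add: field_simps power2_eq_square)
      then have "y'' l t + (\<zeta> l)\<^sup>2 * y l t = - complex_of_real \<kappa> * fourier_coeff a b g l" for l
        unfolding mode_ode[OF in1[OF t]] gl \<kappa>_def[symmetric] by (simp add: algebra_simps)
      then have "L2_set (\<lambda>l. cmod (y'' l t + (\<zeta> l)\<^sup>2 * y l t)) L = \<kappa> * L2_set (\<lambda>l. cmod (fourier_coeff a b g l)) L"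
        by (simp add: norm_mult L2_set_right_distrib \<kappa>_def)
      also have "\<dots> \<le> \<kappa> * (cube_rate * \<epsilon> powr (- \<beta>) * k)"
      proof (rule mult_left_mono[OF L2_fourier_coeff_le_sup[OF ab L gc]])
        fix x assume x: "x \<in> {a..b}"
        have "norm ((u t x) ^ 3 - (u 0 x) ^ 3) \<le> cube_rate * \<epsilon> powr (- \<beta>) * \<bar>t - 0\<bar>"
          by (rule mean_value_bound[OF convex_closed_interval cube_derivative(1)])
            (use x in1[OF t] s0 cube_derivative_bound(1) in auto)
        also have "\<dots> \<le> cube_rate * \<epsilon> powr (- \<beta>) * k"
          using t cube_rate_nonneg by (intro mult_left_mono) auto
        finally have "\<bar>(u t x) ^ 3 - (u 0 x) ^ 3\<bar> \<le> cube_rate * \<epsilon> powr (- \<beta>) * k" by simp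
        moreover have "g x = complex_of_real ((u t x) ^ 3 - (u 0 x) ^ 3)"
          by (simp add: g_def)
        ultimately show "cmod (g x) \<le> cube_rate * \<epsilon> powr (- \<beta>) * k" by (simp only: norm_of_real)
      qed (use cube_rate_nonneg k in \<open>auto simp: \<kappa>_def\<close>)
      finally show ?thesis .
    qed
    show "y l 0 = 0" "y' l 0 = 0" for l by (simp_all add: y_def y'_def)
  qed (use L k zeta_pos in auto)
  have yk: "y l k = V l k - p_bar a b \<beta> \<epsilon> k l * V l 0
      - q_bar a b \<beta> \<epsilon> k l * fourier_coeff a b (\<lambda>x. complex_of_real (\<gamma> x)) l
      - r_bar a b \<beta> \<epsilon> k l * cube_coeff l 0" for l
  proof -
    have "\<kappa> / (\<zeta> l)\<^sup>2 * (cos (\<zeta> l * k) - 1) = \<epsilon>\<^sup>2 * (cos (k * \<zeta> l) - 1) / (\<epsilon> powr \<beta> * \<zeta> l)\<^sup>2"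
      unfolding \<kappa>_def powr_2_minus by (simp add: power_mult_distrib mult.commute)
    moreover have "V' l 0 = complex_of_real (\<epsilon> powr (- \<beta>)) * fourier_coeff a b (\<lambda>x. complex_of_real (\<gamma> x)) l"
      unfolding fourier_coeff_cmult[symmetric] by (rule fourier_coeff_cong) (simp add: initial)
    moreover have "sin (\<zeta> l * k) / \<zeta> l * \<epsilon> powr (- \<beta>) = sin (k * \<zeta> l) / (\<epsilon> powr \<beta> * \<zeta> l)"
      using eps by (simp add: powr_minus field_simps)
    then have "complex_of_real (sin (\<zeta> l * k) / \<zeta> l) * (complex_of_real (\<epsilon> powr (- \<beta>)) * c)
        = complex_of_real (sin (k * \<zeta> l) / (\<epsilon> powr \<beta> * \<zeta> l)) * c" for c
      by (metis mult.assoc of_real_mult)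
    ultimately show ?thesis unfolding y_def p_bar_def r_bar_def q_bar_def by (simp add: mult.commute[of k])
  qed
  have fin: "k\<^sup>2 * (\<kappa> * (cube_rate * \<epsilon> powr (- \<beta>) * k)) = cube_rate * \<epsilon> powr (2 - 3 * \<beta>) * k ^ 3"
  proof -
    have "\<kappa> * \<epsilon> powr (- \<beta>) = \<epsilon> powr (2 - 3 * \<beta>)"
      unfolding \<kappa>_def by (simp add: powr_add[symmetric])
    moreover have "k\<^sup>2 * (\<kappa> * (cube_rate * \<epsilon> powr (- \<beta>) * k)) = cube_rate * (\<kappa> * \<epsilon> powr (- \<beta>)) * k ^ 3"
      by (simp add: eval_nat_numeral)
    ultimately show ?thesis by simp
  qed
  show ?thesis using main unfolding yk fin .
qed

end

section \<open>Linear recurrences and elementary inequalities\<close>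

lemma L2_set_sum_le:
  "L2_set (\<lambda>l. \<Sum>j\<in>J. f j l) L \<le> (\<Sum>j\<in>J. L2_set (f j) L)"
proof (induction J rule: infinite_finite_induct)
  case (insert j J)
  have "L2_set (\<lambda>l. f j l + (\<Sum>j\<in>J. f j l)) L \<le> L2_set (f j) L + L2_set (\<lambda>l. \<Sum>j\<in>J. f j l) L"
    by (rule L2_set_triangle_ineq)
  with insert show ?case by simp
qed (simp_all add: L2_set_def)

text \<open>The quotients \<open>sin(m\<theta>)/sin \<theta>\<close> are the Chebyshev polynomials of the second kind in \<open>cos \<theta>\<close>, which
solve the homogeneous recurrence with initial values \<open>0, 1\<close>.\<close>

lemma discrete_duhamel:
  fixes e R :: "nat \<Rightarrow> complex" and \<theta> :: real
  assumes "sin \<theta> \<noteq> 0" and e0: "e 0 = 0" and e1: "1 \<le> N \<Longrightarrow> e 1 = R 0"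
    and rec: "\<And>n. n + 2 \<le> N \<Longrightarrow> e (n + 2) = 2 * complex_of_real (cos \<theta>) * e (n + 1) - e n + R (n + 1)"
  shows "n \<le> N \<Longrightarrow> e n = (\<Sum>j<n. complex_of_real (sin (real (n - j) * \<theta>) / sin \<theta>) * R j)"
proof (induction n rule: less_induct)
  case (less n)
  define U where "U = (\<lambda>m::nat. complex_of_real (sin (real m * \<theta>) / sin \<theta>))"
  have U1: "U 1 = 1" using assms(1) by (simp add: U_def)
  have U0: "U 0 = 0" by (simp add: U_def)
  have Urec: "U (m + 2) = 2 * complex_of_real (cos \<theta>) * U (m + 1) - U m" for m
  proof -
    have "sin (real (m + 2) * \<theta>) + sin (real m * \<theta>) = 2 * cos \<theta> * sin (real (m + 1) * \<theta>)"
    proof -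
      have *: "real (m + 2) * \<theta> = real (m + 1) * \<theta> + \<theta>" "real m * \<theta> = real (m + 1) * \<theta> - \<theta>"
        by (simp_all add: algebra_simps)
      show ?thesis unfolding * sin_add sin_diff by simp
    qed
    then have "sin (real (m + 2) * \<theta>) / sin \<theta> = 2 * cos \<theta> * (sin (real (m + 1) * \<theta>) / sin \<theta>) - sin (real m * \<theta>) / sin \<theta>"
      using assms(1) by (simp add: field_simps)
    then show ?thesis unfolding U_def by (metis (no_types, lifting) of_real_diff of_real_mult of_real_numeral)
  qed
  consider "n = 0" | "n = 1" | m where "n = m + 2"
    by (metis add_2_eq_Suc' not0_implies_Suc One_nat_def)
  then show ?case
  proof cases
    case 1 then show ?thesis using e0 by simp
  next
    case 2 then show ?thesis using e1 less.prems assms(1) by simp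
  next
    case (3 m)
    have IH1: "e (m + 1) = (\<Sum>j<m + 1. U (m + 1 - j) * R j)"
      using less.IH[of "m + 1"] less.prems 3 unfolding U_def by simp
    have IH0: "e m = (\<Sum>j<m. U (m - j) * R j)"
      using less.IH[of m] less.prems 3 unfolding U_def by simp
    have U2: "U 2 = 2 * complex_of_real (cos \<theta>)" using Urec[of 0] U1 U0 by (simp add: numeral_2_eq_2)
    have "(\<Sum>j<n. U (n - j) * R j) = (\<Sum>j<m. U (m - j + 2) * R j) + U 2 * R m + U 1 * R (m + 1)"
      using 3 by (simp add: numeral_2_eq_2 Suc_diff_le cong: sum.cong_simp)
    also have "(\<Sum>j<m. U (m - j + 2) * R j)
        = 2 * complex_of_real (cos \<theta>) * (\<Sum>j<m. U (m - j + 1) * R j) - (\<Sum>j<m. U (m - j) * R j)"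
      unfolding Urec by (simp add: sum_distrib_left left_diff_distrib sum_subtractf mult.assoc)
    also have "(\<Sum>j<m. U (m - j + 1) * R j) = e (m + 1) - R m"
      unfolding IH1 using U1 by (simp add: Suc_diff_le cong: sum.cong_simp)
    finally have "(\<Sum>j<n. U (n - j) * R j) = 2 * complex_of_real (cos \<theta>) * e (m + 1) - e m + R (m + 1)"
      unfolding U2 U1 IH0[symmetric] by (simp add: algebra_simps)
    then show ?thesis using rec[of m] 3 less.prems unfolding U_def by simp
  qed
qed

lemma discrete_gronwall:
  fixes x :: "nat \<Rightarrow> real"
  assumes "0 \<le> q" "\<And>n. n \<le> N \<Longrightarrow> x n \<le> G + q * (\<Sum>j<n. x j)"
  shows "n \<le> N \<Longrightarrow> x n \<le> G * (1 + q) ^ n"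
proof (induction n rule: less_induct)
  case (less n)
  have "x n \<le> G + q * (\<Sum>j<n. x j)" by (rule assms(2)[OF less.prems])
  also have "\<dots> \<le> G + q * (\<Sum>j<n. G * (1 + q) ^ j)"
    using less assms(1) by (intro add_left_mono mult_left_mono sum_mono) auto
  also have "\<dots> = G * (1 + q) ^ n"
    by (induction n) (simp_all add: algebra_simps)
  finally show ?case .
qed

text \<open>The slope of the sine is at least \<open>cos(\<pi>/3) = 1/2\<close> on the interval.\<close>

lemma half_le_sin:
  assumes "0 \<le> x" "x \<le> pi / 3"
  shows "x / 2 \<le> sin x"
proof (cases "x = 0")
  case False
  then have "x > 0" using assms by simp
  then obtain \<xi> where \<xi>: "0 < \<xi>" "\<xi> < x" "sin x - sin 0 = (x - 0) * cos \<xi>"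
    using MVT2[of 0 x sin cos] by (auto intro: DERIV_sin)
  have "cos (pi / 3) \<le> cos \<xi>" using \<xi> assms pi_gt_zero by (intro cos_monotone_0_pi_le) auto
  then have "x * (1 / 2) \<le> x * cos \<xi>" using \<open>x > 0\<close> by (simp add: cos_60)
  then show ?thesis using \<xi> by simp
qed simp

lemma cube_difference_bound:
  fixes z w :: complex
  assumes "cmod z \<le> R" "cmod w \<le> R"
  shows "cmod (z ^ 3 - w ^ 3) \<le> 3 * R\<^sup>2 * cmod (z - w)"
proof -
  have R: "0 \<le> R" using assms(1) norm_ge_zero order_trans by blast
  have "z ^ 3 - w ^ 3 = (z\<^sup>2 + z * w + w\<^sup>2) * (z - w)"
    by (simp add: algebra_simps power2_eq_square power3_eq_cube)
  then have "cmod (z ^ 3 - w ^ 3) = cmod (z\<^sup>2 + z * w + w\<^sup>2) * cmod (z - w)"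
    by (simp add: norm_mult)
  also have "\<dots> \<le> (R\<^sup>2 + R\<^sup>2 + R\<^sup>2) * cmod (z - w)"
  proof (intro mult_right_mono norm_ge_zero)
    have "cmod (z\<^sup>2) \<le> R\<^sup>2" "cmod (w\<^sup>2) \<le> R\<^sup>2" "cmod (z * w) \<le> R\<^sup>2"
      using assms R by (auto simp: norm_power norm_mult power2_eq_square intro!: mult_mono)
    then show "cmod (z\<^sup>2 + z * w + w\<^sup>2) \<le> R\<^sup>2 + R\<^sup>2 + R\<^sup>2"
      by (intro norm_triangle_mono)
  qed
  finally show ?thesis by simp
qed

section \<open>Global error of the spectral integrator\<close>

lemma finite_modes: "finite (modes M)"
  by (simp add: modes_def)

lemma trig_poly_has_vector_derivative:
  "(trig_poly a b M c has_vector_derivative trig_poly a b M (\<lambda>l. \<i> * mu a b l * c l) x) (at x within S)"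
proof -
  have "((\<lambda>x. \<Sum>l\<in>modes M. c l * mode a b l x) has_vector_derivative
      (\<Sum>l\<in>modes M. c l * (\<i> * mu a b l * mode a b l x))) (at x within S)"
    by (intro has_vector_derivative_sum has_vector_derivative_mult_right mode_has_vector_derivative)
  then show ?thesis unfolding trig_poly_mode by (simp add: mult_ac)
qed

lemma continuous_on_trig_poly: "continuous_on S (trig_poly a b M c)"
  unfolding trig_poly_mode by (intro continuous_intros)

context
  fixes a b :: real
  assumes ab: "a < b"
begin

lemma fourier_coeff_trig_poly:
  "fourier_coeff a b (trig_poly a b M c) l = (if l \<in> modes M then c l else 0)"
  unfolding trig_poly_mode by (rule fourier_coeff_trig_sum[OF ab finite_modes])

lemma trig_poly_fourier_coeff: "trig_poly a b M (fourier_coeff a b (trig_poly a b M c)) = trig_poly a b M c"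
  unfolding fourier_coeff_trig_poly by (simp add: trig_poly_def fun_eq_iff)

lemma ewi_fs_trig_poly: "ewi_fs a b \<beta> \<epsilon> \<phi> \<gamma> M k n = trig_poly a b M (fourier_coeff a b (ewi_fs a b \<beta> \<epsilon> \<phi> \<gamma> M k n))"
  by (cases "(a, b, \<beta>, \<epsilon>, \<phi>, \<gamma>, M, k, n)" rule: ewi_fs.cases)
    (auto simp only: ewi_fs.simps trig_poly_fourier_coeff prod.inject)

lemma trig_poly_right_end: "trig_poly a b M c a = trig_poly a b M c b"
  by (simp add: trig_poly_mode mode_right[OF ab])

lemma mu_on_modes:
  assumes M: "0 < M" "even M" and l: "l \<in> modes M"
  shows "\<bar>mu a b l\<bar> \<le> pi / ((b - a) / real M)"
proof -
  have "2 * \<bar>l\<bar> \<le> int M" using l M by (auto simp: modes_def)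
  then have "2 * \<bar>real_of_int l\<bar> \<le> real M" by linarith
  then have "pi * (2 * \<bar>real_of_int l\<bar>) \<le> pi * real M" by (intro mult_left_mono) auto
  then show ?thesis using ab M by (simp add: mu_def abs_mult abs_divide divide_right_mono mult_ac)
qed

lemma mu_off_modes:
  assumes M: "0 < M" "even M" and l: "l \<notin> modes M"
  shows "pi / ((b - a) / real M) \<le> \<bar>mu a b l\<bar>"
proof -
  obtain N where "M = 2 * N" using M by (auto elim: evenE)
  then have "int M \<le> 2 * \<bar>l\<bar>" using l by (auto simp: modes_def not_le)
  then have "real M \<le> 2 * \<bar>real_of_int l\<bar>" by linarith
  then have "pi * real M \<le> pi * (2 * \<bar>real_of_int l\<bar>)" by (intro mult_left_mono) auto
  then show ?thesis using ab M by (simp add: mu_def abs_mult abs_divide divide_right_mono mult_ac)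
qed

end

text \<open>The exact solution is bounded in \<open>H\<^sup>m\<^sup>0\<close> by \<^term>\<open>A\<close>. The restriction \<^term>\<open>k \<le> \<epsilon> powr \<beta> * pi * h / (3 * sqrt (h\<^sup>2 + pi\<^sup>2))\<close>
of the time step resolves the fastest oscillation on the mesh.\<close>

locale ewi_fs_error = kg_bounded_solution +
  fixes A h k :: real and m0 M :: nat
  assumes A: "\<And>s. s \<in> {0..T0} \<Longrightarrow> H_bounded a b m0 (\<lambda>x. complex_of_real (u s x)) A" and A0: "0 \<le> A"
    and m0: "2 \<le> m0" and M: "0 < M" "even M" and h: "h = (b - a) / real M" "h \<le> 1"
    and k: "0 < k" and cfl: "k \<le> \<epsilon> powr \<beta> * pi * h / (3 * sqrt (h\<^sup>2 + pi\<^sup>2))"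
    and beta2: "\<beta> \<le> 2"
begin

text \<open>A Lipschitz constant of the cube on the disc of radius \<open>B + 1\<close>.\<close>

definition lip :: real where "lip = 3 * (B + 1)\<^sup>2"

text \<open>The Gronwall constant: consistency and projection errors, amplified over the time interval.\<close>

definition error_const :: real where "error_const = (2 * cube_rate + 4 * cube_curvature * T0 + 2 * lip * T0 * A) * exp (2 * lip * T0)"

definition \<rho> :: real where "\<rho> = \<epsilon> powr (2 - 3 * \<beta>) * k\<^sup>2"

abbreviation vM :: "nat \<Rightarrow> real \<Rightarrow> complex" where
  "vM n \<equiv> ewi_fs a b \<beta> \<epsilon> \<phi> \<gamma> M k n"

definition err :: "nat \<Rightarrow> real \<Rightarrow> complex" where
  "err n x = complex_of_real (u (real n * k) x) - vM n x"

definition mode_error :: "nat \<Rightarrow> int \<Rightarrow> complex" where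
  "mode_error n l = V l (real n * k) - fourier_coeff a b (vM n) l"

text \<open>The \<open>H\<^sup>j\<close> norm of the error of the resolved modes.\<close>

definition Hnorm :: "nat \<Rightarrow> nat \<Rightarrow> real" where
  "Hnorm j n = L2_set (\<lambda>l. sqrt ((1 + (mu a b l)\<^sup>2) ^ j) * cmod (mode_error n l)) (modes M)"

lemma h_pos: "0 < h" using ab M h by simp

lemma rho_nonneg: "0 \<le> \<rho>" by (simp add: \<rho>_def)

lemma lip_nonneg: "0 \<le> lip" by (simp add: lip_def)

lemma error_const_nonneg: "0 \<le> error_const"
  unfolding error_const_def using cube_rate_nonneg cube_curvature_nonneg T0 lip_nonneg A0 by auto

lemma continuous_vM: "continuous_on S (vM n)"
  by (subst ewi_fs_trig_poly[OF ab]) (rule continuous_on_trig_poly)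

lemma vM_periodic: "vM n a = vM n b"
  by (subst (1 2) ewi_fs_trig_poly[OF ab]) (rule trig_poly_right_end[OF ab])

lemma vM_off_modes: "l \<notin> modes M \<Longrightarrow> fourier_coeff a b (vM n) l = 0"
  by (subst ewi_fs_trig_poly[OF ab]) (simp add: fourier_coeff_trig_poly[OF ab])

lemma time_grid: "real n * k \<le> T0 \<Longrightarrow> real n * k \<in> {0..T0}"
  using k by auto

lemma continuous_u: "real n * k \<le> T0 \<Longrightarrow> continuous_on {a..b} (\<lambda>x. complex_of_real (u (real n * k) x))"
  using continuous_space(1)[OF time_grid] by (intro continuous_intros)

lemma continuous_err: "real n * k \<le> T0 \<Longrightarrow> continuous_on {a..b} (err n)"
  unfolding err_def by (intro continuous_on_diff continuous_u continuous_vM)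

lemma err_periodic: "real n * k \<le> T0 \<Longrightarrow> err n a = err n b"
  unfolding err_def using vM_periodic periodic(1)[OF time_grid] by simp

lemma fourier_coeff_err:
  assumes "real n * k \<le> T0"
  shows "fourier_coeff a b (err n) l = mode_error n l"
  unfolding err_def mode_error_def by (rule fourier_coeff_diff[OF ab continuous_u[OF assms] continuous_vM])

text \<open>The highest resolved frequency is at most \<open>\<epsilon>\<^sup>-\<^sup>\<beta> sqrt(h\<^sup>2 + \<pi>\<^sup>2) / h\<close>, so the time step restriction is exactly what this needs.\<close>

lemma phase_bound:
  assumes "l \<in> modes M"
  shows "0 < k * \<zeta> l" "k * \<zeta> l \<le> pi / 3"
proof -
  show "0 < k * \<zeta> l" using k zeta_pos by simp
  have "\<bar>mu a b l\<bar> \<le> pi / h" using mu_on_modes[OF ab M assms] by (simp add: h)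
  then have "(mu a b l)\<^sup>2 \<le> (pi / h)\<^sup>2" using power_mono[of "\<bar>mu a b l\<bar>" "pi / h" 2] by simp
  then have "sqrt (1 + (mu a b l)\<^sup>2) \<le> sqrt ((h\<^sup>2 + pi\<^sup>2) / h\<^sup>2)"
    using h_pos by (intro real_sqrt_le_mono) (simp add: power_divide add_divide_distrib)
  also have "\<dots> = sqrt (h\<^sup>2 + pi\<^sup>2) / h" using h_pos by (simp add: real_sqrt_divide)
  finally have "\<zeta> l \<le> \<epsilon> powr (- \<beta>) * (sqrt (h\<^sup>2 + pi\<^sup>2) / h)"
    unfolding zeta_bar_def by (intro mult_left_mono) auto
  then have "k * \<zeta> l \<le> (\<epsilon> powr \<beta> * pi * h / (3 * sqrt (h\<^sup>2 + pi\<^sup>2))) * (\<epsilon> powr (- \<beta>) * (sqrt (h\<^sup>2 + pi\<^sup>2) / h))"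
    using cfl zeta_pos[of l] k h_pos by (intro mult_mono) (auto intro: less_imp_le)
  also have "\<dots> = pi / 3"
  proof -
    have "sqrt (h\<^sup>2 + pi\<^sup>2) > 0" using h_pos by (simp add: add_pos_pos)
    moreover have "\<epsilon> powr \<beta> > 0" using eps by simp
    ultimately show ?thesis using h_pos by (simp add: powr_minus field_simps)
  qed
  finally show "k * \<zeta> l \<le> pi / 3" .
qed

text \<open>The frequency in the denominator gains one derivative and a factor \<open>\<epsilon>\<^sup>\<beta>\<close>.\<close>

lemma propagator_bound:
  assumes "l \<in> modes M"
  shows "sqrt (1 + (mu a b l)\<^sup>2) * \<bar>sin t / sin (k * \<zeta> l)\<bar> \<le> 2 * \<epsilon> powr \<beta> / k"
proof -
  note p = phase_bound[OF assms]
  have s: "k * \<zeta> l / 2 \<le> sin (k * \<zeta> l)" using half_le_sin p by auto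
  have pos: "0 < k * \<zeta> l / 2" using p by simp
  have "\<bar>sin t / sin (k * \<zeta> l)\<bar> = \<bar>sin t\<bar> / sin (k * \<zeta> l)" using s pos by simp
  also have "\<dots> \<le> 1 / (k * \<zeta> l / 2)" using s pos by (intro frac_le) auto
  finally have "sqrt (1 + (mu a b l)\<^sup>2) * \<bar>sin t / sin (k * \<zeta> l)\<bar> \<le> sqrt (1 + (mu a b l)\<^sup>2) * (1 / (k * \<zeta> l / 2))"
    by (intro mult_left_mono) auto
  also have "\<dots> = 2 * \<epsilon> powr \<beta> / k"
  proof -
    have "sqrt (1 + (mu a b l)\<^sup>2) > 0" by (simp add: add_pos_nonneg)
    moreover have "\<epsilon> powr \<beta> > 0" using eps by simp
    ultimately show ?thesis using k by (simp add: zeta_bar_def powr_minus field_simps)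
  qed
  finally show ?thesis .
qed

definition nonlin :: "nat \<Rightarrow> int \<Rightarrow> complex" where
  "nonlin n l = cube_coeff l (real n * k) - fourier_coeff a b (\<lambda>x. vM n x ^ 3) l"

text \<open>The defect of the scheme at step \<^term>\<open>n\<close>: the local error and, after the first step, the effect of evaluating the cubic term at the numerical solution. The first step uses the exact initial data.\<close>

definition residual :: "nat \<Rightarrow> int \<Rightarrow> complex" where
  "residual n l = (if n = 0 then V l k - p_bar a b \<beta> \<epsilon> k l * V l 0
        - q_bar a b \<beta> \<epsilon> k l * fourier_coeff a b (\<lambda>x. complex_of_real (\<gamma> x)) l
        - r_bar a b \<beta> \<epsilon> k l * cube_coeff l 0
      else (V l (real n * k + k) + V l (real n * k - k)
        - 2 * p_bar a b \<beta> \<epsilon> k l * V l (real n * k) - 2 * r_bar a b \<beta> \<epsilon> k l * cube_coeff l (real n * k))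
        + 2 * r_bar a b \<beta> \<epsilon> k l * nonlin n l)"

lemma error_recursion:
  assumes l: "l \<in> modes M"
  shows "mode_error 0 l = 0" "mode_error 1 l = residual 0 l"
    "mode_error (n + 2) l = 2 * complex_of_real (cos (k * \<zeta> l)) * mode_error (n + 1) l - mode_error n l + residual (n + 1) l"
proof -
  have i: "V l 0 = fourier_coeff a b (\<lambda>x. complex_of_real (\<phi> x)) l"
    "cube_coeff l 0 = fourier_coeff a b (\<lambda>x. complex_of_real (\<phi> x) ^ 3) l"
    by (rule fourier_coeff_cong; simp add: initial)+
  show "mode_error 0 l = 0" unfolding mode_error_def using l i by (simp add: fourier_coeff_trig_poly[OF ab])
  show "mode_error 1 l = residual 0 l" unfolding mode_error_def residual_def i using l by (simp add: fourier_coeff_trig_poly[OF ab])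
  have t: "real (n + 1) * k + k = real (n + 2) * k" "real (n + 1) * k - k = real n * k"
    by (simp_all add: algebra_simps)
  show "mode_error (n + 2) l = 2 * complex_of_real (cos (k * \<zeta> l)) * mode_error (n + 1) l - mode_error n l + residual (n + 1) l"
    unfolding residual_def t mode_error_def nonlin_def using l
    by (simp add: fourier_coeff_trig_poly[OF ab] p_bar_def algebra_simps)
qed

lemma error_representation:
  assumes l: "l \<in> modes M"
  shows "mode_error n l = (\<Sum>j<n. complex_of_real (sin (real (n - j) * (k * \<zeta> l)) / sin (k * \<zeta> l)) * residual j l)"
proof (rule discrete_duhamel[where N = n])
  show "sin (k * \<zeta> l) \<noteq> 0"
    using half_le_sin[of "k * \<zeta> l"] phase_bound[OF l] by auto
qed (use error_recursion[OF l] in auto)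

text \<open>Although residuals are measured in \<open>L\<^sup>2\<close>, the error is controlled in \<open>H\<^sup>1\<close>.\<close>

lemma stability:
  "Hnorm 1 n \<le> (\<Sum>j<n. 2 * \<epsilon> powr \<beta> / k * L2_set (\<lambda>l. cmod (residual j l)) (modes M))"
proof -
  have "Hnorm 1 n \<le> L2_set (\<lambda>l. \<Sum>j<n. 2 * \<epsilon> powr \<beta> / k * cmod (residual j l)) (modes M)"
    unfolding Hnorm_def
  proof (rule L2_set_mono)
    fix l assume l: "l \<in> modes M"
    let ?w = "sqrt (1 + (mu a b l)\<^sup>2)"
    let ?s = "\<lambda>j. sin (real (n - j) * (k * \<zeta> l)) / sin (k * \<zeta> l)"
    have "?w * cmod (mode_error n l) \<le> ?w * (\<Sum>j<n. \<bar>?s j\<bar> * cmod (residual j l))"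
      unfolding error_representation[OF l]
      by (intro mult_left_mono order_trans[OF norm_sum] sum_mono) (simp_all add: norm_mult norm_divide abs_divide)
    also have "\<dots> = (\<Sum>j<n. ?w * \<bar>?s j\<bar> * cmod (residual j l))" by (simp add: sum_distrib_left mult.assoc)
    also have "\<dots> \<le> (\<Sum>j<n. 2 * \<epsilon> powr \<beta> / k * cmod (residual j l))"
      by (intro sum_mono mult_right_mono propagator_bound[OF l]) auto
    finally show "sqrt ((1 + (mu a b l)\<^sup>2) ^ 1) * cmod (mode_error n l) \<le> (\<Sum>j<n. 2 * \<epsilon> powr \<beta> / k * cmod (residual j l))"
      by simp
  qed auto
  also have "\<dots> \<le> (\<Sum>j<n. L2_set (\<lambda>l. 2 * \<epsilon> powr \<beta> / k * cmod (residual j l)) (modes M))"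
    by (rule L2_set_sum_le)
  also have "\<dots> = (\<Sum>j<n. 2 * \<epsilon> powr \<beta> / k * L2_set (\<lambda>l. cmod (residual j l)) (modes M))"
    using k by (intro sum.cong refl, intro L2_set_right_distrib[symmetric]) auto
  finally show ?thesis .
qed

lemma Hnorm_0_le_1: "Hnorm 0 n \<le> Hnorm 1 n"
  unfolding Hnorm_def by (intro L2_set_mono) (auto simp: mult_le_cancel_right1)

text \<open>Resolved modes contribute the error of the scheme, unresolved ones the projection error, which the
frequency bound \<open>\<bar>\<mu>_l\<bar> \<ge> \<pi>/h\<close> and the regularity of the exact solution control.\<close>

lemma err_H_bounded:
  assumes n: "real n * k \<le> T0" and j: "j \<le> 1"
  shows "H_bounded a b j (err n) (Hnorm j n + A * h ^ (m0 - j))"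
  unfolding H_bounded_def
proof (intro allI impI)
  fix F :: "int set" assume F: "finite F"
  let ?w = "\<lambda>l. 1 + (mu a b l)\<^sup>2"
  have w: "0 < ?w l" for l by (simp add: add_pos_nonneg)
  have 1: "(\<Sum>l\<in>F \<inter> modes M. ?w l ^ j * (cmod (fourier_coeff a b (err n) l))\<^sup>2) \<le> (Hnorm j n)\<^sup>2"
  proof -
    have "(\<Sum>l\<in>F \<inter> modes M. ?w l ^ j * (cmod (fourier_coeff a b (err n) l))\<^sup>2)
        \<le> (\<Sum>l\<in>modes M. ?w l ^ j * (cmod (mode_error n l))\<^sup>2)"
      unfolding fourier_coeff_err[OF n] using w
      by (intro sum_mono2 finite_modes) (auto intro!: mult_nonneg_nonneg zero_le_power less_imp_le)
    also have "\<dots> = (Hnorm j n)\<^sup>2"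
      unfolding Hnorm_def L2_set_def using w
      by (subst real_sqrt_pow2)
        (auto intro!: sum_nonneg sum.cong simp: power_mult_distrib less_imp_le)
    finally show ?thesis .
  qed
  have 2: "(\<Sum>l\<in>F - modes M. ?w l ^ j * (cmod (fourier_coeff a b (err n) l))\<^sup>2) \<le> (A * h ^ (m0 - j))\<^sup>2"
  proof -
    have "(\<Sum>l\<in>F - modes M. ?w l ^ j * (cmod (fourier_coeff a b (err n) l))\<^sup>2)
        \<le> (\<Sum>l\<in>F - modes M. (h\<^sup>2) ^ (m0 - j) * (?w l ^ m0 * (cmod (V l (real n * k)))\<^sup>2))"
    proof (rule sum_mono)
      fix l assume l: "l \<in> F - modes M"
      have "pi / h \<le> \<bar>mu a b l\<bar>" using mu_off_modes[OF ab M, of l] l by (simp add: h)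
      moreover have "1 / h \<le> pi / h" using h_pos pi_gt3 by (intro divide_right_mono) auto
      ultimately have "1 / h \<le> \<bar>mu a b l\<bar>" by linarith
      then have "(1 / h)\<^sup>2 \<le> (mu a b l)\<^sup>2" using power_mono[of "1 / h" "\<bar>mu a b l\<bar>" 2] h_pos by simp
      then have "1 \<le> h\<^sup>2 * (mu a b l)\<^sup>2" using h_pos by (simp add: power_divide pos_divide_le_eq mult.commute)
      then have "1 \<le> h\<^sup>2 * ?w l" by (simp add: algebra_simps add_increasing)
      then have "1 \<le> (h\<^sup>2 * ?w l) ^ (m0 - j)" by (rule one_le_power)
      then have "?w l ^ j * 1 \<le> ?w l ^ j * ((h\<^sup>2) ^ (m0 - j) * ?w l ^ (m0 - j))"
        using w[of l] by (intro mult_left_mono) (auto simp: power_mult_distrib less_imp_le)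
      also have "\<dots> = (h\<^sup>2) ^ (m0 - j) * ?w l ^ m0"
        using j m0 power_add[of "?w l" j "m0 - j"] by simp
      finally have "?w l ^ j * (cmod (V l (real n * k)))\<^sup>2 \<le> (h\<^sup>2) ^ (m0 - j) * ?w l ^ m0 * (cmod (V l (real n * k)))\<^sup>2"
        by (intro mult_right_mono) auto
      moreover have "fourier_coeff a b (err n) l = V l (real n * k)"
        unfolding fourier_coeff_err[OF n] mode_error_def using vM_off_modes l by simp
      ultimately show "?w l ^ j * (cmod (fourier_coeff a b (err n) l))\<^sup>2
          \<le> (h\<^sup>2) ^ (m0 - j) * (?w l ^ m0 * (cmod (V l (real n * k)))\<^sup>2)" by (simp add: mult.assoc)
    qed
    also have "\<dots> = (h\<^sup>2) ^ (m0 - j) * (\<Sum>l\<in>F - modes M. ?w l ^ m0 * (cmod (V l (real n * k)))\<^sup>2)"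
      by (simp add: sum_distrib_left)
    also have "\<dots> \<le> (h\<^sup>2) ^ (m0 - j) * A\<^sup>2"
      using F by (intro mult_left_mono H_boundedD[OF A[OF time_grid[OF n]]]) auto
    also have "\<dots> = (A * h ^ (m0 - j))\<^sup>2" by (simp add: power_mult_distrib mult.commute flip: power_mult)
    finally show ?thesis .
  qed
  have "(\<Sum>l\<in>F. ?w l ^ j * (cmod (fourier_coeff a b (err n) l))\<^sup>2)
     \<le> (Hnorm j n)\<^sup>2 + (A * h ^ (m0 - j))\<^sup>2"
    using 1 2 sum.Int_Diff[OF F, of "\<lambda>l. ?w l ^ j * (cmod (fourier_coeff a b (err n) l))\<^sup>2" "modes M"] by simp
  also have "\<dots> \<le> (Hnorm j n + A * h ^ (m0 - j))\<^sup>2"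
    using A0 h_pos by (auto simp: power2_sum Hnorm_def intro!: mult_nonneg_nonneg)
  finally show "(\<Sum>l\<in>F. ?w l ^ j * (cmod (fourier_coeff a b (err n) l))\<^sup>2)
     \<le> (Hnorm j n + A * h ^ (m0 - j))\<^sup>2" .
qed

text \<open>The Lipschitz bound is pointwise, so it needs the error in physical space, which Parseval's inequality returns to frequency space.\<close>

lemma nonlin_bound:
  assumes n: "real n * k \<le> T0" and vM: "\<And>x. x \<in> {a..b} \<Longrightarrow> cmod (vM n x) \<le> B + 1"
  shows "L2_set (\<lambda>l. cmod (nonlin n l)) (modes M) \<le> lip * (Hnorm 1 n + A * h ^ m0)"
proof -
  define g where "g = (\<lambda>x. complex_of_real (u (real n * k) x) ^ 3 - vM n x ^ 3)"
  have c3: "continuous_on {a..b} (\<lambda>x. complex_of_real (u (real n * k) x) ^ 3)" "continuous_on {a..b} (\<lambda>x. vM n x ^ 3)"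
    using continuous_u[OF n] continuous_vM by (intro continuous_intros; simp)+
  have gc: "continuous_on {a..b} g" unfolding g_def by (intro continuous_on_diff c3)
  have nn: "nonlin n l = fourier_coeff a b g l" for l
    unfolding nonlin_def g_def using fourier_coeff_diff[OF ab c3] by simp
  have nonneg: "0 \<le> Hnorm 1 n + A * h ^ m0" using A0 h_pos by (simp add: Hnorm_def)
  have "H_bounded a b 0 (err n) (Hnorm 1 n + A * h ^ m0)"
    by (rule H_bounded_mono[OF err_H_bounded[OF n, of 0]])
      (use Hnorm_0_le_1[of n] A0 h_pos in \<open>auto simp: Hnorm_def\<close>)
  moreover have "0 \<le> Hnorm 1 n + A * h ^ (m0 - 1)" using A0 h_pos by (simp add: Hnorm_def)
  ultimately have ms: "mean_square a b (err n) \<le> (Hnorm 1 n + A * h ^ m0)\<^sup>2"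
    using mean_square_le[OF ab continuous_err[OF n] err_periodic[OF n] err_H_bounded[OF n, of 1]] by simp
  have "mean_square a b g \<le> lip\<^sup>2 * mean_square a b (err n)"
  proof (rule mean_square_mono[OF ab gc continuous_err[OF n]])
    fix x assume x: "x \<in> {a..b}"
    have "cmod (complex_of_real (u (real n * k) x)) \<le> B + 1"
      using B[OF time_grid[OF n] x] by simp
    from cube_difference_bound[OF this vM[OF x]]
    show "cmod (g x) \<le> lip * cmod (err n x)" by (simp add: g_def err_def lip_def)
  qed
  also have "\<dots> \<le> (lip * (Hnorm 1 n + A * h ^ m0))\<^sup>2"
    unfolding power_mult_distrib using ms by (intro mult_left_mono) auto
  finally show ?thesis unfolding nn
    using lip_nonneg nonneg by (intro L2_fourier_coeff_le_mean_square[OF ab finite_modes gc]) auto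
qed

lemma r_bar_bound: "cmod (2 * r_bar a b \<beta> \<epsilon> k l) \<le> \<epsilon> powr (2 - 2 * \<beta>) * k\<^sup>2"
proof -
  have z: "0 < \<zeta> l" by (rule zeta_pos)
  let ?t = "k * \<zeta> l"
  have half: "1 - cos ?t = 2 * (sin (?t / 2))\<^sup>2" using cos_double_sin[of "?t / 2"] by simp
  have "\<bar>sin (?t / 2)\<bar> \<le> \<bar>?t / 2\<bar>" by (rule abs_sin_x_le_abs_x)
  then have "(sin (?t / 2))\<^sup>2 \<le> (?t / 2)\<^sup>2" by (rule abs_le_square_iff[THEN iffD1])
  then have c: "1 - cos ?t \<le> ?t\<^sup>2 / 2" unfolding half by (simp add: power_divide)
  have c0: "0 \<le> 1 - cos ?t" by simp
  have "cmod (2 * r_bar a b \<beta> \<epsilon> k l) = \<epsilon> powr (2 - 2 * \<beta>) * (2 * (1 - cos ?t) / (\<zeta> l)\<^sup>2)"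
  proof -
    have "2 * r_bar a b \<beta> \<epsilon> k l = complex_of_real (- (\<epsilon> powr (2 - 2 * \<beta>) * (2 * (1 - cos ?t) / (\<zeta> l)\<^sup>2)))"
    proof -
      have "2 * (\<epsilon>\<^sup>2 * (cos ?t - 1) / (\<epsilon> powr \<beta> * \<zeta> l)\<^sup>2) = - (\<epsilon> powr (2 - 2 * \<beta>) * (2 * (1 - cos ?t) / (\<zeta> l)\<^sup>2))"
        unfolding powr_2_minus using z eps by (simp add: field_simps)
      then show ?thesis unfolding r_bar_def by (metis of_real_mult of_real_numeral)
    qed
    then show ?thesis using c0 by (simp only: norm_of_real) (simp add: abs_mult abs_divide)
  qed
  also have "\<dots> \<le> \<epsilon> powr (2 - 2 * \<beta>) * k\<^sup>2"
  proof (rule mult_left_mono)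
    have "2 * (1 - cos ?t) / (\<zeta> l)\<^sup>2 \<le> (k * \<zeta> l)\<^sup>2 / (\<zeta> l)\<^sup>2"
      using c by (intro divide_right_mono) auto
    also have "\<dots> = k\<^sup>2" using z by (simp add: power_mult_distrib)
    finally show "2 * (1 - cos ?t) / (\<zeta> l)\<^sup>2 \<le> k\<^sup>2" .
  qed simp
  finally show ?thesis .
qed

text \<open>The factor \<open>2 \<epsilon>\<^sup>\<beta> / k\<close> is the amplification from \<open>stability\<close>. The local errors and the nonlinear
terms are left with one power of \<^term>\<open>k\<close>, which the summation over the time steps absorbs; the nonlinear
terms carry \<open>\<epsilon>\<close> to the power \<open>2 - \<beta> \<ge> 0\<close>.\<close>

lemma residual_bound:
  assumes n: "real (Suc j) * k \<le> T0" and vM: "\<And>x. x \<in> {a..b} \<Longrightarrow> cmod (vM j x) \<le> B + 1"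
  shows "2 * \<epsilon> powr \<beta> / k * L2_set (\<lambda>l. cmod (residual j l)) (modes M)
    \<le> (if j = 0 then 2 * cube_rate * \<rho> else 0) + 4 * cube_curvature * \<rho> * k + 2 * lip * (Hnorm 1 j + A * h ^ m0) * k"
proof -
  have epb: "\<epsilon> powr \<beta> \<le> 1" using powr_mono2[of \<beta> \<epsilon> 1] eps eps1 beta by simp
  have nonneg: "0 \<le> Hnorm 1 j + A * h ^ m0" using A0 h_pos by (simp add: Hnorm_def)
  have rest: "0 \<le> 4 * cube_curvature * \<rho> * k" "0 \<le> 2 * lip * (Hnorm 1 j + A * h ^ m0) * k"
    using cube_curvature_nonneg rho_nonneg k lip_nonneg nonneg by auto
  show ?thesis
  proof (cases "j = 0")
    case True
    have "L2_set (\<lambda>l. cmod (residual j l)) (modes M) \<le> cube_rate * \<epsilon> powr (2 - 3 * \<beta>) * k ^ 3"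
      using local_error_first_step[OF finite_modes k, of M] n k True by (simp add: residual_def)
    then have "2 * \<epsilon> powr \<beta> / k * L2_set (\<lambda>l. cmod (residual j l)) (modes M)
        \<le> 2 * \<epsilon> powr \<beta> / k * (cube_rate * \<epsilon> powr (2 - 3 * \<beta>) * k ^ 3)"
      using k by (intro mult_left_mono) auto
    also have "\<dots> = \<epsilon> powr \<beta> * (2 * cube_rate * \<rho>)"
      using k by (simp add: \<rho>_def eval_nat_numeral)
    also have "\<dots> \<le> 1 * (2 * cube_rate * \<rho>)"
      using epb cube_rate_nonneg rho_nonneg by (intro mult_right_mono) auto
    finally show ?thesis unfolding if_P[OF True] using rest by linarith
  next
    case False
    let ?loc = "\<lambda>l. V l (real j * k + k) + V l (real j * k - k)
        - 2 * p_bar a b \<beta> \<epsilon> k l * V l (real j * k) - 2 * r_bar a b \<beta> \<epsilon> k l * cube_coeff l (real j * k)"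
    have j: "real j * k \<le> T0" using n k by (simp add: algebra_simps)
    have ts: "real j * k - k \<in> {0..T0}" "real j * k + k \<in> {0..T0}"
    proof -
      have "1 * k \<le> real j * k" using False k by (intro mult_right_mono) auto
      then show "real j * k - k \<in> {0..T0}" "real j * k + k \<in> {0..T0}"
        using n k by (auto simp: algebra_simps)
    qed
    have "L2_set (\<lambda>l. cmod (residual j l)) (modes M)
        \<le> L2_set (\<lambda>l. cmod (?loc l) + \<epsilon> powr (2 - 2 * \<beta>) * k\<^sup>2 * cmod (nonlin j l)) (modes M)"
    proof (rule L2_set_mono)
      fix l
      have "cmod (residual j l) \<le> cmod (?loc l) + cmod (2 * r_bar a b \<beta> \<epsilon> k l * nonlin j l)"
        unfolding residual_def using False norm_triangle_ineq by simp
      also have "\<dots> \<le> cmod (?loc l) + \<epsilon> powr (2 - 2 * \<beta>) * k\<^sup>2 * cmod (nonlin j l)"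
        unfolding norm_mult[of _ "nonlin j l"] by (intro add_left_mono mult_right_mono r_bar_bound) auto
      finally show "cmod (residual j l) \<le> cmod (?loc l) + \<epsilon> powr (2 - 2 * \<beta>) * k\<^sup>2 * cmod (nonlin j l)" .
    qed simp
    also have "\<dots> \<le> L2_set (\<lambda>l. cmod (?loc l)) (modes M)
        + L2_set (\<lambda>l. \<epsilon> powr (2 - 2 * \<beta>) * k\<^sup>2 * cmod (nonlin j l)) (modes M)"
      by (rule L2_set_triangle_ineq)
    also have "\<dots> \<le> 2 * cube_curvature * \<epsilon> powr (2 - 4 * \<beta>) * k ^ 4
        + \<epsilon> powr (2 - 2 * \<beta>) * k\<^sup>2 * (lip * (Hnorm 1 j + A * h ^ m0))"
      unfolding L2_set_right_distrib[symmetric, OF zero_le_mult_iff[THEN iffD2, OF disjI1, OF conjI, OF powr_ge_zero zero_le_power2]]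
      by (intro add_mono mult_left_mono local_error finite_modes k ts nonlin_bound j vM) auto
    finally have "2 * \<epsilon> powr \<beta> / k * L2_set (\<lambda>l. cmod (residual j l)) (modes M)
        \<le> 2 * \<epsilon> powr \<beta> / k * (2 * cube_curvature * \<epsilon> powr (2 - 4 * \<beta>) * k ^ 4
        + \<epsilon> powr (2 - 2 * \<beta>) * k\<^sup>2 * (lip * (Hnorm 1 j + A * h ^ m0)))"
      using k by (intro mult_left_mono) auto
    also have "\<dots> = 4 * cube_curvature * (\<epsilon> powr \<beta> * \<epsilon> powr (2 - 4 * \<beta>)) * k\<^sup>2 * k
        + (\<epsilon> powr \<beta> * \<epsilon> powr (2 - 2 * \<beta>)) * (2 * lip * (Hnorm 1 j + A * h ^ m0) * k)"
      using k by (simp add: field_simps eval_nat_numeral)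
    also have "\<epsilon> powr \<beta> * \<epsilon> powr (2 - 4 * \<beta>) = \<epsilon> powr (2 - 3 * \<beta>)"
      by (simp add: powr_add[symmetric])
    also have "\<epsilon> powr \<beta> * \<epsilon> powr (2 - 2 * \<beta>) = \<epsilon> powr (2 - \<beta>)"
      by (simp add: powr_add[symmetric])
    also have "\<epsilon> powr (2 - \<beta>) * (2 * lip * (Hnorm 1 j + A * h ^ m0) * k) \<le> 1 * (2 * lip * (Hnorm 1 j + A * h ^ m0) * k)"
      using powr_mono2[of "2 - \<beta>" \<epsilon> 1] eps eps1 beta2 rest(2) by (intro mult_right_mono) auto
    finally show ?thesis using False by (simp add: \<rho>_def mult.assoc)
  qed
qed

lemma Hnorm_bound:
  assumes n: "real n * k \<le> T0" and vM: "\<And>j x. j < n \<Longrightarrow> x \<in> {a..b} \<Longrightarrow> cmod (vM j x) \<le> B + 1"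
  shows "Hnorm 1 n \<le> error_const * (h ^ m0 + \<rho>)"
proof -
  let ?\<tau> = "A * h ^ m0"
  \<comment> \<open>The part of the bound that does not depend on the errors at earlier times.\<close>
  define G where "G = (2 * cube_rate + 4 * cube_curvature * T0) * \<rho> + 2 * lip * T0 * ?\<tau>"
  have G0: "0 \<le> G" unfolding G_def
    using cube_rate_nonneg cube_curvature_nonneg T0 rho_nonneg lip_nonneg A0 h_pos by auto
  have step: "Hnorm 1 i \<le> G + 2 * lip * k * (\<Sum>j<i. Hnorm 1 j)" if i: "i \<le> n" for i
  proof -
    have ik: "real i * k \<le> T0" using i n k by (meson less_imp_le mult_right_mono of_nat_mono order_trans)
    have "Hnorm 1 i \<le> (\<Sum>j<i. 2 * \<epsilon> powr \<beta> / k * L2_set (\<lambda>l. cmod (residual j l)) (modes M))"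
      by (rule stability)
    also have "\<dots> \<le> (\<Sum>j<i. (if j = 0 then 2 * cube_rate * \<rho> else 0) + 4 * cube_curvature * \<rho> * k + 2 * lip * (Hnorm 1 j + ?\<tau>) * k)"
    proof (rule sum_mono, rule residual_bound)
      fix j assume j: "j \<in> {..<i}"
      then have "real (Suc j) * k \<le> real i * k" using k by (intro mult_right_mono) auto
      then show "real (Suc j) * k \<le> T0" using ik by linarith
      show "cmod (vM j x) \<le> B + 1" if "x \<in> {a..b}" for x using vM j i that by auto
    qed
    also have "\<dots> = (\<Sum>j<i. if j = 0 then 2 * cube_rate * \<rho> else 0) + (4 * cube_curvature * \<rho> + 2 * lip * ?\<tau>) * (real i * k)
        + 2 * lip * k * (\<Sum>j<i. Hnorm 1 j)"
      by (simp add: sum.distrib sum_distrib_left sum_distrib_right algebra_simps)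
    also have "(\<Sum>j<i. if j = 0 then 2 * cube_rate * \<rho> else 0) \<le> 2 * cube_rate * \<rho>"
      using cube_rate_nonneg rho_nonneg by (simp add: sum.delta)
    also have "(4 * cube_curvature * \<rho> + 2 * lip * ?\<tau>) * (real i * k) \<le> (4 * cube_curvature * \<rho> + 2 * lip * ?\<tau>) * T0"
      using cube_curvature_nonneg rho_nonneg lip_nonneg A0 h_pos ik by (intro mult_left_mono) auto
    finally show ?thesis by (simp add: G_def algebra_simps)
  qed
  have "Hnorm 1 n \<le> G * (1 + 2 * lip * k) ^ n"
    by (rule discrete_gronwall[where N = n]) (use step lip_nonneg k in auto)
  also have "\<dots> \<le> G * exp (2 * lip * T0)"
  proof (rule mult_left_mono[OF _ G0])
    have "(1 + 2 * lip * k) ^ n \<le> exp (2 * lip * k) ^ n"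
      using lip_nonneg k by (intro power_mono exp_ge_add_one_self) auto
    also have "\<dots> = exp (2 * lip * (real n * k))" by (simp add: exp_of_nat_mult[symmetric] mult_ac)
    also have "\<dots> \<le> exp (2 * lip * T0)"
      unfolding exp_le_cancel_iff using n lip_nonneg by (intro mult_left_mono) auto
    finally show "(1 + 2 * lip * k) ^ n \<le> exp (2 * lip * T0)" .
  qed
  also have "\<dots> \<le> ((2 * cube_rate + 4 * cube_curvature * T0 + 2 * lip * T0 * A) * (h ^ m0 + \<rho>)) * exp (2 * lip * T0)"
  proof (rule mult_right_mono)
    have "(2 * cube_rate + 4 * cube_curvature * T0 + 2 * lip * T0 * A) * (h ^ m0 + \<rho>)
      = G + ((2 * cube_rate + 4 * cube_curvature * T0) * h ^ m0 + 2 * lip * T0 * A * \<rho>)" by (simp add: G_def algebra_simps)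
    moreover have "0 \<le> (2 * cube_rate + 4 * cube_curvature * T0) * h ^ m0 + 2 * lip * T0 * A * \<rho>"
      using cube_rate_nonneg cube_curvature_nonneg T0 rho_nonneg lip_nonneg A0 h_pos by auto
    ultimately show "G \<le> (2 * cube_rate + 4 * cube_curvature * T0 + 2 * lip * T0 * A) * (h ^ m0 + \<rho>)" by linarith
  qed simp
  finally show ?thesis by (simp add: error_const_def mult_ac)
qed

text \<open>Bootstrap: the boundedness of the numerical solution at the previous steps gives the \<open>H\<^sup>1\<close> estimate, which
gives boundedness at the present step through the Sobolev embedding and the smallness assumption.\<close>

lemma error_bound:
  assumes small: "sobolev_const a b * (error_const * (h ^ m0 + \<rho>) + A * h ^ (m0 - 1)) \<le> 1"
  shows "real n * k \<le> T0 \<Longrightarrow>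
     (\<forall>j\<le>1. H_bounded a b j (err n) (error_const * (h ^ m0 + \<rho>) + A * h ^ (m0 - j))) \<and> (\<forall>x\<in>{a..b}. cmod (err n x) \<le> 1)"
proof (induction n rule: less_induct)
  case (less n)
  have vM: "cmod (vM j x) \<le> B + 1" if j: "j < n" and x: "x \<in> {a..b}" for j x
  proof -
    have "real j * k \<le> real n * k" using j k by (intro mult_right_mono) auto
    then have jk: "real j * k \<le> T0" using less.prems by linarith
    have "vM j x = complex_of_real (u (real j * k) x) - err j x" by (simp add: err_def)
    then have "cmod (vM j x) \<le> cmod (complex_of_real (u (real j * k) x)) + cmod (err j x)"
      by (simp only: norm_triangle_ineq4)
    also have "\<dots> \<le> B + 1" using less.IH[OF j jk] B[OF time_grid[OF jk] x] x by (intro add_mono) auto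
    finally show ?thesis .
  qed
  have H1: "Hnorm 1 n \<le> error_const * (h ^ m0 + \<rho>)" by (rule Hnorm_bound[OF less.prems vM])
  have H: "Hnorm j n \<le> error_const * (h ^ m0 + \<rho>)" if "j \<le> 1" for j
    using that H1 Hnorm_0_le_1[of n] by (cases j) auto
  have bnd: "H_bounded a b j (err n) (error_const * (h ^ m0 + \<rho>) + A * h ^ (m0 - j))" if j: "j \<le> 1" for j
    by (rule H_bounded_mono[OF err_H_bounded[OF less.prems j]])
      (use H[OF j] A0 h_pos in \<open>auto simp: Hnorm_def\<close>)
  have "cmod (err n x) \<le> 1" if x: "x \<in> {a..b}" for x
  proof -
    have "cmod (err n x) \<le> sobolev_const a b * (error_const * (h ^ m0 + \<rho>) + A * h ^ (m0 - 1))"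
      by (rule sobolev_sup_bound[OF ab continuous_err[OF less.prems] err_periodic[OF less.prems] bnd _ x])
        (use error_const_nonneg A0 h_pos rho_nonneg in auto)
    then show ?thesis using small by linarith
  qed
  then show ?case using bnd by blast
qed

lemma err_weak_derivs:
  assumes n: "real n * k \<le> T0" and "j \<le> 1"
  shows "\<exists>g. weak_derivs a b j 2 (err n) g"
proof -
  define c where "c = fourier_coeff a b (vM n)"
  have vM: "vM n = trig_poly a b M c" unfolding c_def by (rule ewi_fs_trig_poly[OF ab])
  have "weak_derivs a b j 2 (err n) (\<lambda>i. if i = 0 then err n else
     (\<lambda>x. complex_of_real (dx a b u (real n * k) x) - trig_poly a b M (\<lambda>l. \<i> * mu a b l * c l) x))"
  proof (rule weak_derivs_C1[OF ab _ _ \<open>j \<le> 1\<close>])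
    show "continuous_on {a..b} (\<lambda>x. complex_of_real (dx a b u (real n * k) x) - trig_poly a b M (\<lambda>l. \<i> * mu a b l * c l) x)"
      using continuous_space(4)[OF time_grid[OF n]] by (intro continuous_intros continuous_on_trig_poly)
    fix x assume x: "x \<in> {a..b}"
    show "(err n has_vector_derivative
        (complex_of_real (dx a b u (real n * k) x) - trig_poly a b M (\<lambda>l. \<i> * mu a b l * c l) x)) (at x within {a..b})"
      unfolding err_def vM
      by (intro has_vector_derivative_diff trig_poly_has_vector_derivative
          bounded_linear.has_vector_derivative[OF bounded_linear_of_real] has_space_derivative(1)[OF time_grid[OF n] x])
  qed
  then show ?thesis by blast
qed

end

section \<open>Uniform convergence\<close>

lemma Linf_norm_le_1_plus_M1_bar:
  assumes ab: "a < b" and T0: "0 < T0" and \<epsilon>: "\<epsilon> \<in> {0<..1}"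
    and c: "continuous_on ({0..T0} \<times> {a..b}) (\<lambda>(s, x). v \<epsilon> s x)"
    and w: "continuous_on {a..b} w" and s: "s \<in> {0..T0}"
    and dist: "\<And>x. x \<in> {a..b} \<Longrightarrow> cmod (complex_of_real (v \<epsilon> s x) - w x) \<le> 1"
  shows "Linf_norm a b w \<le> 1 + M1_bar a b \<beta> T0 v"
proof -
  let ?L = "Linf_time T0 (Linf_norm a b) (v \<epsilon>)"
  have nonneg: "0 \<le> Linf_time T0 (Linf_norm a b) z" for z :: "real \<Rightarrow> real \<Rightarrow> real"
    unfolding Linf_time_def by (intro esssup_nonneg T0 Linf_norm_nonneg ab)
  have "?L + 0 \<le> ?L + ereal (\<epsilon> powr \<beta>) * Linf_time T0 (Linf_norm a b) (dt (v \<epsilon>))"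
    by (intro add_left_mono ereal_0_le_mult nonneg) simp
  also have "\<dots> \<le> M1_bar a b \<beta> T0 v"
    unfolding M1_bar_def using \<epsilon> by (intro SUP_upper)
  finally have L: "?L \<le> M1_bar a b \<beta> T0 v" by simp
  show ?thesis
  proof (cases ?L)
    case (real L)
    have "Linf_norm a b w \<le> ereal (1 + L)"
    proof (rule Linf_norm_leI[OF w])
      fix x assume x: "x \<in> {a..b}"
      have "\<bar>v \<epsilon> s x\<bar> \<le> L" using Linf_time_imp_bound[OF ab T0 c _ s x] real by simp
      moreover have "cmod (w x) \<le> cmod (complex_of_real (v \<epsilon> s x)) + cmod (complex_of_real (v \<epsilon> s x) - w x)"
        by (metis norm_minus_commute norm_triangle_sub)
      ultimately show "norm (w x) \<le> 1 + L" using dist[OF x] by simp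
    qed
    also have "ereal (1 + L) = 1 + ?L" using real by (simp add: one_ereal_def)
    also have "\<dots> \<le> 1 + M1_bar a b \<beta> T0 v" using L by (rule add_left_mono)
    finally show ?thesis .
  next
    case PInf
    then show ?thesis using L by simp
  next
    case MInf
    then show ?thesis using nonneg[of "v \<epsilon>"] by simp
  qed
qed

text \<open>Hence the full time step restriction implies the one without the term in \<open>M2_bar\<close>. If no admissible \<open>w\<close> existed, the supremum would be \<open>-\<infinity>\<close>, whose real part is \<open>0\<close>.\<close>

lemma real_of_M2_bar_nonneg: "0 \<le> real_of_ereal (M2_bar a b \<beta> T0 v)"
proof (cases "{w::real. w \<noteq> 0 \<and> ereal \<bar>w\<bar> \<le> 1 + M1_bar a b \<beta> T0 v} = {}")
  case True
  then show ?thesis unfolding M2_bar_def True by (simp add: bot_ereal_def)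
next
  case False
  then obtain w :: real where w: "w \<in> {w. w \<noteq> 0 \<and> ereal \<bar>w\<bar> \<le> 1 + M1_bar a b \<beta> T0 v}" by blast
  have "0 \<le> ereal (\<bar>w\<bar>\<^sup>2)" by simp
  also have "\<dots> \<le> M2_bar a b \<beta> T0 v" unfolding M2_bar_def by (rule SUP_upper[OF w])
  finally show ?thesis by (rule real_of_ereal_pos)
qed

theorem theorem5p2:
  fixes a b \<beta> T0 :: real and \<phi> \<gamma> :: "real \<Rightarrow> real"
    and v :: "real \<Rightarrow> real \<Rightarrow> real \<Rightarrow> real" and m0 :: nat
  assumes "a < b" and "0 \<le> \<beta>" and "\<beta> \<le> 2"
    and "0 < T0"
    and "\<forall>\<epsilon>\<in>{0<..1}. ereal T0 < max_existence_time a b \<beta> \<epsilon> \<phi> \<gamma>"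
    and "\<forall>\<epsilon>\<in>{0<..1}. kg_solution a b \<beta> \<epsilon> \<phi> \<gamma> (max_existence_time a b \<beta> \<epsilon> \<phi> \<gamma>) (v \<epsilon>)"
    and "2 \<le> m0"
    and "\<exists>C. \<forall>\<epsilon>\<in>{0<..1}.
           Linf_time T0 (Hp_norm a b m0) (\<lambda>s x. complex_of_real (v \<epsilon> s x)) \<le> ereal C"
    and "\<exists>C. \<forall>\<epsilon>\<in>{0<..1}.
           Linf_time T0 (W_norm a b 1 4) (dt (v \<epsilon>)) \<le> ereal (C * (1 / \<epsilon> powr \<beta>))"
    and "\<exists>C. \<forall>\<epsilon>\<in>{0<..1}.
           Linf_time T0 (H_norm a b 1) (\<lambda>s x. complex_of_real (dt (dt (v \<epsilon>)) s x))
             \<le> ereal (C * (1 / \<epsilon> powr (2 * \<beta>)))"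
  shows "\<exists>h0>0. \<exists>k0>0. \<exists>C>0. \<forall>\<epsilon> k h. \<forall>M::nat.
           0 < \<epsilon> \<and> \<epsilon> \<le> 1 \<and> 0 < M \<and> even M \<and> h = (b - a) / real M \<and> h \<le> h0
           \<and> 0 < k \<and> k \<le> \<epsilon> powr (max 0 (3 * \<beta> / 2 - 1)) * k0
           \<and> k \<le> 2 * \<epsilon> powr \<beta> * h
                  / sqrt (pi\<^sup>2 + h\<^sup>2 * (1 + \<epsilon>\<^sup>2 * sigma_max a b \<beta> \<epsilon> \<phi> \<gamma> M k T0))
           \<and> k \<le> min (\<epsilon> powr \<beta> / 4)
                  (\<epsilon> powr \<beta> * pi * h
                    / (3 * sqrt (h\<^sup>2 + pi\<^sup>2 + \<epsilon>\<^sup>2 * real_of_ereal (M2_bar a b \<beta> T0 v) * h\<^sup>2)))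
           \<longrightarrow> (\<forall>n::nat. real n \<le> T0 / k \<longrightarrow>
                 (\<forall>lam\<in>{0, 1::nat}.
                    H_norm a b lam
                      (\<lambda>x. complex_of_real (v \<epsilon> (real n * k) x) - ewi_fs a b \<beta> \<epsilon> \<phi> \<gamma> M k n x)
                      \<le> ereal (C * (h ^ (m0 - lam) + \<epsilon> powr (2 - 3 * \<beta>) * k\<^sup>2)))
                 \<and> Linf_norm a b (ewi_fs a b \<beta> \<epsilon> \<phi> \<gamma> M k n) \<le> 1 + M1_bar a b \<beta> T0 v)"
proof -
  note ab = \<open>a < b\<close> and T0 = \<open>0 < T0\<close> and m0 = \<open>2 \<le> m0\<close>
  define K where "K = sobolev_const a b"
  have K: "0 \<le> K" unfolding K_def by (rule sobolev_const_nonneg)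
  have kg: "kg_on_interval a b \<beta> \<epsilon> T0 (max_existence_time a b \<beta> \<epsilon> \<phi> \<gamma>) \<phi> \<gamma> (v \<epsilon>)" if "\<epsilon> \<in> {0<..1}" for \<epsilon>
    using assms that by unfold_locales auto
  have per: "v \<epsilon> s a = v \<epsilon> s b" "dt (dt (v \<epsilon>)) s a = dt (dt (v \<epsilon>)) s b"
    and cs: "continuous_on {a..b} (v \<epsilon> s)" "continuous_on {a..b} (dt (dt (v \<epsilon>)) s)"
    if "\<epsilon> \<in> {0<..1}" "s \<in> {0..T0}" for \<epsilon> s
    using kg_on_interval.periodic[OF kg] kg_on_interval.continuous_space[OF kg] that by blast+
  have cplx: "continuous_on ({0..T0} \<times> {a..b}) (\<lambda>(s, x). complex_of_real (w s x))"
    if "continuous_on ({0..T0} \<times> {a..b}) (\<lambda>(s, x). w s x)" for w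
    using that by (auto simp: case_prod_unfold intro!: continuous_intros)

  obtain C_space where C_space: "\<And>\<epsilon>. \<epsilon> \<in> {0<..1} \<Longrightarrow>
      Linf_time T0 (Hp_norm a b m0) (\<lambda>s x. complex_of_real (v \<epsilon> s x)) \<le> ereal C_space"
    using assms(8) by blast
  \<comment> \<open>\<open>H_bounded\<close> involves only the square of the bound, so the sign of the constant is immaterial.\<close>
  define A where "A = \<bar>C_space\<bar>"
  have A0: "0 \<le> A" by (simp add: A_def)
  have A: "H_bounded a b m0 (\<lambda>x. complex_of_real (v \<epsilon> s x)) A" if "\<epsilon> \<in> {0<..1}" "s \<in> {0..T0}" for \<epsilon> s
  proof -
    have "H_bounded a b m0 (\<lambda>x. complex_of_real (v \<epsilon> s x)) C_space"
    proof (rule H_bounded_all_times[OF ab T0 cplx _ that(2)])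
      show "continuous_on ({0..T0} \<times> {a..b}) (\<lambda>(s, x). v \<epsilon> s x)"
        by (rule kg_on_interval.continuous(1)[OF kg[OF that(1)]])
      show "AE s in lebesgue_on {0..T0}. H_bounded a b m0 (\<lambda>x. complex_of_real (v \<epsilon> s x)) C_space"
        using Linf_time_AE[OF C_space[OF that(1)]]
        by (rule AE_mp) (auto intro!: AE_I2 Hp_norm_le_imp_bounded)
    qed
    then show ?thesis by (simp add: H_bounded_def A_def)
  qed

  obtain C_time where C_time: "\<And>\<epsilon>. \<epsilon> \<in> {0<..1} \<Longrightarrow>
      Linf_time T0 (H_norm a b 1) (\<lambda>s x. complex_of_real (dt (dt (v \<epsilon>)) s x)) \<le> ereal (C_time * (1 / \<epsilon> powr (2 * \<beta>)))"
    using assms(10) by blast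
  have A2: "H_bounded a b 1 (\<lambda>x. complex_of_real (dt (dt (v \<epsilon>)) s x)) (\<bar>C_time\<bar> * \<epsilon> powr (- 2 * \<beta>))"
    if "\<epsilon> \<in> {0<..1}" "s \<in> {0..T0}" for \<epsilon> s
  proof -
    have "H_bounded a b 1 (\<lambda>x. complex_of_real (dt (dt (v \<epsilon>)) s x)) (C_time * (1 / \<epsilon> powr (2 * \<beta>)))"
    proof (rule H_bounded_all_times[OF ab T0 cplx _ that(2)])
      show "continuous_on ({0..T0} \<times> {a..b}) (\<lambda>(s, x). dt (dt (v \<epsilon>)) s x)"
        by (rule kg_on_interval.continuous(3)[OF kg[OF that(1)]])
      show "AE s in lebesgue_on {0..T0}. H_bounded a b 1 (\<lambda>x. complex_of_real (dt (dt (v \<epsilon>)) s x)) (C_time * (1 / \<epsilon> powr (2 * \<beta>)))"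
        using Linf_time_AE[OF C_time[OF that(1)]]
        by (rule AE_mp) (auto intro!: AE_I2 H_norm_le_imp_bounded)
    qed
    moreover have "1 / \<epsilon> powr (2 * \<beta>) = \<epsilon> powr (- 2 * \<beta>)" by (simp add: powr_minus_divide)
    ultimately show ?thesis by (simp add: H_bounded_def power_mult_distrib)
  qed

  define B where "B = K * A"
  define D where "D = K * \<bar>C_time\<bar>"
  have B: "\<bar>v \<epsilon> s x\<bar> \<le> B" if "\<epsilon> \<in> {0<..1}" "s \<in> {0..T0}" "x \<in> {a..b}" for \<epsilon> s x
  proof -
    have "cmod (complex_of_real (v \<epsilon> s x)) \<le> sobolev_const a b * A"
      by (rule sobolev_sup_bound[OF ab _ _ H_bounded_lower_order[OF A[OF that(1,2)]] A0 that(3)])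
        (use m0 cs(1)[OF that(1,2)] per(1)[OF that(1,2)] in \<open>auto intro!: continuous_intros\<close>)
    then show ?thesis by (simp add: B_def K_def)
  qed
  have D: "\<bar>dt (dt (v \<epsilon>)) s x\<bar> \<le> D * \<epsilon> powr (- 2 * \<beta>)" if "\<epsilon> \<in> {0<..1}" "s \<in> {0..T0}" "x \<in> {a..b}" for \<epsilon> s x
  proof -
    have "cmod (complex_of_real (dt (dt (v \<epsilon>)) s x)) \<le> sobolev_const a b * (\<bar>C_time\<bar> * \<epsilon> powr (- 2 * \<beta>))"
      by (rule sobolev_sup_bound[OF ab _ _ A2[OF that(1,2)] _ that(3)])
        (use cs(2)[OF that(1,2)] per(2)[OF that(1,2)] in \<open>auto intro!: continuous_intros\<close>)
    then show ?thesis by (simp add: D_def K_def)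
  qed
  have bounded: "kg_bounded_solution a b \<beta> \<epsilon> T0 (max_existence_time a b \<beta> \<epsilon> \<phi> \<gamma>) \<phi> \<gamma> (v \<epsilon>) B D"
    if "\<epsilon> \<in> {0<..1}" for \<epsilon>
    using that assms B D by (intro kg_bounded_solution.intro kg kg_bounded_solution_axioms.intro) auto

  \<comment> \<open>The Gronwall constant is nonnegative once admissible \<open>h\<close> and \<open>k\<close> are given; the maximum makes it
  nonnegative before they are chosen.\<close>
  define G where "G = max 0 (ewi_fs_error.error_const T0 B D A)"
  have G: "0 \<le> G" by (simp add: G_def)
  \<comment> \<open>Each of the two contributions to the uniform error, one of order \<open>h\<close> and one of order
  \<open>\<epsilon>^(2-3\<beta>) k^2 \<le> k0^2 \<le> k0\<close>, is to be at most \<open>1/2\<close>.\<close>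
  define h0 where "h0 = 1 / (2 * (K * (G + A)) + 1)"
  define k0 where "k0 = 1 / (2 * (K * G) + 1)"
  define C where "C = G + A + 1"
  have KA: "0 \<le> K * (G + A)" and KC: "0 \<le> K * G" using K G A0 by auto
  have h0: "0 < h0" "h0 \<le> 1" "K * (G + A) * h0 \<le> 1 / 2"
    using KA by (auto simp: h0_def pos_divide_le_eq)
  have k0: "0 < k0" "k0 \<le> 1" "K * G * k0 \<le> 1 / 2"
    using KC by (auto simp: k0_def pos_divide_le_eq)
  have C: "0 < C" using G A0 by (simp add: C_def)
  have main: "(\<forall>lam\<in>{0, 1::nat}.
        H_norm a b lam (\<lambda>x. complex_of_real (v \<epsilon> (real n * k) x) - ewi_fs a b \<beta> \<epsilon> \<phi> \<gamma> M k n x)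
          \<le> ereal (C * (h ^ (m0 - lam) + \<epsilon> powr (2 - 3 * \<beta>) * k\<^sup>2)))
      \<and> Linf_norm a b (ewi_fs a b \<beta> \<epsilon> \<phi> \<gamma> M k n) \<le> 1 + M1_bar a b \<beta> T0 v"
    if eps01: "0 < \<epsilon>" "\<epsilon> \<le> 1" and M: "0 < M" "even M" and mesh: "h = (b - a) / real M" "h \<le> h0"
      and step: "0 < k" "k \<le> \<epsilon> powr (max 0 (3 * \<beta> / 2 - 1)) * k0"
      and cfl: "k \<le> \<epsilon> powr \<beta> * pi * h
                    / (3 * sqrt (h\<^sup>2 + pi\<^sup>2 + \<epsilon>\<^sup>2 * real_of_ereal (M2_bar a b \<beta> T0 v) * h\<^sup>2))"
      and n: "real n \<le> T0 / k"
    for \<epsilon> k h and M n :: nat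
  proof -
    have \<epsilon>: "\<epsilon> \<in> {0<..1}" using eps01 by simp
    have hpos: "0 < h" using mesh(1) M ab by simp
    have h1: "h \<le> 1" using mesh(2) h0(2) by linarith
    have nk: "real n * k \<le> T0" using n step(1) by (simp add: pos_le_divide_eq)
    have cfl': "k \<le> \<epsilon> powr \<beta> * pi * h / (3 * sqrt (h\<^sup>2 + pi\<^sup>2))"
    proof (rule order_trans[OF cfl], rule divide_left_mono)
      show "3 * sqrt (h\<^sup>2 + pi\<^sup>2) \<le> 3 * sqrt (h\<^sup>2 + pi\<^sup>2 + \<epsilon>\<^sup>2 * real_of_ereal (M2_bar a b \<beta> T0 v) * h\<^sup>2)"
        using real_of_M2_bar_nonneg[of a b \<beta> T0 v] by simp
      have "0 < h\<^sup>2 + pi\<^sup>2" using hpos by (simp add: add_pos_pos)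
      then show "0 < 3 * sqrt (h\<^sup>2 + pi\<^sup>2 + \<epsilon>\<^sup>2 * real_of_ereal (M2_bar a b \<beta> T0 v) * h\<^sup>2) * (3 * sqrt (h\<^sup>2 + pi\<^sup>2))"
        using real_of_M2_bar_nonneg[of a b \<beta> T0 v] by (intro mult_pos_pos) (auto intro: add_pos_nonneg)
    qed (use hpos in auto)
    interpret ewi_fs_error a b \<beta> \<epsilon> T0 "max_existence_time a b \<beta> \<epsilon> \<phi> \<gamma>" \<phi> \<gamma> "v \<epsilon>" B D A h k m0 M
      using bounded[OF \<epsilon>] A[OF \<epsilon>] A0 m0 M mesh(1) h1 step(1) cfl' \<open>\<beta> \<le> 2\<close>
      by (intro ewi_fs_error.intro ewi_fs_error_axioms.intro) auto
    have error_const_eq: "ewi_fs_error.error_const T0 B D A = G"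
      using error_const_nonneg by (simp add: G_def)
    have rho: "\<rho> \<le> k0\<^sup>2"
    proof -
      let ?\<alpha> = "max 0 (3 * \<beta> / 2 - 1)"
      have exponent: "0 \<le> 2 - 3 * \<beta> + 2 * ?\<alpha>" by (auto simp: max_def)
      have "k\<^sup>2 \<le> (\<epsilon> powr ?\<alpha> * k0)\<^sup>2" using step by (intro power_mono) auto
      also have "\<dots> = \<epsilon> powr (2 * ?\<alpha>) * k0\<^sup>2"
        by (simp only: power_mult_distrib power2_eq_square[of "\<epsilon> powr _"] powr_add[symmetric] mult_2)
      finally have "\<rho> \<le> \<epsilon> powr (2 - 3 * \<beta>) * (\<epsilon> powr (2 * ?\<alpha>) * k0\<^sup>2)"
        unfolding \<rho>_def by (intro mult_left_mono) auto
      also have "\<dots> = \<epsilon> powr (2 - 3 * \<beta> + 2 * ?\<alpha>) * k0\<^sup>2" by (simp add: powr_add)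
      also have "\<dots> \<le> 1 * k0\<^sup>2"
        using powr_mono2[of "2 - 3 * \<beta> + 2 * ?\<alpha>" \<epsilon> 1] exponent eps01 by (intro mult_right_mono) auto
      finally show ?thesis by simp
    qed
    have hm: "h ^ m0 \<le> h" "h ^ (m0 - 1) \<le> h"
      using power_decreasing[of 1 m0 h] power_decreasing[of 1 "m0 - 1" h] hpos h1 m0 by auto
    have "k0\<^sup>2 \<le> k0" using k0 power_decreasing[of 1 2 k0] by simp
    then have "G * (h ^ m0 + \<rho>) + A * h ^ (m0 - 1) \<le> G * (h0 + k0) + A * h0"
      using hm mesh(2) rho G A0 by (intro add_mono mult_left_mono) auto
    then have "K * (G * (h ^ m0 + \<rho>) + A * h ^ (m0 - 1)) \<le> K * (G * (h0 + k0) + A * h0)"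
      using K by (rule mult_left_mono)
    also have "\<dots> = K * (G + A) * h0 + K * G * k0" by (simp add: algebra_simps)
    also have "\<dots> \<le> 1" using h0(3) k0(3) by linarith
    finally have small: "sobolev_const a b * (G * (h ^ m0 + \<rho>) + A * h ^ (m0 - 1)) \<le> 1" by (simp add: K_def)
    note est = error_bound[unfolded error_const_eq, OF small nk]
    have err: "err n = (\<lambda>x. complex_of_real (v \<epsilon> (real n * k) x) - ewi_fs a b \<beta> \<epsilon> \<phi> \<gamma> M k n x)"
      by (simp add: fun_eq_iff err_def)
    have Hj: "H_norm a b j (err n) \<le> ereal (C * (h ^ (m0 - j) + \<epsilon> powr (2 - 3 * \<beta>) * k\<^sup>2))" if j: "j \<le> 1" for j
    proof -
      obtain g where "weak_derivs a b j 2 (err n) g" using err_weak_derivs[OF nk j] by blast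
      then have "H_norm a b j (err n) \<le> ereal (G * (h ^ m0 + \<rho>) + A * h ^ (m0 - j))"
        using est j G A0 hpos rho_nonneg by (intro H_norm_leI) auto
      also have "G * (h ^ m0 + \<rho>) + A * h ^ (m0 - j) \<le> G * (h ^ (m0 - j) + \<rho>) + (A + 1) * (h ^ (m0 - j) + \<rho>)"
      proof (rule add_mono)
        show "G * (h ^ m0 + \<rho>) \<le> G * (h ^ (m0 - j) + \<rho>)"
          using G hpos h1 by (intro mult_left_mono add_right_mono power_decreasing) auto
        show "A * h ^ (m0 - j) \<le> (A + 1) * (h ^ (m0 - j) + \<rho>)"
          using A0 rho_nonneg hpos by (intro mult_mono) auto
      qed
      also have "\<dots> = C * (h ^ (m0 - j) + \<epsilon> powr (2 - 3 * \<beta>) * k\<^sup>2)"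
        by (simp add: C_def \<rho>_def algebra_simps)
      finally show ?thesis by simp
    qed
    have Linf: "Linf_norm a b (ewi_fs a b \<beta> \<epsilon> \<phi> \<gamma> M k n) \<le> 1 + M1_bar a b \<beta> T0 v"
      by (rule Linf_norm_le_1_plus_M1_bar[where v = v, OF ab T0 \<epsilon> continuous(1) continuous_vM time_grid[OF nk]])
        (use est in \<open>auto simp: err_def\<close>)
    show ?thesis
    proof (intro conjI ballI Linf)
      fix lam :: nat assume "lam \<in> {0, 1}"
      then have "lam \<le> 1" by auto
      from Hj[OF this]
      show "H_norm a b lam (\<lambda>x. complex_of_real (v \<epsilon> (real n * k) x) - ewi_fs a b \<beta> \<epsilon> \<phi> \<gamma> M k n x)
          \<le> ereal (C * (h ^ (m0 - lam) + \<epsilon> powr (2 - 3 * \<beta>) * k\<^sup>2))"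
        unfolding err .
    qed
  qed
  show ?thesis
    by (intro exI[of _ h0] exI[of _ k0] exI[of _ C] conjI h0(1) k0(1) C allI impI main) auto
qed

end
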